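(* Let $\Bbbk$ be a countable totally ordered division ring, let $T$ be a tree with least element $\bot$ in which every element has countable height, and let $\vec L=(L_s,\varphi_{s,t}\mid s\le t\text{ in }T)$ be a commutative $T$-indexed diagram of distributive $0$-lattices and $0$-lattice homomorphisms $\varphi_{s,t}\colon L_s\to L_t$ (with $\varphi_{s,s}$ the identity and $\varphi_{s,u}=\varphi_{t,u}\circ\varphi_{s,t}$ for $s\le t\le u$) such that $L_t$ is countable and completely normal whenever $t\in T\setminus\{\bot\}$. Let $I_\bot\subseteq\{\bot\}\times\omega$ and set $I_t=(T\mathbin{\downarrow}t)\times\omega$ for $t\in T\setminus\{\bot\}$, where $T\mathbin{\downarrow}t=\{s\in T:s\le t\}$. Then every $0$-lattice homomorphism $\chi_\bot\colon\mathrm{Id}_c\mathrm{F}_\ell(I_\bot,\Bbbk)\to L_\bot$ extends to a family $(\chi_t\mid t\in T)$ of $0$-lattice homomorphisms $\chi_t\colon\mathrm{Id}_c\mathrm{F}_\ell(I_t,\Bbbk)\to L_t$ such that $\chi_t\circ\eta_{I_s,I_t}=\varphi_{s,t}\circ\chi_s$ whenever $s\le t$ in $T$, and such that $\chi_t$ is a surjective lattice homomorphism whenever $t\in T\setminus\{\bot\}$.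
   Context: A tree is a poset with least element in which every principal down-set $\{s: s\le t\}$ is well-ordered; the height of $t$ is the order type of $\{s:s<t\}$ (countable height means this set is countable). A totally ordered division ring is a division ring with a compatible total order. $\mathrm{F}_\ell(I,\Bbbk)$ denotes the free left $\Bbbk$-vector lattice on the set $I$ (a left vector lattice being a left $\Bbbk$-vector space with a lattice order making it an $\ell$-group and with $\lambda x\ge 0$ for $\lambda\ge0$, $x\ge0$). $\mathrm{Id}_c F$ is the lattice of principal $\ell$-ideals (order-convex vector subspaces closed under the lattice operations, generated by one element) of a vector lattice $F$. For $I\subseteq J$, $\eta_{I,J}\colon\mathrm{Id}_c\mathrm{F}_\ell(I,\Bbbk)\to\mathrm{Id}_c\mathrm{F}_\ell(J,\Bbbk)$ is the canonical embedding induced by the vector lattice homomorphism $\mathrm{F}_\ell(I,\Bbbk)\to\mathrm{F}_\ell(J,\Bbbk)$ extending the inclusion $I\subseteq J$. A distributive $0$-lattice $D$ is completely normal if for all $a,b\in D$ there exist $x,y\in D$ with $a\vee b=a\vee y=x\vee b$ and $x\wedge y=0$. *)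

theory Defs
  imports "HOL-Algebra.Complete_Lattice" "HOL-Algebra.Group" "HOL-Library.Countable_Set"
begin

section \<open>Ordered division rings and trees\<close>

text \<open>The class \<^class>\<open>linordered_ring_strict\<close> carries an absolute value, but \<open>abs_if\<close> makes it
  definable from the order, so this is exactly a (not necessarily commutative) division ring with
  a compatible total order.\<close>

class linordered_division_ring = division_ring + linordered_ring_strict

class rooted_tree = order_bot +
  assumes down_set_well_ordered: "well_order_on {..t} {(x, y). x \<le> y \<and> y \<le> t}"


section \<open>Distributive lattices with zero\<close>

locale distributive_zero_lattice = lattice L + weak_partial_order_bottom L for L (structure) +
  assumes meet_join_distrib:
    "\<lbrakk>x \<in> carrier L; y \<in> carrier L; z \<in> carrier L\<rbrakk>
      \<Longrightarrow> x \<sqinter> (y \<squnion> z) = (x \<sqinter> y) \<squnion> (x \<sqinter> z)"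

definition zero_lattice_hom :: "'a gorder \<Rightarrow> 'b gorder \<Rightarrow> ('a \<Rightarrow> 'b) \<Rightarrow> bool" where
  "zero_lattice_hom L M f \<longleftrightarrow>
     f \<in> carrier L \<rightarrow> carrier M \<and> join_pres L M f \<and> meet_pres L M f \<and> f \<bottom>\<^bsub>L\<^esub> = \<bottom>\<^bsub>M\<^esub>"

definition completely_normal :: "'a gorder \<Rightarrow> bool" where
  "completely_normal L \<longleftrightarrow>
     (\<forall>a\<in>carrier L. \<forall>b\<in>carrier L. \<exists>x\<in>carrier L. \<exists>y\<in>carrier L.
        a \<squnion>\<^bsub>L\<^esub> b = a \<squnion>\<^bsub>L\<^esub> y \<and> a \<squnion>\<^bsub>L\<^esub> b = x \<squnion>\<^bsub>L\<^esub> b \<and> x \<sqinter>\<^bsub>L\<^esub> y = \<bottom>\<^bsub>L\<^esub>)"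


section \<open>Left vector lattices\<close>

record ('k, 'v) vector_lattice = "'v gorder" +
  vadd :: "'v \<Rightarrow> 'v \<Rightarrow> 'v" (infixl \<open>\<boxplus>\<index>\<close> 65)
  vzero :: "'v"
  vscale :: "'k \<Rightarrow> 'v \<Rightarrow> 'v" (infixr \<open>\<boxdot>\<index>\<close> 75)

definition additive_group :: "('k, 'v) vector_lattice \<Rightarrow> 'v monoid" where
  "additive_group V = \<lparr>carrier = carrier V, mult = vadd V, one = vzero V\<rparr>"

locale left_vector_lattice = lattice V
  for V :: "('k::linordered_division_ring, 'v) vector_lattice" (structure) +
  assumes additive_comm_group: "comm_group (additive_group V)"
    and vscale_closed: "x \<in> carrier V \<Longrightarrow> c \<boxdot> x \<in> carrier V"
    and vscale_add_right: "\<lbrakk>x \<in> carrier V; y \<in> carrier V\<rbrakk> \<Longrightarrow> c \<boxdot> (x \<boxplus> y) = c \<boxdot> x \<boxplus> c \<boxdot> y"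
    and vscale_add_left: "x \<in> carrier V \<Longrightarrow> (c + d) \<boxdot> x = c \<boxdot> x \<boxplus> d \<boxdot> x"
    and vscale_assoc: "x \<in> carrier V \<Longrightarrow> (c * d) \<boxdot> x = c \<boxdot> (d \<boxdot> x)"
    and vscale_one: "x \<in> carrier V \<Longrightarrow> 1 \<boxdot> x = x"
    and vadd_mono: "\<lbrakk>x \<in> carrier V; y \<in> carrier V; z \<in> carrier V; x \<sqsubseteq> y\<rbrakk> \<Longrightarrow> x \<boxplus> z \<sqsubseteq> y \<boxplus> z"
    and vscale_nonneg: "\<lbrakk>x \<in> carrier V; 0 \<le> c; vzero V \<sqsubseteq> x\<rbrakk> \<Longrightarrow> vzero V \<sqsubseteq> c \<boxdot> x"

definition vector_lattice_hom ::
  "('k, 'v) vector_lattice \<Rightarrow> ('k, 'w) vector_lattice \<Rightarrow> ('v \<Rightarrow> 'w) \<Rightarrow> bool" where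
  "vector_lattice_hom V W h \<longleftrightarrow>
     h \<in> carrier V \<rightarrow> carrier W \<and>
     (\<forall>x\<in>carrier V. \<forall>y\<in>carrier V. h (x \<boxplus>\<^bsub>V\<^esub> y) = h x \<boxplus>\<^bsub>W\<^esub> h y) \<and>
     (\<forall>c. \<forall>x\<in>carrier V. h (c \<boxdot>\<^bsub>V\<^esub> x) = c \<boxdot>\<^bsub>W\<^esub> h x) \<and>
     join_pres V W h \<and> meet_pres V W h"


section \<open>Principal l-ideals\<close>

definition l_ideal :: "('k, 'v) vector_lattice \<Rightarrow> 'v set \<Rightarrow> bool" where
  "l_ideal V A \<longleftrightarrow>
     A \<subseteq> carrier V \<and> vzero V \<in> A \<and>
     (\<forall>x\<in>A. \<forall>y\<in>A. x \<boxplus>\<^bsub>V\<^esub> y \<in> A) \<and>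
     (\<forall>c. \<forall>x\<in>A. c \<boxdot>\<^bsub>V\<^esub> x \<in> A) \<and>
     (\<forall>x\<in>A. \<forall>y\<in>A. x \<squnion>\<^bsub>V\<^esub> y \<in> A \<and> x \<sqinter>\<^bsub>V\<^esub> y \<in> A) \<and>
     (\<forall>x\<in>A. \<forall>y\<in>A. \<forall>z\<in>carrier V. x \<sqsubseteq>\<^bsub>V\<^esub> z \<and> z \<sqsubseteq>\<^bsub>V\<^esub> y \<longrightarrow> z \<in> A)"

definition l_ideal_gen :: "('k, 'v) vector_lattice \<Rightarrow> 'v set \<Rightarrow> 'v set" where
  "l_ideal_gen V S = \<Inter>{A. l_ideal V A \<and> S \<subseteq> A}"

definition Id_c :: "('k, 'v) vector_lattice \<Rightarrow> 'v set gorder" where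
  "Id_c V = \<lparr>carrier = (\<lambda>a. l_ideal_gen V {a}) ` carrier V, eq = (=), le = (\<subseteq>)\<rparr>"

text \<open>The action of \<^const>\<open>Id_c\<close> on a homomorphism \<open>h\<close> into \<open>W\<close>. It sends the l-ideal generated by
  \<open>a\<close> to the one generated by \<open>h a\<close>; see \<open>Id_c_map_principal\<close> below.\<close>

definition Id_c_map :: "('k, 'w) vector_lattice \<Rightarrow> ('v \<Rightarrow> 'w) \<Rightarrow> 'v set \<Rightarrow> 'w set" where
  "Id_c_map W h A = l_ideal_gen W (h ` A)"

lemma l_ideal_gen_superset: "S \<subseteq> l_ideal_gen V S"
  by (auto simp: l_ideal_gen_def)

lemma l_ideal_gen_least: "l_ideal V A \<Longrightarrow> S \<subseteq> A \<Longrightarrow> l_ideal_gen V S \<subseteq> A"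
  by (auto simp: l_ideal_gen_def)

lemma (in left_vector_lattice) l_ideal_carrier: "l_ideal V (carrier V)"
proof -
  interpret G: comm_group "additive_group V" by (rule additive_comm_group)
  have "vzero V \<in> carrier V"
    using G.one_closed by (simp add: additive_group_def)
  moreover have "x \<boxplus> y \<in> carrier V" if "x \<in> carrier V" "y \<in> carrier V" for x y
    using G.m_closed[of x y] that by (simp add: additive_group_def)
  ultimately show ?thesis
    by (auto simp: l_ideal_def vscale_closed)
qed

lemma l_ideal_gen_l_ideal:
  assumes "left_vector_lattice V" and "S \<subseteq> carrier V"
  shows "l_ideal V (l_ideal_gen V S)"
proof -
  have "l_ideal_gen V S \<subseteq> carrier V"
    using l_ideal_gen_least left_vector_lattice.l_ideal_carrier[OF assms(1)] assms(2) by blast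
  then show ?thesis
    unfolding l_ideal_def l_ideal_gen_def by blast
qed

lemma vector_lattice_hom_zero:
  assumes V: "left_vector_lattice V" and W: "left_vector_lattice W" and h: "vector_lattice_hom V W h"
  shows "h (vzero V) = vzero W"
proof -
  interpret GV: comm_group "additive_group V"
    by (rule left_vector_lattice.additive_comm_group[OF V])
  interpret GW: comm_group "additive_group W"
    by (rule left_vector_lattice.additive_comm_group[OF W])
  have "h \<in> hom (additive_group V) (additive_group W)"
    using h by (auto simp: hom_def vector_lattice_hom_def additive_group_def)
  then have "h \<one>\<^bsub>additive_group V\<^esub> = \<one>\<^bsub>additive_group W\<^esub>"
    by (rule hom_one) (unfold_locales)
  then show ?thesis by (simp add: additive_group_def)
qed

lemma vector_lattice_hom_vimage_l_ideal:
  assumes V: "left_vector_lattice V" and W: "left_vector_lattice W" and h: "vector_lattice_hom V W h"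
    and B: "l_ideal W B"
  shows "l_ideal V {x \<in> carrier V. h x \<in> B}"
proof -
  interpret V: left_vector_lattice V by fact
  have mono: "h x \<sqsubseteq>\<^bsub>W\<^esub> h y" if "x \<in> carrier V" "y \<in> carrier V" "x \<sqsubseteq>\<^bsub>V\<^esub> y" for x y
    using h that join_pres_isotone[of h V W] by (auto simp: vector_lattice_hom_def isotone_def)
  note C = V.l_ideal_carrier[unfolded l_ideal_def]
  note D = B[unfolded l_ideal_def]
  note H = h[unfolded vector_lattice_hom_def join_pres_def meet_pres_def]
  show ?thesis
    unfolding l_ideal_def
  proof (intro conjI ballI allI impI)
    show "vzero V \<in> {x \<in> carrier V. h x \<in> B}"
      using vector_lattice_hom_zero[OF V W h] C D by simp
  next
    fix x c assume "x \<in> {x \<in> carrier V. h x \<in> B}"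
    then show "c \<boxdot>\<^bsub>V\<^esub> x \<in> {x \<in> carrier V. h x \<in> B}"
      using C D H by simp
  next
    fix x y assume xy: "x \<in> {x \<in> carrier V. h x \<in> B}" "y \<in> {x \<in> carrier V. h x \<in> B}"
    then show "x \<boxplus>\<^bsub>V\<^esub> y \<in> {x \<in> carrier V. h x \<in> B}"
      using C D H by simp
    show "x \<squnion>\<^bsub>V\<^esub> y \<in> {x \<in> carrier V. h x \<in> B}"
      using xy C D H by simp
    show "x \<sqinter>\<^bsub>V\<^esub> y \<in> {x \<in> carrier V. h x \<in> B}"
      using xy C D H by simp
    fix z assume z: "z \<in> carrier V" "x \<sqsubseteq>\<^bsub>V\<^esub> z \<and> z \<sqsubseteq>\<^bsub>V\<^esub> y"
    have convex: "r \<in> B" if "p \<in> B" "q \<in> B" "r \<in> carrier W" "p \<sqsubseteq>\<^bsub>W\<^esub> r" "r \<sqsubseteq>\<^bsub>W\<^esub> q" for p q r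
      using D that by metis
    have h_closed: "h u \<in> carrier W" if "u \<in> carrier V" for u
      using funcset_mem[OF conjunct1[OF H] that] .
    have "h z \<in> B"
    proof (rule convex)
      show "h x \<in> B" and "h y \<in> B" using xy by simp_all
      show "h z \<in> carrier W" using z by (intro h_closed) simp
      show "h x \<sqsubseteq>\<^bsub>W\<^esub> h z" using xy z by (intro mono) simp_all
      show "h z \<sqsubseteq>\<^bsub>W\<^esub> h y" using xy z by (intro mono) simp_all
    qed
    then show "z \<in> {x \<in> carrier V. h x \<in> B}"
      using z by simp
  qed auto
qed

lemma Id_c_map_principal:
  assumes V: "left_vector_lattice V" and W: "left_vector_lattice W" and h: "vector_lattice_hom V W h"
    and a: "a \<in> carrier V"
  shows "Id_c_map W h (l_ideal_gen V {a}) = l_ideal_gen W {h a}"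
proof
  have "h a \<in> carrier W" using h a by (auto simp: vector_lattice_hom_def)
  then have "l_ideal W (l_ideal_gen W {h a})" by (intro l_ideal_gen_l_ideal W) auto
  note * = vector_lattice_hom_vimage_l_ideal[OF V W h this]
  have "l_ideal_gen V {a} \<subseteq> {x \<in> carrier V. h x \<in> l_ideal_gen W {h a}}"
    using a l_ideal_gen_superset[of "{h a}" W] by (intro l_ideal_gen_least *) auto
  then show "Id_c_map W h (l_ideal_gen V {a}) \<subseteq> l_ideal_gen W {h a}"
    unfolding Id_c_map_def
    by (intro l_ideal_gen_least \<open>l_ideal W (l_ideal_gen W {h a})\<close>) auto
  show "l_ideal_gen W {h a} \<subseteq> Id_c_map W h (l_ideal_gen V {a})"
    unfolding Id_c_map_def l_ideal_gen_def by auto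
qed


section \<open>Free left vector lattices\<close>

text \<open>The free left vector lattice is the algebra of vector lattice terms modulo the least preorder
  turning it into a left vector lattice.  Its elements are classes of terms over the whole type of
  generators; the object free on a set \<open>I\<close> consists of the classes of terms with generators in
  \<open>I\<close>.  The usual universal property is theorem \<open>free_vector_lattice_universal\<close> below.\<close>

datatype (dead 'k, gens: 'i) vl_term =
    Gen 'i
  | Zero
  | Add "('k, 'i) vl_term" "('k, 'i) vl_term"
  | Scale 'k "('k, 'i) vl_term"
  | Join "('k, 'i) vl_term" "('k, 'i) vl_term"
  | Meet "('k, 'i) vl_term" "('k, 'i) vl_term"

inductive vl_le :: "('k::linordered_division_ring, 'i) vl_term \<Rightarrow> ('k, 'i) vl_term \<Rightarrow> bool"
    (infix \<open>\<preceq>\<^sub>v\<close> 50) where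
  vl_refl: "s \<preceq>\<^sub>v s"
| vl_trans: "s \<preceq>\<^sub>v t \<Longrightarrow> t \<preceq>\<^sub>v u \<Longrightarrow> s \<preceq>\<^sub>v u"
| vl_add_assoc: "Add (Add s t) u \<preceq>\<^sub>v Add s (Add t u)"
| vl_add_comm: "Add s t \<preceq>\<^sub>v Add t s"
| vl_add_zero1: "Add s Zero \<preceq>\<^sub>v s"
| vl_add_zero2: "s \<preceq>\<^sub>v Add s Zero"
| vl_add_neg1: "Add s (Scale (-1) s) \<preceq>\<^sub>v Zero"
| vl_add_neg2: "Zero \<preceq>\<^sub>v Add s (Scale (-1) s)"
| vl_add_mono: "s \<preceq>\<^sub>v t \<Longrightarrow> Add s u \<preceq>\<^sub>v Add t u"
| vl_scale_cong: "s \<preceq>\<^sub>v t \<Longrightarrow> t \<preceq>\<^sub>v s \<Longrightarrow> Scale c s \<preceq>\<^sub>v Scale c t"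
| vl_scale_mono: "0 \<le> c \<Longrightarrow> s \<preceq>\<^sub>v t \<Longrightarrow> Scale c s \<preceq>\<^sub>v Scale c t"
| vl_scale_add_right1: "Scale c (Add s t) \<preceq>\<^sub>v Add (Scale c s) (Scale c t)"
| vl_scale_add_right2: "Add (Scale c s) (Scale c t) \<preceq>\<^sub>v Scale c (Add s t)"
| vl_scale_add_left1: "Scale (c + d) s \<preceq>\<^sub>v Add (Scale c s) (Scale d s)"
| vl_scale_add_left2: "Add (Scale c s) (Scale d s) \<preceq>\<^sub>v Scale (c + d) s"
| vl_scale_assoc1: "Scale (c * d) s \<preceq>\<^sub>v Scale c (Scale d s)"
| vl_scale_assoc2: "Scale c (Scale d s) \<preceq>\<^sub>v Scale (c * d) s"
| vl_scale_one1: "Scale 1 s \<preceq>\<^sub>v s"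
| vl_scale_one2: "s \<preceq>\<^sub>v Scale 1 s"
| vl_join_upper1: "s \<preceq>\<^sub>v Join s t"
| vl_join_upper2: "t \<preceq>\<^sub>v Join s t"
| vl_join_least: "s \<preceq>\<^sub>v u \<Longrightarrow> t \<preceq>\<^sub>v u \<Longrightarrow> Join s t \<preceq>\<^sub>v u"
| vl_meet_lower1: "Meet s t \<preceq>\<^sub>v s"
| vl_meet_lower2: "Meet s t \<preceq>\<^sub>v t"
| vl_meet_greatest: "u \<preceq>\<^sub>v s \<Longrightarrow> u \<preceq>\<^sub>v t \<Longrightarrow> u \<preceq>\<^sub>v Meet s t"

definition vl_equiv :: "('k::linordered_division_ring, 'i) vl_term \<Rightarrow> ('k, 'i) vl_term \<Rightarrow> bool" where
  "vl_equiv s t \<longleftrightarrow> s \<preceq>\<^sub>v t \<and> t \<preceq>\<^sub>v s"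

lemma equivp_vl_equiv: "equivp (vl_equiv :: ('k::linordered_division_ring, 'i) vl_term \<Rightarrow> _)"
  by (intro equivpI reflpI sympI transpI) (auto simp: vl_equiv_def intro: vl_refl vl_trans)

quotient_type (overloaded) ('k, 'i) free_vl = "('k::linordered_division_ring, 'i) vl_term" / vl_equiv
  by (rule equivp_vl_equiv)

declare vl_trans [trans]

lemma vl_add_mono2: "s \<preceq>\<^sub>v s' \<Longrightarrow> t \<preceq>\<^sub>v t' \<Longrightarrow> Add s t \<preceq>\<^sub>v Add s' t'"
  by (meson vl_add_comm vl_add_mono vl_trans)

lift_definition fv_gen :: "'i \<Rightarrow> ('k::linordered_division_ring, 'i) free_vl" is Gen .

lift_definition fv_zero :: "('k::linordered_division_ring, 'i) free_vl" is Zero .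

lift_definition fv_add ::
    "('k::linordered_division_ring, 'i) free_vl \<Rightarrow> ('k, 'i) free_vl \<Rightarrow> ('k, 'i) free_vl" is Add
  by (auto simp: vl_equiv_def intro: vl_add_mono2)

lift_definition fv_scale ::
    "'k::linordered_division_ring \<Rightarrow> ('k, 'i) free_vl \<Rightarrow> ('k, 'i) free_vl" is Scale
  by (auto simp: vl_equiv_def intro: vl_scale_cong)

lift_definition fv_le ::
    "('k::linordered_division_ring, 'i) free_vl \<Rightarrow> ('k, 'i) free_vl \<Rightarrow> bool" is vl_le
  by (auto simp: vl_equiv_def intro: vl_trans)

lift_definition fv_class :: "('k::linordered_division_ring, 'i) vl_term \<Rightarrow> ('k, 'i) free_vl"
  is "\<lambda>t. t" .

definition free_vector_lattice ::
    "'i set \<Rightarrow> ('k::linordered_division_ring, ('k, 'i) free_vl) vector_lattice" where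
  "free_vector_lattice I =
     \<lparr>carrier = fv_class ` {t. gens t \<subseteq> I}, eq = (=), le = fv_le,
      vadd = fv_add, vzero = fv_zero, vscale = fv_scale\<rparr>"

primrec vl_eval :: "('k, 'v) vector_lattice \<Rightarrow> ('i \<Rightarrow> 'v) \<Rightarrow> ('k, 'i) vl_term \<Rightarrow> 'v" where
  "vl_eval V f (Gen i) = f i"
| "vl_eval V f Zero = vzero V"
| "vl_eval V f (Add s t) = vl_eval V f s \<boxplus>\<^bsub>V\<^esub> vl_eval V f t"
| "vl_eval V f (Scale c t) = c \<boxdot>\<^bsub>V\<^esub> vl_eval V f t"
| "vl_eval V f (Join s t) = vl_eval V f s \<squnion>\<^bsub>V\<^esub> vl_eval V f t"
| "vl_eval V f (Meet s t) = vl_eval V f s \<sqinter>\<^bsub>V\<^esub> vl_eval V f t"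

text \<open>The homomorphism from the object free on \<open>I\<close> to \<open>V\<close> that extends \<open>f\<close> on \<open>I\<close>.\<close>

definition free_vl_lift ::
    "'i set \<Rightarrow> ('k::linordered_division_ring, 'v) vector_lattice \<Rightarrow> ('i \<Rightarrow> 'v)
      \<Rightarrow> ('k, 'i) free_vl \<Rightarrow> 'v" where
  "free_vl_lift I V f X = vl_eval V f (SOME t. fv_class t = X \<and> gens t \<subseteq> I)"

lemma fv_class_eq_iff: "fv_class s = fv_class t \<longleftrightarrow> s \<preceq>\<^sub>v t \<and> t \<preceq>\<^sub>v s"
  by transfer (simp add: vl_equiv_def)

lemma fv_le_class: "fv_le (fv_class s) (fv_class t) \<longleftrightarrow> s \<preceq>\<^sub>v t"
  by transfer simp

lemma fv_class_simps:
  "fv_gen i = fv_class (Gen i)"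
  "fv_zero = fv_class Zero"
  "fv_add (fv_class s) (fv_class t) = fv_class (Add s t)"
  "fv_scale c (fv_class s) = fv_class (Scale c s)"
  by (simp_all add: fv_gen.abs_eq fv_zero.abs_eq fv_add.abs_eq fv_scale.abs_eq fv_class.abs_eq)

lemma free_vector_lattice_simps [simp]:
  "carrier (free_vector_lattice I) = fv_class ` {t. gens t \<subseteq> I}"
  "eq (free_vector_lattice I) = (=)"
  "le (free_vector_lattice I) = fv_le"
  "vadd (free_vector_lattice I) = fv_add"
  "vzero (free_vector_lattice I) = fv_zero"
  "vscale (free_vector_lattice I) = fv_scale"
  by (simp_all add: free_vector_lattice_def)

lemma free_vl_partial_order: "partial_order (free_vector_lattice I)"
  by unfold_locales
     (auto simp: fv_le_class fv_class_eq_iff intro: vl_refl vl_trans)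

lemma free_vl_is_lub:
  assumes "gens s \<subseteq> I" "gens t \<subseteq> I"
  shows "least (free_vector_lattice I) (fv_class (Join s t))
           (Upper (free_vector_lattice I) {fv_class s, fv_class t})"
  using assms
  unfolding least_def Upper_def
  by (auto simp: fv_le_class intro!: vl_join_upper1 vl_join_upper2 vl_join_least imageI)

lemma free_vl_is_glb:
  assumes "gens s \<subseteq> I" "gens t \<subseteq> I"
  shows "greatest (free_vector_lattice I) (fv_class (Meet s t))
           (Lower (free_vector_lattice I) {fv_class s, fv_class t})"
  using assms
  unfolding greatest_def Lower_def
  by (auto simp: fv_le_class intro!: vl_meet_lower1 vl_meet_lower2 vl_meet_greatest imageI)

lemma free_vl_lattice: "lattice (free_vector_lattice I)" (is "lattice ?F")
proof -
  interpret partial_order ?F by (rule free_vl_partial_order)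
  show ?thesis
  proof unfold_locales
    fix x y
    assume "x \<in> carrier (?F)" "y \<in> carrier (?F)"
    then obtain s t where "x = fv_class s" "gens s \<subseteq> I" "y = fv_class t" "gens t \<subseteq> I"
      by auto
    then show "\<exists>s. least (?F) s (Upper (?F) {x, y})"
      and "\<exists>s. greatest (?F) s (Lower (?F) {x, y})"
      using free_vl_is_lub free_vl_is_glb by metis+
  qed
qed

lemma free_vl_join_meet:
  assumes "gens s \<subseteq> I" "gens t \<subseteq> I"
  shows "fv_class s \<squnion>\<^bsub>free_vector_lattice I\<^esub> fv_class t = fv_class (Join s t)"
    and "fv_class s \<sqinter>\<^bsub>free_vector_lattice I\<^esub> fv_class t = fv_class (Meet s t)"
proof -
  interpret partial_order "free_vector_lattice I" by (rule free_vl_partial_order)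
  show "fv_class s \<squnion>\<^bsub>free_vector_lattice I\<^esub> fv_class t = fv_class (Join s t)"
    unfolding join_def sup_def
    by (rule some_equality) (use free_vl_is_lub[OF assms] least_unique in blast)+
  show "fv_class s \<sqinter>\<^bsub>free_vector_lattice I\<^esub> fv_class t = fv_class (Meet s t)"
    unfolding meet_def inf_def
    by (rule some_equality) (use free_vl_is_glb[OF assms] greatest_unique in blast)+
qed

theorem free_vector_lattice_left_vector_lattice:
  "left_vector_lattice (free_vector_lattice I :: ('k::linordered_division_ring, _) vector_lattice)"
proof -
  let ?F = "free_vector_lattice I :: ('k, _) vector_lattice"
  interpret lattice ?F by (rule free_vl_lattice)
  have assoc': "Add s (Add t u) \<preceq>\<^sub>v Add (Add s t) u" for s t u :: "('k, 'a) vl_term"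
  proof -
    have "Add s (Add t u) \<preceq>\<^sub>v Add (Add t u) s" by (rule vl_add_comm)
    also have "\<dots> \<preceq>\<^sub>v Add t (Add u s)" by (rule vl_add_assoc)
    also have "\<dots> \<preceq>\<^sub>v Add (Add u s) t" by (rule vl_add_comm)
    also have "\<dots> \<preceq>\<^sub>v Add u (Add s t)" by (rule vl_add_assoc)
    also have "\<dots> \<preceq>\<^sub>v Add (Add s t) u" by (rule vl_add_comm)
    finally show ?thesis .
  qed
  have scale_zero: "Zero \<preceq>\<^sub>v Scale c Zero" for c :: 'k
  proof -
    have "Zero \<preceq>\<^sub>v Add (Scale c Zero) (Scale (-1) (Scale c Zero))" by (rule vl_add_neg2)
    also have "\<dots> \<preceq>\<^sub>v Add (Scale c (Add Zero Zero)) (Scale (-1) (Scale c Zero))"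
      by (intro vl_add_mono vl_scale_cong vl_add_zero1 vl_add_zero2)
    also have "\<dots> \<preceq>\<^sub>v Add (Add (Scale c Zero) (Scale c Zero)) (Scale (-1) (Scale c Zero))"
      by (intro vl_add_mono vl_scale_add_right1)
    also have "\<dots> \<preceq>\<^sub>v Add (Scale c Zero) (Add (Scale c Zero) (Scale (-1) (Scale c Zero)))"
      by (rule vl_add_assoc)
    also have "\<dots> \<preceq>\<^sub>v Add (Scale c Zero) Zero"
      by (intro vl_add_mono2 vl_refl vl_add_neg1)
    also have "\<dots> \<preceq>\<^sub>v Scale c Zero" by (rule vl_add_zero1)
    finally show ?thesis .
  qed
  have grp: "comm_group (additive_group ?F)"
  proof (rule comm_groupI)
    fix x assume "x \<in> carrier (additive_group ?F)"
    then obtain s where s: "x = fv_class s" "gens s \<subseteq> I" by (auto simp: additive_group_def)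
    show "\<exists>y\<in>carrier (additive_group ?F).
        y \<otimes>\<^bsub>additive_group ?F\<^esub> x = \<one>\<^bsub>additive_group ?F\<^esub>"
    proof
      show "fv_class (Scale (-1) s) \<in> carrier (additive_group ?F)"
        using s by (simp add: additive_group_def)
      show "fv_class (Scale (-1) s) \<otimes>\<^bsub>additive_group ?F\<^esub> x = \<one>\<^bsub>additive_group ?F\<^esub>"
        using s vl_trans[OF vl_add_comm vl_add_neg1, of s] vl_trans[OF vl_add_neg2 vl_add_comm, of s]
        by (simp add: additive_group_def fv_class_simps fv_class_eq_iff)
    qed
    show "\<one>\<^bsub>additive_group ?F\<^esub> \<otimes>\<^bsub>additive_group ?F\<^esub> x = x"
      using s vl_trans[OF vl_add_comm vl_add_zero1, of s] vl_trans[OF vl_add_zero2 vl_add_comm, of s]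
      by (simp add: additive_group_def fv_class_simps fv_class_eq_iff)
  next
    fix x y assume "x \<in> carrier (additive_group ?F)" "y \<in> carrier (additive_group ?F)"
    then obtain s t where st: "x = fv_class s" "gens s \<subseteq> I" "y = fv_class t" "gens t \<subseteq> I"
      by (auto simp: additive_group_def)
    then show "x \<otimes>\<^bsub>additive_group ?F\<^esub> y \<in> carrier (additive_group ?F)"
      by (simp add: additive_group_def fv_class_simps)
    show "x \<otimes>\<^bsub>additive_group ?F\<^esub> y = y \<otimes>\<^bsub>additive_group ?F\<^esub> x"
      using st by (simp add: additive_group_def fv_class_simps fv_class_eq_iff vl_add_comm)
    fix z assume "z \<in> carrier (additive_group ?F)"
    then obtain u where "z = fv_class u" by (auto simp: additive_group_def)
    then show "x \<otimes>\<^bsub>additive_group ?F\<^esub> y \<otimes>\<^bsub>additive_group ?F\<^esub> z =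
        x \<otimes>\<^bsub>additive_group ?F\<^esub> (y \<otimes>\<^bsub>additive_group ?F\<^esub> z)"
      using st by (simp add: additive_group_def fv_class_simps fv_class_eq_iff vl_add_assoc assoc')
  next
    show "\<one>\<^bsub>additive_group ?F\<^esub> \<in> carrier (additive_group ?F)"
      by (simp add: additive_group_def fv_class_simps)
  qed
  show ?thesis
  proof (intro left_vector_lattice.intro left_vector_lattice_axioms.intro free_vl_lattice grp)
    fix x and c d :: 'k assume "x \<in> carrier ?F"
    then obtain s where s: "x = fv_class s" "gens s \<subseteq> I" by auto
    show "c \<boxdot>\<^bsub>?F\<^esub> x \<in> carrier ?F"
      using s by (simp add: fv_class_simps)
    show "(c + d) \<boxdot>\<^bsub>?F\<^esub> x = c \<boxdot>\<^bsub>?F\<^esub> x \<boxplus>\<^bsub>?F\<^esub> d \<boxdot>\<^bsub>?F\<^esub> x"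
      using s by (simp add: fv_class_simps fv_class_eq_iff vl_scale_add_left1 vl_scale_add_left2)
    show "(c * d) \<boxdot>\<^bsub>?F\<^esub> x = c \<boxdot>\<^bsub>?F\<^esub> (d \<boxdot>\<^bsub>?F\<^esub> x)"
      using s by (simp add: fv_class_simps fv_class_eq_iff vl_scale_assoc1 vl_scale_assoc2)
    show "1 \<boxdot>\<^bsub>?F\<^esub> x = x"
      using s by (simp add: fv_class_simps fv_class_eq_iff vl_scale_one1 vl_scale_one2)
    assume "0 \<le> c" and "vzero ?F \<sqsubseteq>\<^bsub>?F\<^esub> x"
    then have "Scale c Zero \<preceq>\<^sub>v Scale c s"
      using s by (simp add: fv_class_simps fv_le_class vl_scale_mono)
    with s vl_trans[OF scale_zero] show "vzero ?F \<sqsubseteq>\<^bsub>?F\<^esub> c \<boxdot>\<^bsub>?F\<^esub> x"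
      by (simp add: fv_class_simps fv_le_class)
  next
    fix x y and c :: 'k assume "x \<in> carrier ?F" "y \<in> carrier ?F"
    then obtain s t where "x = fv_class s" "y = fv_class t" by auto
    then show "c \<boxdot>\<^bsub>?F\<^esub> (x \<boxplus>\<^bsub>?F\<^esub> y) = c \<boxdot>\<^bsub>?F\<^esub> x \<boxplus>\<^bsub>?F\<^esub> c \<boxdot>\<^bsub>?F\<^esub> y"
      by (simp add: fv_class_simps fv_class_eq_iff vl_scale_add_right1 vl_scale_add_right2)
  next
    fix x y z
    assume "x \<in> carrier ?F" "y \<in> carrier ?F" "z \<in> carrier ?F" and le: "x \<sqsubseteq>\<^bsub>?F\<^esub> y"
    then obtain s t u where "x = fv_class s" "y = fv_class t" "z = fv_class u" by auto
    with le show "x \<boxplus>\<^bsub>?F\<^esub> z \<sqsubseteq>\<^bsub>?F\<^esub> y \<boxplus>\<^bsub>?F\<^esub> z"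
      by (simp add: fv_class_simps fv_le_class vl_add_mono)
  qed
qed

lemma (in left_vector_lattice) vl_eval_closed:
  assumes "\<And>i. i \<in> gens t \<Longrightarrow> f i \<in> carrier V"
  shows "vl_eval V f t \<in> carrier V"
proof -
  interpret G: comm_group "additive_group V" by (rule additive_comm_group)
  have "vzero V \<in> carrier V"
    using G.one_closed by (simp add: additive_group_def)
  moreover have "x \<boxplus> y \<in> carrier V" if "x \<in> carrier V" "y \<in> carrier V" for x y
    using G.m_closed[of x y] that by (simp add: additive_group_def)
  ultimately show ?thesis
    using assms by (induction t) (auto simp: vscale_closed)
qed

lemma (in left_vector_lattice) vscale_mono:
  assumes "x \<in> carrier V" "y \<in> carrier V" "0 \<le> c" "x \<sqsubseteq> y"
  shows "c \<boxdot> x \<sqsubseteq> c \<boxdot> y"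
proof -
  interpret G: comm_group "additive_group V" by (rule additive_comm_group)
  have add_closed: "u \<boxplus> v \<in> carrier V" if "u \<in> carrier V" "v \<in> carrier V" for u v
    using G.m_closed[of u v] that by (simp add: additive_group_def)
  have zero: "vzero V \<in> carrier V" "vzero V \<boxplus> u = u" if "u \<in> carrier V" for u
    using G.one_closed G.l_one[of u] that by (simp_all add: additive_group_def)
  define x' where "x' = inv\<^bsub>additive_group V\<^esub> x"
  have x': "x' \<in> carrier V" "x \<boxplus> x' = vzero V" "x' \<boxplus> x = vzero V"
    using G.inv_closed[of x] G.r_inv[of x] G.l_inv[of x] assms(1)
    by (simp_all add: additive_group_def x'_def)
  let ?d = "y \<boxplus> x'"
  have d: "?d \<in> carrier V" by (intro add_closed assms x')
  have "vzero V \<sqsubseteq> ?d"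
    using vadd_mono[OF assms(1,2) x'(1) assms(4)] x' by simp
  then have "vzero V \<sqsubseteq> c \<boxdot> ?d"
    by (intro vscale_nonneg d assms)
  then have "vzero V \<boxplus> c \<boxdot> x \<sqsubseteq> c \<boxdot> ?d \<boxplus> c \<boxdot> x"
    by (intro vadd_mono vscale_closed d assms(1) zero[OF d])
  also have "c \<boxdot> ?d \<boxplus> c \<boxdot> x = c \<boxdot> (?d \<boxplus> x)"
    by (simp add: vscale_add_right d assms)
  also have "?d \<boxplus> x = y"
    using G.m_assoc[of y x' x] G.r_one[of y] assms x' by (simp add: additive_group_def)
  finally show ?thesis
    using zero(2)[OF vscale_closed[OF assms(1)]] by simp
qed

lemma (in left_vector_lattice) vl_eval_mono:
  assumes f: "\<And>i. f i \<in> carrier V" and "s \<preceq>\<^sub>v t"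
  shows "vl_eval V f s \<sqsubseteq> vl_eval V f t"
proof -
  interpret G: comm_group "additive_group V" by (rule additive_comm_group)
  have closed: "vl_eval V f u \<in> carrier V" for u
    by (rule vl_eval_closed) (rule f)
  have zero: "vzero V \<in> carrier V"
    using G.one_closed by (simp add: additive_group_def)
  have add: "x \<boxplus> y \<in> carrier V" "x \<boxplus> y = y \<boxplus> x" "x \<boxplus> vzero V = x"
    if "x \<in> carrier V" "y \<in> carrier V" for x y
    using G.m_closed[of x y] G.m_comm[of x y] G.r_one[of x] that
    by (simp_all add: additive_group_def)
  have assoc: "(x \<boxplus> y) \<boxplus> z = x \<boxplus> (y \<boxplus> z)"
    if "x \<in> carrier V" "y \<in> carrier V" "z \<in> carrier V" for x y z
    using G.m_assoc[of x y z] that by (simp add: additive_group_def)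
  have neg: "x \<boxplus> (-1) \<boxdot> x = vzero V" if x: "x \<in> carrier V" for x
  proof -
    have "0 \<boxdot> x \<boxplus> 0 \<boxdot> x = 0 \<boxdot> x"
      using vscale_add_left[OF x, of 0 0] by simp
    then have "0 \<boxdot> x = vzero V"
      using G.l_cancel_one[of "0 \<boxdot> x" "0 \<boxdot> x"] vscale_closed[OF x, of 0]
      by (simp add: additive_group_def)
    then show ?thesis
      using vscale_add_left[OF x, of 1 "-1"] vscale_one[OF x] by simp
  qed
  from \<open>s \<preceq>\<^sub>v t\<close> show ?thesis
  proof (induction rule: vl_le.induct)
    case (vl_trans s t u)
    show ?case by (rule le_trans[OF vl_trans.IH closed closed closed])
  next
    case (vl_scale_cong s t c)
    have "vl_eval V f s = vl_eval V f t"
      by (rule le_antisym[OF vl_scale_cong.IH closed closed])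
    then show ?case by (simp add: vscale_closed closed)
  next
    case (vl_add_comm s t)
    then show ?case using add(1,2)[OF closed closed] by simp
  next
    case (vl_add_mono s t u)
    then show ?case by (simp add: vadd_mono closed)
  next
    case (vl_scale_mono c s t)
    then show ?case by (simp add: vscale_mono closed)
  next
    case (vl_join_least s u t)
    then show ?case by (simp add: join_le closed)
  next
    case (vl_meet_greatest u s t)
    then show ?case by (simp add: meet_le closed)
  qed (simp_all add: closed zero add(1) add(3)[OF _ zero] assoc neg vscale_closed vscale_add_right vscale_add_left
         vscale_assoc vscale_one join_left join_right meet_left meet_right)
qed

text \<open>Extending \<open>f\<close> by zero outside \<open>I\<close>, the evaluation of a term with generators in \<open>I\<close> depends
  on its class only.\<close>

lemma (in left_vector_lattice) free_vl_lift_class: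
  assumes f: "f \<in> I \<rightarrow> carrier V" and t: "gens t \<subseteq> I"
  shows "free_vl_lift I V f (fv_class t) = vl_eval V f t"
proof -
  interpret G: comm_group "additive_group V" by (rule additive_comm_group)
  define g where "g i = (if i \<in> I then f i else vzero V)" for i
  have g: "g i \<in> carrier V" for i
    using f G.one_closed by (auto simp: g_def additive_group_def)
  have eval: "vl_eval V f s = vl_eval V g s" if "gens s \<subseteq> I" for s
    using that by (induction s) (auto simp: g_def)
  define s where "s = (SOME s. fv_class s = fv_class t \<and> gens s \<subseteq> I)"
  have "fv_class s = fv_class t \<and> gens s \<subseteq> I"
    unfolding s_def by (rule someI[of _ t]) (simp add: t)
  then have "s \<preceq>\<^sub>v t" "t \<preceq>\<^sub>v s" and s: "gens s \<subseteq> I"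
    by (simp_all add: fv_class_eq_iff)
  then have "vl_eval V g s = vl_eval V g t"
    by (intro le_antisym vl_eval_mono vl_eval_closed g)
  then show ?thesis
    using eval[OF s] eval[OF t] by (simp add: free_vl_lift_def s_def)
qed

theorem free_vector_lattice_universal:
  fixes V :: "('k::linordered_division_ring, 'v) vector_lattice" (structure)
    and I :: "'i set"
  assumes V: "left_vector_lattice V" and f: "f \<in> I \<rightarrow> carrier V"
  shows "vector_lattice_hom (free_vector_lattice I) V (free_vl_lift I V f)"
    and "i \<in> I \<Longrightarrow> free_vl_lift I V f (fv_gen i) = f i"
    and "\<lbrakk>vector_lattice_hom (free_vector_lattice I) V h; \<And>i. i \<in> I \<Longrightarrow> h (fv_gen i) = f i;
          X \<in> carrier (free_vector_lattice I)\<rbrakk> \<Longrightarrow> h X = free_vl_lift I V f X"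
proof -
  interpret left_vector_lattice V by fact
  have V_lattice: "lattice V" ..
  note lift = free_vl_lift_class[OF f]
  show "vector_lattice_hom (free_vector_lattice I) V (free_vl_lift I V f)"
    unfolding vector_lattice_hom_def join_pres_def meet_pres_def
  proof (intro conjI ballI allI free_vl_lattice V_lattice)
    show "free_vl_lift I V f \<in> carrier (free_vector_lattice I) \<rightarrow> carrier V"
      proof
      fix X :: "('k, 'i) free_vl" assume "X \<in> carrier (free_vector_lattice I)"
      then obtain t where t: "X = fv_class t" "gens t \<subseteq> I" by auto
      then have "vl_eval V f t \<in> carrier V"
        using f by (intro vl_eval_closed) auto
      then show "free_vl_lift I V f X \<in> carrier V"
        using t by (simp add: lift)
    qed
  qed (auto simp: fv_class_simps free_vl_join_meet lift)
  show "free_vl_lift I V f (fv_gen i) = f i" if "i \<in> I"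
    using that by (simp add: fv_class_simps lift)
  show "h X = free_vl_lift I V f X"
    if h: "vector_lattice_hom (free_vector_lattice I) V h"
      and hf: "\<And>i. i \<in> I \<Longrightarrow> h (fv_gen i) = f i"
      and X: "X \<in> carrier (free_vector_lattice I)"
  proof -
    have h_zero: "h fv_zero = vzero V"
      using vector_lattice_hom_zero[OF free_vector_lattice_left_vector_lattice V h] by simp
    have "h (fv_class t) = vl_eval V f t" if "gens t \<subseteq> I" for t
      using that
    proof (induction t)
      case (Add s t)
      then have "h (fv_add (fv_class s) (fv_class t)) = h (fv_class s) \<boxplus> h (fv_class t)"
        using h by (simp add: vector_lattice_hom_def)
      with Add show ?case by (simp add: fv_class_simps)
    next
      case (Scale c t)
      then have "h (fv_scale c (fv_class t)) = c \<boxdot> h (fv_class t)"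
        using h by (simp add: vector_lattice_hom_def)
      with Scale show ?case by (simp add: fv_class_simps)
    next
      case (Join s t)
      then have "h (fv_class s \<squnion>\<^bsub>free_vector_lattice I\<^esub> fv_class t) = h (fv_class s) \<squnion> h (fv_class t)"
        using h by (simp add: vector_lattice_hom_def join_pres_def)
      with Join show ?case by (simp add: free_vl_join_meet)
    next
      case (Meet s t)
      then have "h (fv_class s \<sqinter>\<^bsub>free_vector_lattice I\<^esub> fv_class t) = h (fv_class s) \<sqinter> h (fv_class t)"
        using h by (simp add: vector_lattice_hom_def meet_pres_def)
      with Meet show ?case by (simp add: free_vl_join_meet)
    qed (use hf h_zero in \<open>simp_all add: fv_class_simps\<close>)
    with X show ?thesis by (auto simp: lift)
  qed
qed


section \<open>The canonical maps between free objects\<close>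

text \<open>For \<open>I \<subseteq> J\<close>, the homomorphism sending the generator \<open>i\<close> of the object free on \<open>I\<close> to the
  generator \<open>i\<close> of the object free on \<open>J\<close>, and the induced map on principal l-ideals.\<close>

definition free_vl_incl ::
    "'i set \<Rightarrow> 'i set \<Rightarrow> ('k::linordered_division_ring, 'i) free_vl \<Rightarrow> ('k, 'i) free_vl" where
  "free_vl_incl I J = free_vl_lift I (free_vector_lattice J) fv_gen"

definition eta ::
    "'i set \<Rightarrow> 'i set \<Rightarrow> ('k::linordered_division_ring, 'i) free_vl set \<Rightarrow> ('k, 'i) free_vl set" where
  "eta I J = Id_c_map (free_vector_lattice J) (free_vl_incl I J)"

lemma free_vl_incl_hom:
  assumes "I \<subseteq> J"
  shows "vector_lattice_hom (free_vector_lattice I) (free_vector_lattice J) (free_vl_incl I J)"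
    and "i \<in> I \<Longrightarrow> free_vl_incl I J (fv_gen i) = fv_gen i"
proof -
  have "fv_gen \<in> I \<rightarrow> carrier (free_vector_lattice J)"
    using assms by (auto simp: fv_class_simps)
  note universal = free_vector_lattice_universal[OF free_vector_lattice_left_vector_lattice this]
  show "vector_lattice_hom (free_vector_lattice I) (free_vector_lattice J) (free_vl_incl I J)"
    unfolding free_vl_incl_def by (rule universal(1))
  show "free_vl_incl I J (fv_gen i) = fv_gen i" if "i \<in> I"
    unfolding free_vl_incl_def using that by (rule universal(2))
qed

end

theory Submission
  imports Defs "HOL-Library.Lattice_Algebras" "HOL-Library.Product_Plus"
begin

text \<open>A homomorphism from \<open>Id_c F\<close>, where \<open>F\<close> is free on \<open>J\<close>, to a distributive lattice \<open>L\<close>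
  amounts to a map \<open>P\<close> from \<open>F\<close> to \<open>L\<close> whose value \<open>P x\<close> measures where \<open>x > 0\<close>. Seen
  through the prime filters of \<open>L\<close>, it is a family of compatible total preorders on \<open>F\<close>. To
  add one generator \<open>e\<close> one has to choose, for every \<open>v\<close> in \<open>F\<close>, the regions \<open>e > v\<close> and
  \<open>v > e\<close>. Running through the countable set \<open>F\<close>, only finitely many such choices have been
  made when \<open>v\<close> is treated; they bound the two regions for \<open>v\<close> from above by finite meets
  \<open>M\<close> and \<open>N\<close>, and the splitting of the pair \<open>(M, N)\<close> given by complete normality is the
  required choice. The position of \<open>e\<close> relative to \<open>0\<close> is arbitrary, so a countable \<open>L\<close> is
  exhausted by countably many new generators, and well-founded recursion over the tree
  finishes the proof.\<close>

section \<open>The free vector lattice as a lattice-ordered group\<close>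

text \<open>Why prime filters: at a single one, the preorder on \<open>F\<close> is total, so a new
  element \<open>e\<close> is just a cut and every join or meet selects one of its arguments. What
  has to be controlled globally is that all regions come from elements of \<open>L\<close>. Only
  finite unions and intersections preserve this, whence the countability of the scalars and of each
  set of generators, the latter through the countable heights. Complete normality enters once, to
  make the overlapping bounds \<open>M\<close> and \<open>N\<close> disjoint. The free object on
  \<open>J\<close> with \<open>e\<close> added is never analysed directly. Its terms are evaluated,
  separately at each prime filter, in the plain vector space of expressions \<open>c e + w\<close>
  with \<open>w\<close> in \<open>F\<close>. The region of a term is then a lattice polynomial in
  regions of such affine expressions, and these are read off the cuts. At a node \<open>t\<close> of
  the tree, everything built below \<open>t\<close> is first pushed forward into \<open>L t\<close>.
  Each extension therefore takes place over one countable, completely normal lattice, and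
  \<open>L bot\<close> enters only as the source of the given data.\<close>

lemma fv_class_surj: "\<exists>t. x = fv_class t"
  by (induction x) (metis fv_class.abs_eq)

text \<open>All free objects consist of elements of the one type \<open>free_vl\<close>. A single
  instance on that type supplies the group and lattice identities for every \<open>J\<close>, and
  inclusions of free objects become inclusions of the sets \<open>vl_on J\<close>.\<close>

instantiation free_vl :: (linordered_division_ring, type) lattice_ab_group_add
begin

definition "0 = fv_zero"
definition "x + y = fv_add x y"
definition "- x = fv_scale (-1) x" for x :: "('a, 'b) free_vl"
definition "x - y = fv_add x (fv_scale (-1) y)"
definition "x \<le> y \<longleftrightarrow> fv_le x y"
definition "x < y \<longleftrightarrow> fv_le x y \<and> \<not> fv_le y x"

lift_definition sup_free_vl :: "('a, 'b) free_vl \<Rightarrow> ('a, 'b) free_vl \<Rightarrow> ('a, 'b) free_vl" is Join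
  unfolding vl_equiv_def
  by (meson vl_join_least vl_join_upper1 vl_join_upper2 vl_trans)

lift_definition inf_free_vl :: "('a, 'b) free_vl \<Rightarrow> ('a, 'b) free_vl \<Rightarrow> ('a, 'b) free_vl" is Meet
  unfolding vl_equiv_def
  by (meson vl_meet_greatest vl_meet_lower1 vl_meet_lower2 vl_trans)

instance
proof -
  let ?F = "free_vector_lattice UNIV :: ('a, ('a, 'b) free_vl) vector_lattice"
  interpret F: left_vector_lattice ?F
    by (rule free_vector_lattice_left_vector_lattice)
  interpret G: comm_group "additive_group ?F"
    by (rule F.additive_comm_group)
  have mem: "x \<in> carrier ?F" for x
    using fv_class_surj[of x] by auto
  note defs = zero_free_vl_def plus_free_vl_def uminus_free_vl_def minus_free_vl_def
    less_eq_free_vl_def less_free_vl_def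
  show "OFCLASS(('a, 'b) free_vl, lattice_ab_group_add_class)"
  proof
    fix x y z :: "('a, 'b) free_vl"
    obtain s t u where st: "x = fv_class s" "y = fv_class t" "z = fv_class u"
      using fv_class_surj by metis
    have sup_inf: "Lattices.sup x y = fv_class (Join s t)" "Lattices.inf x y = fv_class (Meet s t)"
      "Lattices.sup y z = fv_class (Join t u)" "Lattices.inf y z = fv_class (Meet t u)"
      by (simp_all add: st sup_free_vl.abs_eq inf_free_vl.abs_eq fv_class.abs_eq)
    show "x + y + z = x + (y + z)"
      using G.m_assoc[of x y z] mem by (simp add: additive_group_def defs)
    show "x + y = y + x"
      using G.m_comm[of x y] mem by (simp add: additive_group_def defs)
    show "0 + x = x"
      using G.l_one[of x] mem by (simp add: additive_group_def defs)
    show "- x + x = 0"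
      using vl_trans[OF vl_add_comm vl_add_neg1, of s] vl_trans[OF vl_add_neg2 vl_add_comm, of s]
      by (simp add: st defs fv_class_simps fv_class_eq_iff)
    show "x - y = x + - y" by (simp add: defs)
    show "(x < y) = (x \<le> y \<and> \<not> y \<le> x)" by (simp add: defs)
    show "x \<le> x" by (simp add: defs st fv_le_class vl_refl)
    show "x \<le> z" if "x \<le> y" "y \<le> z"
      using that vl_trans by (auto simp add: defs st fv_le_class)
    show "x = y" if "x \<le> y" "y \<le> x"
      using that by (simp add: defs st fv_le_class fv_class_eq_iff)
    show "z + x \<le> z + y" if "x \<le> y"
      using that vl_add_mono2[OF vl_refl] by (simp add: defs st fv_class_simps fv_le_class)
    show "Lattices.inf x y \<le> x" "Lattices.inf x y \<le> y" "x \<le> Lattices.sup x y" "y \<le> Lattices.sup x y"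
      unfolding sup_inf by (simp_all add: st defs fv_le_class vl_le.intros)
    show "x \<le> Lattices.inf y z" if "x \<le> y" "x \<le> z"
      using that unfolding sup_inf by (simp add: st defs fv_le_class vl_le.intros)
    show "Lattices.sup y z \<le> x" if "y \<le> x" "z \<le> x"
      using that unfolding sup_inf by (simp add: st defs fv_le_class vl_le.intros)
  qed
qed

end

notation sup_class.sup (infixl \<open>\<curlyvee>\<close> 65)
notation inf_class.inf (infixl \<open>\<curlywedge>\<close> 70)
notation fv_scale (infixr \<open>\<star>\<close> 75)

definition vl_on :: "'i set \<Rightarrow> ('k::linordered_division_ring, 'i) free_vl set" where
  "vl_on J = fv_class ` {t. gens t \<subseteq> J}"

lemma fv_class_eval:
  "fv_class (Gen i) = fv_gen i"
  "fv_class Zero = 0"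
  "fv_class (Add s t) = fv_class s + fv_class t"
  "fv_class (Scale c s) = c \<star> fv_class s"
  "fv_class (Join s t) = fv_class s \<curlyvee> fv_class t"
  "fv_class (Meet s t) = fv_class s \<curlywedge> fv_class t"
  by (simp_all add: fv_class_simps zero_free_vl_def plus_free_vl_def)
     (simp_all add: fv_class.abs_eq sup_free_vl.abs_eq inf_free_vl.abs_eq)

lemma fv_class_le_iff: "fv_class s \<le> fv_class t \<longleftrightarrow> s \<preceq>\<^sub>v t"
  by (simp add: less_eq_free_vl_def fv_le_class)

lemma fv_scale_laws:
  fixes x y :: "('k::linordered_division_ring, 'i) free_vl"
  shows "c \<star> (x + y) = c \<star> x + c \<star> y" "(c + d) \<star> x = c \<star> x + d \<star> x"
    "(c * d) \<star> x = c \<star> d \<star> x" "1 \<star> x = x" "(-1) \<star> x = - x"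
proof -
  obtain s t where st: "x = fv_class s" "y = fv_class t"
    using fv_class_surj by metis
  show "c \<star> (x + y) = c \<star> x + c \<star> y" "(c + d) \<star> x = c \<star> x + d \<star> x"
    "(c * d) \<star> x = c \<star> d \<star> x" "1 \<star> x = x" "(-1) \<star> x = - x"
    by (simp_all add: st fv_class_simps plus_free_vl_def fv_class_eq_iff vl_le.intros
        uminus_free_vl_def)
qed

lemma vl_on_closed [intro]:
  fixes x y :: "('k::linordered_division_ring, 'i) free_vl"
  shows "i \<in> J \<Longrightarrow> (fv_gen i :: ('k, 'i) free_vl) \<in> vl_on J"
  "(0 :: ('k, 'i) free_vl) \<in> vl_on J"
  "x \<in> vl_on J \<Longrightarrow> y \<in> vl_on J \<Longrightarrow> x + y \<in> vl_on J"
  "x \<in> vl_on J \<Longrightarrow> c \<star> x \<in> vl_on J"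
  "x \<in> vl_on J \<Longrightarrow> y \<in> vl_on J \<Longrightarrow> x \<curlyvee> y \<in> vl_on J"
  "x \<in> vl_on J \<Longrightarrow> y \<in> vl_on J \<Longrightarrow> x \<curlywedge> y \<in> vl_on J"
proof -
  have *: "fv_class t \<in> vl_on J" if "gens t \<subseteq> J" for t :: "('k, 'i) vl_term"
    using that by (auto simp: vl_on_def)
  show "i \<in> J \<Longrightarrow> (fv_gen i :: ('k, 'i) free_vl) \<in> vl_on J" "(0 :: ('k, 'i) free_vl) \<in> vl_on J"
    using *[of "Gen i"] *[of Zero] by (auto simp: fv_class_eval)
  show "x \<in> vl_on J \<Longrightarrow> c \<star> x \<in> vl_on J"
    using *[of "Scale c _"] by (auto simp: vl_on_def fv_class_eval)
  show "x \<in> vl_on J \<Longrightarrow> y \<in> vl_on J \<Longrightarrow> x + y \<in> vl_on J"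
    "x \<in> vl_on J \<Longrightarrow> y \<in> vl_on J \<Longrightarrow> x \<curlyvee> y \<in> vl_on J"
    "x \<in> vl_on J \<Longrightarrow> y \<in> vl_on J \<Longrightarrow> x \<curlywedge> y \<in> vl_on J"
    using *[of "Add _ _"] *[of "Join _ _"] *[of "Meet _ _"]
    by (auto simp: vl_on_def fv_class_eval)
qed

lemma vl_on_mono: "J \<subseteq> K \<Longrightarrow> vl_on J \<subseteq> vl_on K"
  by (auto simp: vl_on_def)

section \<open>Countability of the free object\<close>

lemma countable_vl_term:
  assumes "countable (UNIV :: 'k set)" "countable J"
  shows "countable {t :: ('k, 'i) vl_term. gens t \<subseteq> J}"
proof -
  \<comment> \<open>\<open>T n\<close> holds the terms of depth at most \<open>n\<close>, a leaf
    having depth 1. Monotonicity in \<open>n\<close> brings both arguments of a binary operation to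
    a common level.\<close>
  define T where "T = rec_nat {} (\<lambda>_ A. Gen ` J \<union> {Zero} \<union> (\<lambda>(s, t). Add s t) ` (A \<times> A)
    \<union> (\<lambda>(c, t). Scale c t) ` ((UNIV :: 'k set) \<times> A) \<union> (\<lambda>(s, t). Join s t) ` (A \<times> A)
    \<union> (\<lambda>(s, t). Meet s t) ` (A \<times> A))"
  have T_Suc: "T (Suc n) = Gen ` J \<union> {Zero} \<union> (\<lambda>(s, t). Add s t) ` (T n \<times> T n)
    \<union> (\<lambda>(c, t). Scale c t) ` (UNIV \<times> T n) \<union> (\<lambda>(s, t). Join s t) ` (T n \<times> T n)
    \<union> (\<lambda>(s, t). Meet s t) ` (T n \<times> T n)" for n
    by (simp add: T_def)
  have "T n \<subseteq> T (Suc n)" for n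
  proof (induction n)
    case (Suc n)
    then show ?case unfolding T_Suc[of "Suc n"] by (subst T_Suc) blast
  qed (simp add: T_def)
  then have mono: "T m \<subseteq> T n" if "m \<le> n" for m n
    using that by (rule lift_Suc_mono_le)
  have countable_T: "countable (T n)" for n
  proof (induction n)
    case (Suc n)
    then show ?case
      unfolding T_Suc by (intro countable_Un countable_image countable_SIGMA assms) auto
  qed (simp add: T_def)
  have "t \<in> (\<Union>n. T n)" if "gens t \<subseteq> J" for t
    using that
  proof (induction t)
    case (Gen i)
    then have "Gen i \<in> T (Suc 0)" by (simp add: T_Suc)
    then show ?case by blast
  next
    case Zero
    have "Zero \<in> T (Suc 0)" by (simp add: T_Suc)
    then show ?case by blast
  next
    case (Scale c t)
    then obtain n where "t \<in> T n" by auto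
    then have "Scale c t \<in> T (Suc n)" unfolding T_Suc by blast
    then show ?case by blast
  next
    case (Add s t)
    then obtain m n where "s \<in> T m" "t \<in> T n" by auto
    then have "s \<in> T (max m n)" "t \<in> T (max m n)" using mono[of m "max m n"] mono[of n "max m n"] by auto
    then have "Add s t \<in> T (Suc (max m n))" unfolding T_Suc by blast
    then show ?case by blast
  next
    case (Join s t)
    then obtain m n where "s \<in> T m" "t \<in> T n" by auto
    then have "s \<in> T (max m n)" "t \<in> T (max m n)" using mono[of m "max m n"] mono[of n "max m n"] by auto
    then have "Join s t \<in> T (Suc (max m n))" unfolding T_Suc by blast
    then show ?case by blast
  next
    case (Meet s t)
    then obtain m n where "s \<in> T m" "t \<in> T n" by auto
    then have "s \<in> T (max m n)" "t \<in> T (max m n)" using mono[of m "max m n"] mono[of n "max m n"] by auto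
    then have "Meet s t \<in> T (Suc (max m n))" unfolding T_Suc by blast
    then show ?case by blast
  qed
  then have "{t. gens t \<subseteq> J} \<subseteq> (\<Union>n. T n)" by blast
  moreover have "countable (\<Union>n. T n)" by (intro countable_UN countable_T) simp
  ultimately show ?thesis by (rule countable_subset)
qed

lemma countable_vl_on:
  assumes "countable (UNIV :: 'k::linordered_division_ring set)" "countable J"
  shows "countable (vl_on J :: ('k, 'i) free_vl set)"
  unfolding vl_on_def using countable_vl_term[OF assms] by blast

section \<open>Set-valued valuations\<close>

text \<open>The order axioms of the class do not mention \<open>1\<close>, but \<open>1\<close> is a
  square.\<close>

lemma zero_le_one_division_ring: "0 \<le> (1::'k::linordered_division_ring)"
  using zero_le_square[of "1::'k"] by simp

lemma inverse_pos_division_ring: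
  fixes c :: "'k::linordered_division_ring"
  assumes "0 < c"
  shows "0 < inverse c"
proof (rule ccontr)
  assume "\<not> 0 < inverse c"
  then have "c * inverse c \<le> 0"
    using assms by (intro mult_nonneg_nonpos) auto
  then have "1 \<le> (0::'k)" using assms by simp
  then show False
    using zero_le_one_division_ring[where 'k='k] by (simp add: order_antisym_conv)
qed

text \<open>For a fixed \<open>q\<close>, read \<open>q \<in> p x\<close> as \<open>x > 0\<close>; then \<open>p\<close> is a family of total
  preorders on the left vector space \<open>S\<close>.\<close>

locale preorder_valuation =
  fixes scale :: "'k::linordered_division_ring \<Rightarrow> 'v::ab_group_add \<Rightarrow> 'v" and S :: "'v set"
    and p :: "'v \<Rightarrow> 'q set"
  assumes scale_add_right: "scale c (x + y) = scale c x + scale c y"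
    and scale_add_left: "scale (c + d) x = scale c x + scale d x"
    and scale_assoc: "scale (c * d) x = scale c (scale d x)"
    and scale_one: "scale 1 x = x"
    and zero_closed: "0 \<in> S"
    and add_closed: "\<lbrakk>x \<in> S; y \<in> S\<rbrakk> \<Longrightarrow> x + y \<in> S"
    and scale_closed: "x \<in> S \<Longrightarrow> scale c x \<in> S"
    and p_zero: "p 0 = {}"
    and p_scale: "\<lbrakk>x \<in> S; 0 < c\<rbrakk> \<Longrightarrow> p (scale c x) = p x"
    and p_add: "\<lbrakk>x \<in> S; y \<in> S\<rbrakk> \<Longrightarrow> p (x + y) \<subseteq> p x \<union> p y"
    and p_disjoint: "x \<in> S \<Longrightarrow> p x \<inter> p (- x) = {}"
begin

lemma scale_zero_left: "scale 0 x = 0"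
  using scale_add_left[of 0 0 x] by simp

lemma scale_zero_right: "scale c 0 = 0"
  using scale_add_right[of c 0 0] by simp

lemma scale_minus_left: "scale (- c) x = - scale c x"
  using scale_add_left[of "- c" c x] by (simp add: scale_zero_left eq_neg_iff_add_eq_0)

lemma scale_minus_right: "scale c (- x) = - scale c x"
  using scale_add_right[of c "- x" x] by (simp add: scale_zero_right eq_neg_iff_add_eq_0)

lemma scale_diff_right: "scale c (x - y) = scale c x - scale c y"
  using scale_add_right[of c x "- y"] by (simp add: scale_minus_right)

lemma minus_closed: "x \<in> S \<Longrightarrow> - x \<in> S"
  using scale_closed[of x "-1"] by (simp add: scale_minus_left scale_one)

lemma diff_closed: "x \<in> S \<Longrightarrow> y \<in> S \<Longrightarrow> x - y \<in> S"
  using add_closed[OF _ minus_closed, of x y] by simp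

section \<open>The total preorder at a point\<close>

definition below :: "'q \<Rightarrow> 'v \<Rightarrow> 'v \<Rightarrow> bool" where
  "below q x y \<longleftrightarrow> q \<notin> p (x - y)"

lemma below_refl: "below q x x"
  by (simp add: below_def p_zero)

lemma below_trans: "\<lbrakk>below q x y; below q y z; x \<in> S; y \<in> S; z \<in> S\<rbrakk> \<Longrightarrow> below q x z"
  using p_add[of "x - y" "y - z"] by (auto simp: below_def diff_closed)

lemma below_total: "\<lbrakk>x \<in> S; y \<in> S\<rbrakk> \<Longrightarrow> below q x y \<or> below q y x"
  using p_disjoint[of "x - y"] by (auto simp: below_def diff_closed)

lemma not_below: "\<lbrakk>x \<in> S; y \<in> S; q \<in> p (x - y)\<rbrakk> \<Longrightarrow> below q y x"
  using below_total[of x y q] by (auto simp: below_def)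

lemma below_add: "below q x y \<Longrightarrow> below q (x + z) (y + z)"
  by (simp add: below_def)

lemma below_scale:
  assumes "below q x y" "x \<in> S" "y \<in> S" "0 \<le> c"
  shows "below q (scale c x) (scale c y)"
proof (cases "c = 0")
  case False
  then show ?thesis
    using assms p_scale[of "x - y" c] by (simp add: below_def scale_diff_right diff_closed)
qed (simp add: scale_zero_left below_refl)

lemma p_cong: "\<lbrakk>below q x y; x \<in> S; y \<in> S; q \<in> p x\<rbrakk> \<Longrightarrow> q \<in> p y"
  using p_add[of "x - y" y] by (auto simp: below_def diff_closed)

lemma p_affine_mono:
  assumes "below q x y" "x \<in> S" "y \<in> S" "z \<in> S"
  shows "0 \<le> c \<Longrightarrow> q \<in> p (scale c x + z) \<Longrightarrow> q \<in> p (scale c y + z)"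
    and "c \<le> 0 \<Longrightarrow> q \<in> p (scale c y + z) \<Longrightarrow> q \<in> p (scale c x + z)"
proof -
  show "q \<in> p (scale c y + z)" if "0 \<le> c" "q \<in> p (scale c x + z)"
    using p_cong[OF below_add[OF below_scale]] assms that add_closed scale_closed by meson
  show "q \<in> p (scale c x + z)" if "c \<le> 0" "q \<in> p (scale c y + z)"
  proof (rule p_cong[OF below_add])
    have "below q (scale (- c) x) (scale (- c) y)"
      using assms that by (intro below_scale) auto
    then show "below q (scale c y) (scale c x)" by (simp add: below_def scale_minus_left)
  qed (use assms that in \<open>simp_all add: add_closed scale_closed\<close>)
qed

text \<open>An affine map is monotone or antitone at \<open>q\<close> according to the sign of
  \<open>c\<close>. Applied to a maximum or a minimum, it is therefore positive under a disjunction
  or a conjunction of the two conditions. This converts a selection that depends on \<open>q\<close>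
  into a union or an intersection of regions.\<close>

lemma p_affine_select:
  fixes x y z :: 'v and q :: 'q
  assumes "x \<in> S" "y \<in> S" "z \<in> S"
  defines "m \<equiv> if q \<in> p (x - y) then x else y" and "n \<equiv> if q \<in> p (x - y) then y else x"
  shows "0 \<le> c \<Longrightarrow> q \<in> p (scale c m + z) \<longleftrightarrow> q \<in> p (scale c x + z) \<or> q \<in> p (scale c y + z)"
    and "c \<le> 0 \<Longrightarrow> q \<in> p (scale c m + z) \<longleftrightarrow> q \<in> p (scale c x + z) \<and> q \<in> p (scale c y + z)"
    and "0 \<le> c \<Longrightarrow> q \<in> p (scale c n + z) \<longleftrightarrow> q \<in> p (scale c x + z) \<and> q \<in> p (scale c y + z)"
    and "c \<le> 0 \<Longrightarrow> q \<in> p (scale c n + z) \<longleftrightarrow> q \<in> p (scale c x + z) \<or> q \<in> p (scale c y + z)"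
proof -
  have mn: "m = x \<and> n = y \<and> below q y x \<or> m = y \<and> n = x \<and> below q x y"
    using not_below[OF assms(1,2)] by (auto simp: m_def n_def below_def)
  note mono = p_affine_mono[OF _ assms(1,2,3)] p_affine_mono[OF _ assms(2,1,3)]
  show "0 \<le> c \<Longrightarrow> q \<in> p (scale c m + z) \<longleftrightarrow> q \<in> p (scale c x + z) \<or> q \<in> p (scale c y + z)"
    using mn mono(1,3) by metis
  show "c \<le> 0 \<Longrightarrow> q \<in> p (scale c m + z) \<longleftrightarrow> q \<in> p (scale c x + z) \<and> q \<in> p (scale c y + z)"
    using mn mono(2,4) by metis
  show "0 \<le> c \<Longrightarrow> q \<in> p (scale c n + z) \<longleftrightarrow> q \<in> p (scale c x + z) \<and> q \<in> p (scale c y + z)"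
    using mn mono(1,3) by metis
  show "c \<le> 0 \<Longrightarrow> q \<in> p (scale c n + z) \<longleftrightarrow> q \<in> p (scale c x + z) \<or> q \<in> p (scale c y + z)"
    using mn mono(2,4) by metis
qed

text \<open>In a totally preordered space, joins and meets select one of their arguments. Ties are
  broken arbitrarily, so equivalent terms have values that agree only up to \<open>below q\<close>
  in both directions.\<close>

primrec term_value :: "('i \<Rightarrow> 'v) \<Rightarrow> 'q \<Rightarrow> ('k, 'i) vl_term \<Rightarrow> 'v" where
  "term_value g q (Gen i) = g i"
| "term_value g q Zero = 0"
| "term_value g q (Add s t) = term_value g q s + term_value g q t"
| "term_value g q (Scale c t) = scale c (term_value g q t)"
| "term_value g q (Join s t) =
     (if q \<in> p (term_value g q s - term_value g q t) then term_value g q s else term_value g q t)"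
| "term_value g q (Meet s t) =
     (if q \<in> p (term_value g q s - term_value g q t) then term_value g q t else term_value g q s)"

context
  fixes g :: "'i \<Rightarrow> 'v"
  assumes g_closed: "g i \<in> S"
begin

lemma term_value_closed: "term_value g q t \<in> S"
  by (induction t) (auto simp: g_closed zero_closed add_closed scale_closed)

text \<open>Modulo equivalence at \<open>q\<close>, \<open>S\<close> is a totally ordered left
  vector space, hence a left vector lattice, and so satisfies every rule defining the preorder on
  terms.\<close>

lemma term_value_mono: "s \<preceq>\<^sub>v t \<Longrightarrow> below q (term_value g q s) (term_value g q t)"
proof (induction rule: vl_le.induct)
  case (vl_trans s t u)
  then show ?case using below_trans term_value_closed by blast
next
  case (vl_add_mono s t u)
  then show ?case by (simp add: below_add)
next
  case (vl_scale_cong s t c)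
  show ?case
  proof (cases "0 \<le> c")
    \<comment> \<open>A negative scalar reverses the preorder; the two premises of the rule provide
      both directions.\<close>
    case False
    then have "below q (scale (- c) (term_value g q t)) (scale (- c) (term_value g q s))"
      using vl_scale_cong.IH by (intro below_scale term_value_closed) auto
    then show ?thesis by (simp add: below_def scale_minus_left)
  qed (use vl_scale_cong.IH in \<open>simp add: below_scale term_value_closed\<close>)
next
  case (vl_scale_mono c s t)
  then show ?case by (simp add: below_scale term_value_closed)
next
  case (vl_join_upper1 s t)
  then show ?case by (auto simp: below_refl) (simp add: below_def)
next
  case (vl_join_upper2 t s)
  then show ?case by (auto simp: below_refl not_below term_value_closed)
next
  case (vl_meet_lower1 s t)
  then show ?case by (auto simp: below_refl not_below term_value_closed)
next
  case (vl_meet_lower2 s t)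
  then show ?case by (auto simp: below_refl) (simp add: below_def)
qed (simp_all add: below_refl add_ac scale_add_right scale_add_left scale_assoc scale_one
      scale_minus_left)

text \<open>The function \<open>h\<close> is a continuation: it makes the induction go through sums, although
  the values of \<open>term_value g q t\<close> depend on \<open>q\<close>.\<close>

lemma term_value_range:
  assumes Un: "\<And>A B. A \<in> R \<Longrightarrow> B \<in> R \<Longrightarrow> A \<union> B \<in> R"
    and Int: "\<And>A B. A \<in> R \<Longrightarrow> B \<in> R \<Longrightarrow> A \<inter> B \<in> R"
    and h: "\<And>q. h q \<in> S" "\<And>w. w \<in> S \<Longrightarrow> {q. q \<in> p (h q + w)} \<in> R"
    and w: "w \<in> S"
  shows "{q. q \<in> p (scale c (term_value g q t) + h q + w)} \<in> R"
  using h w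
proof (induction t arbitrary: c h w)
  case (Gen i)
  then show ?case
    using Gen(2)[of "scale c (g i) + w"] by (simp add: add_ac add_closed scale_closed g_closed)
next
  case Zero
  then show ?case by (simp add: scale_zero_right)
next
  case (Add s t)
  \<comment> \<open>The second summand is absorbed into the continuation; the induction hypothesis
    for \<open>t\<close> shows that the enlarged continuation is again admissible.\<close>
  have "{q. q \<in> p (scale c (term_value g q s) + (scale c (term_value g q t) + h q) + w)} \<in> R"
    using Add.prems
    by (intro Add.IH(1)) (simp_all add: add_closed scale_closed term_value_closed Add.IH(2))
  then show ?case by (simp add: scale_add_right add_ac)
next
  case (Scale d t)
  then show ?case using Scale.IH[of h w "c * d"] by (simp add: scale_assoc)
next
  case (Join s t)
  let ?P = "\<lambda>t. {q. q \<in> p (scale c (term_value g q t) + (h q + w))}"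
  have R: "?P s \<in> R" "?P t \<in> R"
    using Join.IH[OF Join.prems, of c] by (simp_all add: add.assoc)
  have hw: "h q + w \<in> S" for q
    using Join.prems by (simp add: add_closed)
  note select = p_affine_select[OF term_value_closed term_value_closed hw]
  have "?P (Join s t) = ?P s \<union> ?P t" if "0 \<le> c"
    using select(1)[OF that] by auto
  moreover have "?P (Join s t) = ?P s \<inter> ?P t" if "c \<le> 0"
    using select(2)[OF that] by auto
  ultimately have "?P (Join s t) \<in> R"
    using Un[OF R] Int[OF R] by (cases "0 \<le> c") (simp_all only: not_le less_imp_le)
  then show ?case by (simp only: add.assoc)
next
  case (Meet s t)
  let ?P = "\<lambda>t. {q. q \<in> p (scale c (term_value g q t) + (h q + w))}"
  have R: "?P s \<in> R" "?P t \<in> R"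
    using Meet.IH[OF Meet.prems, of c] by (simp_all add: add.assoc)
  have hw: "h q + w \<in> S" for q
    using Meet.prems by (simp add: add_closed)
  note select = p_affine_select[OF term_value_closed term_value_closed hw]
  have "?P (Meet s t) = ?P s \<inter> ?P t" if "0 \<le> c"
    using select(3)[OF that] by auto
  moreover have "?P (Meet s t) = ?P s \<union> ?P t" if "c \<le> 0"
    using select(4)[OF that] by auto
  ultimately have "?P (Meet s t) \<in> R"
    using Un[OF R] Int[OF R] by (cases "0 \<le> c") (simp_all only: not_le less_imp_le)
  then show ?case by (simp only: add.assoc)
qed

definition free_value :: "('k, 'i) free_vl \<Rightarrow> 'q set" where
  "free_value x = {q. q \<in> p (term_value g q (SOME t. fv_class t = x))}"

text \<open>Two representatives of a class have values below each other at \<open>q\<close>, and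
  \<open>p\<close> cannot separate such values.\<close>

lemma free_value_class: "free_value (fv_class t) = {q. q \<in> p (term_value g q t)}"
proof -
  define s where "s = (SOME s. fv_class s = fv_class t)"
  have "fv_class s = fv_class t"
    unfolding s_def by (rule someI[of _ t]) simp
  then have "s \<preceq>\<^sub>v t" "t \<preceq>\<^sub>v s" by (simp_all add: fv_class_eq_iff)
  then have "q \<in> p (term_value g q s) \<longleftrightarrow> q \<in> p (term_value g q t)" for q
    using p_cong[OF term_value_mono term_value_closed term_value_closed] by blast
  then show ?thesis by (simp add: free_value_def s_def)
qed

lemma free_value_range:
  assumes "\<And>A B. A \<in> R \<Longrightarrow> B \<in> R \<Longrightarrow> A \<union> B \<in> R"
    and "\<And>A B. A \<in> R \<Longrightarrow> B \<in> R \<Longrightarrow> A \<inter> B \<in> R"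
    and "\<And>x. x \<in> S \<Longrightarrow> p x \<in> R"
  shows "free_value x \<in> R"
proof -
  obtain t where x: "x = fv_class t" using fv_class_surj by blast
  have "{q. q \<in> p (scale 1 (term_value g q t) + 0 + 0)} \<in> R"
    by (rule term_value_range) (simp_all add: assms zero_closed)
  then show ?thesis by (simp add: x free_value_class scale_one)
qed

end

end

text \<open>The lattice clauses speak only about positivity. By translation invariance they already
  force \<open>x \<curlyvee> y\<close> to be equivalent, at each point, to the larger of
  \<open>x\<close> and \<open>y\<close>; see \<open>equal_at_sup_inf\<close>.\<close>

definition lattice_valuation ::
    "'i set \<Rightarrow> (('k::linordered_division_ring, 'i) free_vl \<Rightarrow> 'q set) \<Rightarrow> bool" where
  "lattice_valuation J p \<longleftrightarrow>
     preorder_valuation fv_scale (vl_on J) p \<and>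
     (\<forall>x\<in>vl_on J. \<forall>y\<in>vl_on J. p (x \<curlyvee> y) = p x \<union> p y \<and> p (x \<curlywedge> y) = p x \<inter> p y)"

lemma preorder_valuation_fv_scaleI:
  fixes p :: "('k::linordered_division_ring, 'i) free_vl \<Rightarrow> 'q set"
  assumes "p 0 = {}"
    and "\<And>x c. \<lbrakk>x \<in> vl_on J; 0 < c\<rbrakk> \<Longrightarrow> p (c \<star> x) = p x"
    and "\<And>x y. \<lbrakk>x \<in> vl_on J; y \<in> vl_on J\<rbrakk> \<Longrightarrow> p (x + y) \<subseteq> p x \<union> p y"
    and "\<And>x. x \<in> vl_on J \<Longrightarrow> p x \<inter> p (- x) = {}"
  shows "preorder_valuation fv_scale (vl_on J) p"
  using assms by unfold_locales (auto simp: fv_scale_laws intro: vl_on_closed)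

text \<open>The operations on classes are those on terms, so the axioms are inherited from
  \<open>p\<close> one point at a time; the lattice clauses are affine selection with scalar
  \<open>1\<close> and constant \<open>0\<close>.\<close>

lemma (in preorder_valuation) free_value_lattice_valuation:
  fixes g :: "'i \<Rightarrow> 'v"
  assumes g: "\<And>i. g i \<in> S"
  shows "lattice_valuation J (free_value g)"
proof -
  note on_class = free_value_class[of g, OF g]
  note closed = term_value_closed[of g, OF g]
  have "preorder_valuation fv_scale (vl_on J) (free_value g)"
  proof (rule preorder_valuation_fv_scaleI)
    show "free_value g 0 = {}"
      using on_class[of Zero] by (simp add: fv_class_eval p_zero)
  next
    fix x :: "('k, 'i) free_vl" and c :: 'k assume "0 < c"
    obtain t where "x = fv_class t" using fv_class_surj by blast
    with \<open>0 < c\<close> show "free_value g (c \<star> x) = free_value g x"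
      using on_class[of "Scale c t"] by (simp add: fv_class_eval p_scale closed on_class)
  next
    fix x y :: "('k, 'i) free_vl"
    obtain s t where "x = fv_class s" "y = fv_class t" using fv_class_surj by metis
    moreover have "p (term_value g q s + term_value g q t) \<subseteq> p (term_value g q s) \<union> p (term_value g q t)" for q
      by (intro p_add closed)
    ultimately show "free_value g (x + y) \<subseteq> free_value g x \<union> free_value g y"
      using on_class[of "Add s t"] by (auto simp: fv_class_eval on_class)
  next
    fix x :: "('k, 'i) free_vl"
    obtain t where "x = fv_class t" using fv_class_surj by blast
    then show "free_value g x \<inter> free_value g (- x) = {}"
      using on_class[of "Scale (-1) t"] p_disjoint[OF closed]
      by (auto simp: fv_class_eval fv_scale_laws on_class scale_minus_left scale_one)
  qed
  moreover have "free_value g (x \<curlyvee> y) = free_value g x \<union> free_value g y \<and>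
      free_value g (x \<curlywedge> y) = free_value g x \<inter> free_value g y" for x y
  proof -
    obtain s t where "x = fv_class s" "y = fv_class t" using fv_class_surj by metis
    moreover note select = p_affine_select(1,3)[OF closed closed zero_closed zero_le_one_division_ring,
        unfolded scale_one add_0_right]
    ultimately show ?thesis
      using on_class[of "Join s t"] on_class[of "Meet s t"]
      by (simp add: select fv_class_eval on_class scale_one Un_def Int_def set_eq_iff)
  qed
  ultimately show ?thesis by (simp add: lattice_valuation_def)
qed

section \<open>Cuts\<close>

text \<open>Complete normality for a ring of sets. The instance in mind is the image of
  \<open>L\<close> under \<open>prime_filters\<close>, where lattice computations become pointwise
  reasoning.\<close>

definition normal_set_ring :: "'q set set \<Rightarrow> bool" where
  "normal_set_ring R \<longleftrightarrow>
     {} \<in> R \<and> (\<forall>A\<in>R. \<forall>B\<in>R. A \<union> B \<in> R \<and> A \<inter> B \<in> R) \<and>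
     (\<forall>A\<in>R. \<forall>B\<in>R. \<exists>X\<in>R. \<exists>Y\<in>R. A \<union> B = A \<union> Y \<and> A \<union> B = X \<union> B \<and> X \<inter> Y = {})"

text \<open>An empty intersection would be the set of all points, which may be missing from
  \<open>R\<close> because the lattices have no top; hence \<open>K\<close> is nonempty.\<close>

lemma normal_set_ring_INT:
  assumes "normal_set_ring R" "finite K" "K \<noteq> {}" "\<And>k. k \<in> K \<Longrightarrow> f k \<in> R"
  shows "(\<Inter>k\<in>K. f k) \<in> R"
  using assms(2-4)
proof (induction K rule: finite_ne_induct)
  case (insert k K)
  then have "f k \<in> R" "(\<Inter>k\<in>K. f k) \<in> R" by auto
  then show ?case using assms(1) by (simp add: normal_set_ring_def)
qed auto

context preorder_valuation
begin

text \<open>The components of the pair \<open>P\<close> attached to \<open>v\<close> are the regions where \<open>e > v\<close> and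
  where \<open>v > e\<close>, for a new element \<open>e\<close>.\<close>

definition cut_compatible :: "'v \<Rightarrow> 'q set \<times> 'q set \<Rightarrow> 'v \<Rightarrow> 'q set \<times> 'q set \<Rightarrow> bool" where
  "cut_compatible v P w P' \<longleftrightarrow>
     fst P \<subseteq> fst P' \<union> p (w - v) \<and> fst P' \<subseteq> fst P \<union> p (v - w) \<and>
     snd P \<subseteq> snd P' \<union> p (v - w) \<and> snd P' \<subseteq> snd P \<union> p (w - v) \<and>
     p (v - w) \<subseteq> snd P \<union> fst P' \<and> p (w - v) \<subseteq> snd P' \<union> fst P"

lemma cut_compatible_sym: "cut_compatible v P w P' \<Longrightarrow> cut_compatible w P' v P"
  by (auto simp: cut_compatible_def)

lemma p_triangle: "\<lbrakk>x \<in> S; y \<in> S; z \<in> S\<rbrakk> \<Longrightarrow> p (x - z) \<subseteq> p (x - y) \<union> p (y - z)"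
  using p_add[of "x - y" "y - z"] by (simp add: diff_closed)

text \<open>Compatibility with the earlier cuts bounds the regions \<open>e > v\<close> and
  \<open>v > e\<close> from above and from below. The largest sets allowed by the upper bounds are
  \<open>M\<close> and \<open>N\<close>, which lie in \<open>R\<close> because \<open>K\<close> is
  finite but may overlap; normality then separates them.\<close>

lemma extend_cut:
  assumes R: "normal_set_ring R" and p: "\<And>x. x \<in> S \<Longrightarrow> p x \<in> R"
    and K: "finite K" "K \<noteq> {}" and u: "\<And>k. k \<in> K \<Longrightarrow> u k \<in> S" and v: "v \<in> S"
    and AB: "\<And>k. k \<in> K \<Longrightarrow> fst (f k) \<in> R" "\<And>k. k \<in> K \<Longrightarrow> snd (f k) \<in> R"
      "\<And>k. k \<in> K \<Longrightarrow> fst (f k) \<inter> snd (f k) = {}"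
    and compat: "\<And>i k. i \<in> K \<Longrightarrow> k \<in> K \<Longrightarrow> cut_compatible (u i) (f i) (u k) (f k)"
  shows "\<exists>P. fst P \<in> R \<and> snd P \<in> R \<and> fst P \<inter> snd P = {} \<and>
    (\<forall>k\<in>K. cut_compatible (u k) (f k) v P)"
proof -
  define M where "M = (\<Inter>k\<in>K. fst (f k) \<union> p (u k - v))"
  define N where "N = (\<Inter>k\<in>K. snd (f k) \<union> p (v - u k))"
  have Un: "A \<union> B \<in> R" and Int: "A \<inter> B \<in> R" if "A \<in> R" "B \<in> R" for A B
    using R that by (simp_all add: normal_set_ring_def)
  have "M \<in> R" "N \<in> R"
    unfolding M_def N_def using K by (auto intro!: normal_set_ring_INT R Un AB p diff_closed u v)
  then obtain X Y where XY: "X \<in> R" "Y \<in> R" "M \<union> N = M \<union> Y" "M \<union> N = X \<union> N" "X \<inter> Y = {}"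
    using R unfolding normal_set_ring_def by meson
  \<comment> \<open>\<open>M\<close> and \<open>N\<close> already satisfy the lower bounds, by the triangle inequality; passing from
    \<open>(M, N)\<close> to \<open>(X, Y)\<close> loses at most \<open>M \<inter> N\<close>, which the lower bounds tolerate.\<close>
  have "cut_compatible (u k) (f k) v (X \<inter> M, Y \<inter> N)" if k: "k \<in> K" for k
  proof -
    have MN: "M \<subseteq> fst (f k) \<union> p (u k - v)" "N \<subseteq> snd (f k) \<union> p (v - u k)"
      using k by (auto simp: M_def N_def)
    have disj: "fst (f k) \<inter> snd (f k) = {}" "p (u k - v) \<inter> p (v - u k) = {}"
      using AB(3)[OF k] p_disjoint[OF diff_closed[OF u[OF k] v]] by auto
    have tri: "p (u i - u k) \<subseteq> p (u i - v) \<union> p (v - u k)"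
      "p (u k - u i) \<subseteq> p (u k - v) \<union> p (v - u i)"
      "p (u k - v) \<subseteq> p (u k - u i) \<union> p (u i - v)"
      "p (v - u k) \<subseteq> p (v - u i) \<union> p (u i - u k)" if "i \<in> K" for i
      using u[OF k] u[OF that] v by (auto dest: p_triangle[THEN subsetD, rotated -1])
    have lower: "fst (f k) \<subseteq> M \<union> p (v - u k)" "snd (f k) \<subseteq> N \<union> p (u k - v)"
      "p (u k - v) \<subseteq> M \<union> snd (f k)" "p (v - u k) \<subseteq> N \<union> fst (f k)"
      using compat[OF _ k] tri unfolding M_def N_def cut_compatible_def by blast+
    \<comment> \<open>A point forced into \<open>e > v\<close> by a lower bound lies in
      \<open>M\<close> but not in \<open>N\<close>: the upper bound on \<open>N\<close> would put it
      into \<open>snd (f k)\<close> or \<open>p (v - u k)\<close>, and disjointness together with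
      the case at hand excludes both. Since \<open>X\<close> contains \<open>M\<close> minus
      \<open>N\<close>, the point survives; the argument for \<open>Y\<close> is symmetric.
      Intersecting with \<open>M\<close> and \<open>N\<close> restores the upper bounds.\<close>
    show ?thesis
      unfolding cut_compatible_def fst_conv snd_conv
      using MN disj lower XY(3,4) by blast
  qed
  then show ?thesis
    using XY \<open>M \<in> R\<close> \<open>N \<in> R\<close> Int by (intro exI[of _ "(X \<inter> M, Y \<inter> N)"]) auto
qed

text \<open>No finite family of compatible cuts is a dead end, by \<open>extend_cut\<close>, so
  running through an enumeration of \<open>S\<close> never gets stuck.\<close>

lemma cut_exists:
  assumes R: "normal_set_ring R" and p: "\<And>x. x \<in> S \<Longrightarrow> p x \<in> R"
    and S: "countable S" and z: "z \<in> R"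
  shows "\<exists>f. (\<forall>v\<in>S. fst (f v) \<in> R \<and> snd (f v) \<in> R \<and> fst (f v) \<inter> snd (f v) = {}) \<and>
    (\<forall>v\<in>S. \<forall>w\<in>S. cut_compatible v (f v) w (f w)) \<and> f 0 = (z, {})"
proof -
  \<comment> \<open>Treating \<open>0\<close> first, before there is any constraint, is what allows
    its pair to be prescribed as \<open>(z, {})\<close>.\<close>
  define u where "u = case_nat 0 (from_nat_into S)"
  have u_closed: "u n \<in> S" for n
    using from_nat_into[of S] zero_closed by (auto simp: u_def split: nat.split)
  define good where "good f n P \<longleftrightarrow> fst P \<in> R \<and> snd P \<in> R \<and> fst P \<inter> snd P = {} \<and>
    (\<forall>i<n. cut_compatible (u i) (f i) (u n) P) \<and> (n = 0 \<longrightarrow> P = (z, {}))" for f n P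
  have "\<exists>f. \<forall>n. good f n (f n)"
  proof (rule dependent_wf_choice[OF wf_less])
    show "good f n r = good g n r" if "\<And>z. (z, n) \<in> {(x, y). x < y} \<Longrightarrow> f z = g z" for f g n r
      using that by (simp add: good_def)
    show "\<exists>r. good f n r" if *: "\<And>i. (i, n) \<in> {(x, y). x < y} \<Longrightarrow> good f i (f i)" for n f
    proof (cases "n = 0")
      case True
      then show ?thesis using z R by (auto simp: good_def normal_set_ring_def)
    next
      case False
      have good: "good f i (f i)" if "i < n" for i
        using * that by simp
      have self: "cut_compatible v P v P" for v P
        by (auto simp: cut_compatible_def p_zero)
      have "cut_compatible (u i) (f i) (u k) (f k)" if "i < n" "k < n" for i k
        using good[OF that(1)] good[OF that(2)] cut_compatible_sym self
        by (cases i k rule: linorder_cases) (auto simp: good_def)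
      then have "\<exists>P. fst P \<in> R \<and> snd P \<in> R \<and> fst P \<inter> snd P = {} \<and>
          (\<forall>k\<in>{..<n}. cut_compatible (u k) (f k) (u n) P)"
        using good False
        by (intro extend_cut R p u_closed) (auto simp: good_def)
      then show ?thesis using False by (auto simp: good_def)
    qed
  qed
  then obtain f where f: "\<And>n. good f n (f n)" by blast
  have compat: "cut_compatible (u i) (f i) (u k) (f k)" for i k
    using f[of i] f[of k] cut_compatible_sym
    by (cases i k rule: linorder_cases) (auto simp: good_def cut_compatible_def p_zero)
  have surj: "\<exists>n. u n = v" if v: "v \<in> S" for v
  proof -
    obtain n where "from_nat_into S n = v"
      using from_nat_into_surj[OF S v] by blast
    then have "u (Suc n) = v" by (simp add: u_def)
    then show ?thesis by blast
  qed
  \<comment> \<open>Elements may recur in \<open>u\<close>; taking the first occurrence gives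
    \<open>0\<close> the index at which the pair was prescribed.\<close>
  define idx where "idx v = (LEAST n. u n = v)" for v
  have idx: "u (idx v) = v" if "v \<in> S" for v
    unfolding idx_def by (rule LeastI_ex) (rule surj[OF that])
  have "idx 0 = 0"
    unfolding idx_def by (rule Least_eq_0) (simp add: u_def)
  then have "f (idx 0) = (z, {})" using f[of 0] by (simp add: good_def)
  moreover have "cut_compatible v (f (idx v)) w (f (idx w))" if "v \<in> S" "w \<in> S" for v w
    using compat[of "idx v" "idx w"] idx that by simp
  ultimately show ?thesis
    using f by (intro exI[of _ "\<lambda>v. f (idx v)"]) (auto simp: good_def)
qed

end

section \<open>Adding one generator\<close>

context preorder_valuation
begin

context
  fixes f :: "'v \<Rightarrow> 'q set \<times> 'q set"
  assumes f_compat: "\<lbrakk>v \<in> S; w \<in> S\<rbrakk> \<Longrightarrow> cut_compatible v (f v) w (f w)"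
    and f_disjoint: "v \<in> S \<Longrightarrow> fst (f v) \<inter> snd (f v) = {}"
begin

text \<open>The value at \<open>(c, w)\<close>, which stands for \<open>c e + w\<close>, is read off the position of \<open>e\<close>
  relative to \<open>- inverse c w\<close>.\<close>

definition cut_value :: "'k \<times> 'v \<Rightarrow> 'q set" where
  "cut_value = (\<lambda>(c, w). if c = 0 then p w
     else if 0 < c then fst (f (- scale (inverse c) w)) else snd (f (- scale (inverse c) w)))"

text \<open>Read \<open>X u\<close> as \<open>e > u\<close>, \<open>Y u\<close> as
  \<open>u > e\<close> and \<open>D\<close> as positivity; \<open>x\<close> is the mean of
  \<open>v\<close> and \<open>w\<close> with weights \<open>l\<close> and \<open>m\<close>. For
  \<open>m > 0\<close> it lies between them, so it cannot be strictly below both. For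
  \<open>m < 0\<close> it is \<open>v\<close> that lies between \<open>x\<close> and
  \<open>w\<close>: if \<open>e > x\<close> but not \<open>e > v\<close>, then \<open>v > x\<close>,
  hence \<open>w > v\<close>, and \<open>e\<close> is below \<open>w\<close>. Keeping
  \<open>X\<close>, \<open>Y\<close> and \<open>D\<close> abstract lets the same argument serve the
  reversed order.\<close>

lemma cut_add_pos:
  assumes X: "\<And>v w. \<lbrakk>v \<in> S; w \<in> S\<rbrakk> \<Longrightarrow> X v \<subseteq> X w \<union> D (w - v)"
    and D: "\<And>v w. \<lbrakk>v \<in> S; w \<in> S\<rbrakk> \<Longrightarrow> D (v - w) \<subseteq> Y v \<union> X w"
    and disj: "\<And>x. x \<in> S \<Longrightarrow> D x \<inter> D (- x) = {}"
    and scl: "\<And>c x. \<lbrakk>x \<in> S; 0 < c\<rbrakk> \<Longrightarrow> D (scale c x) = D x"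
    and S: "v \<in> S" "w \<in> S" "x \<in> S"
    and pos: "0 < l" "0 < l + m"
    and x: "scale (l + m) x = scale l v + scale m w"
  shows "0 < m \<Longrightarrow> X x \<subseteq> X v \<union> X w" and "m < 0 \<Longrightarrow> X x \<subseteq> X v \<union> Y w"
proof -
  have vx: "scale (l + m) (v - x) = scale m (v - w)"
    by (simp add: scale_diff_right x scale_add_left[of l m v])
  have wx: "scale (l + m) (w - x) = scale l (w - v)"
    by (simp add: scale_diff_right x scale_add_left[of l m w])
  have Dv: "D (v - x) = D (scale m (v - w))" and Dw: "D (w - x) = D (w - v)"
    using scl[of "v - x" "l + m"] scl[of "w - x" "l + m"] scl[of "w - v" l] S pos
    by (simp_all add: vx wx diff_closed)
  show "X x \<subseteq> X v \<union> X w" if "0 < m"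
    using X[OF S(3,1)] X[OF S(3,2)] disj[of "v - w"] scl[of "v - w" m] that S
    by (auto simp: Dv Dw diff_closed)
  show "X x \<subseteq> X v \<union> Y w" if "m < 0"
  proof -
    have "scale m (v - w) = scale (- m) (w - v)"
      by (simp add: scale_minus_left scale_diff_right)
    then have "D (v - x) = D (w - v)"
      using scl[of "w - v" "- m"] that S by (simp add: Dv diff_closed)
    then show ?thesis using X[OF S(3,1)] D[OF S(2,1)] by blast
  qed
qed

text \<open>Subadditivity is where compatibility of cuts is consumed. If the coefficients of
  \<open>e\<close> cancel, two cut points are compared through \<open>e\<close>; otherwise the cut
  point of the sum is a weighted mean of the given ones, or a translate of one of them when the
  other coefficient vanishes.\<close>

lemma cut_value_preorder_valuation:
  "preorder_valuation (\<lambda>c (d, w). (c * d, scale c w)) (UNIV \<times> S) cut_value"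
proof -
  define pt where "pt c w = - scale (inverse c) w" for c w
  have pt_closed: "pt c w \<in> S" if "w \<in> S" for c w
    using that by (simp add: pt_def minus_closed scale_closed)
  have scale_pt: "scale c (pt c w) = - w" if "c \<noteq> 0" for c w
    using that by (simp add: pt_def scale_minus_right scale_assoc[symmetric] scale_one)
  have value_simps: "cut_value (0, w) = p w" "0 < c \<Longrightarrow> cut_value (c, w) = fst (f (pt c w))"
    "c < 0 \<Longrightarrow> cut_value (c, w) = snd (f (pt c w))" for c w
    by (auto simp: cut_value_def pt_def)
  have X: "fst (f v) \<subseteq> fst (f w) \<union> p (w - v)" and Y: "snd (f v) \<subseteq> snd (f w) \<union> p (v - w)"
    and D: "p (v - w) \<subseteq> snd (f v) \<union> fst (f w)" if "v \<in> S" "w \<in> S" for v w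
    using f_compat[OF that] by (auto simp: cut_compatible_def)
  have scl: "cut_value (c * d, scale c w) = cut_value (d, w)" if w: "w \<in> S" and c: "0 < c" for c d w
  proof -
    \<comment> \<open>\<open>inverse (c * d) * c = inverse d * inverse c * c\<close>, so the
      cancellation respects the order of the factors.\<close>
    have pt_eq: "pt (c * d) (scale c w) = pt d w" if "d \<noteq> 0"
      using c that
      by (simp add: pt_def nonzero_inverse_mult_distrib scale_assoc[symmetric] mult.assoc)
    consider "d = 0" | "0 < d" | "d < 0" using linorder_less_linear by blast
    then show ?thesis
      using c w by cases (simp_all add: value_simps p_scale pt_eq mult_pos_pos mult_pos_neg)
  qed
  have add: "cut_value (l + m, a + b) \<subseteq> cut_value (l, a) \<union> cut_value (m, b)"
    if ab: "a \<in> S" "b \<in> S" for l m a b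
  proof -
    have pos: "cut_value (l + m, a + b) \<subseteq> cut_value (l, a) \<union> cut_value (m, b)"
      if ab: "a \<in> S" "b \<in> S" and l: "0 < l" and lm: "0 < l + m" for l m a b
    proof -
      have S: "pt l a \<in> S" "pt m b \<in> S" "pt (l + m) (a + b) \<in> S"
        using ab by (simp_all add: pt_closed add_closed)
      show ?thesis
      proof (cases "m = 0")
        case True
        have "scale l (pt l a - pt l (a + b)) = b"
          using l by (simp add: scale_diff_right scale_pt)
        then have "p (pt l a - pt l (a + b)) = p b"
          using p_scale[of "pt l a - pt l (a + b)" l] l ab by (simp add: diff_closed pt_closed add_closed)
        then show ?thesis
          using X[OF S(3,1)] True l by (simp add: value_simps)
      next
        case False
        have "scale (l + m) (pt (l + m) (a + b)) = scale l (pt l a) + scale m (pt m b)"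
          using l lm False by (simp add: scale_pt)
        note * = cut_add_pos[where X = "\<lambda>v. fst (f v)" and Y = "\<lambda>v. snd (f v)" and D = p,
            OF X D p_disjoint p_scale S l lm this]
        show ?thesis
          using * l lm False by (cases "0 < m") (auto simp: value_simps)
      qed
    qed
    have neg: "cut_value (l + m, a + b) \<subseteq> cut_value (l, a) \<union> cut_value (m, b)"
      if ab: "a \<in> S" "b \<in> S" and l: "l < 0" and lm: "l + m < 0" for l m a b
    proof -
      have S: "pt l a \<in> S" "pt m b \<in> S" "pt (l + m) (a + b) \<in> S"
        using ab by (simp_all add: pt_closed add_closed)
      show ?thesis
      proof (cases "m = 0")
        case True
        have "scale (- l) (pt l (a + b) - pt l a) = b"
          using l by (simp add: scale_minus_left scale_diff_right scale_pt)
        then have "p (pt l (a + b) - pt l a) = p b"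
          using p_scale[of "pt l (a + b) - pt l a" "- l"] l ab by (simp add: diff_closed pt_closed add_closed)
        then show ?thesis
          using Y[OF S(3,1)] True l by (simp add: value_simps)
      next
        case False
        have eq: "scale (- l + - m) (pt (l + m) (a + b)) = scale (- l) (pt l a) + scale (- m) (pt m b)"
          using l lm False scale_pt[of "l + m" "a + b"] scale_minus_left[of "l + m"]
          by (simp add: scale_minus_left scale_pt)
        have "- l + - m = - (l + m)" by simp
        then have "0 < - l" "0 < - l + - m" using l lm by (simp_all only: neg_0_less_iff_less)
        \<comment> \<open>Reversing the order exchanges the components of each pair and replaces
          \<open>p x\<close> by \<open>p (- x)\<close>; the primed facts are the premises of
          \<open>cut_add_pos\<close> in that reading.\<close>
        have Y': "snd (f v) \<subseteq> snd (f w) \<union> p (- (w - v))" if "v \<in> S" "w \<in> S" for v w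
          using Y[OF that] by simp
        have D': "p (- (v - w)) \<subseteq> fst (f v) \<union> snd (f w)" if "v \<in> S" "w \<in> S" for v w
          using D[OF that(2,1)] by (simp add: Un_commute)
        have disjoint': "p (- x) \<inter> p (- (- x)) = {}" if "x \<in> S" for x
          using p_disjoint[OF minus_closed[OF that]] .
        have scale': "p (- scale c x) = p (- x)" if "x \<in> S" "0 < c" for c x
          using p_scale[OF minus_closed[OF that(1)] that(2)] by (simp add: scale_minus_right)
        note * = cut_add_pos[where X = "\<lambda>v. snd (f v)" and Y = "\<lambda>v. fst (f v)"
            and D = "\<lambda>x. p (- x)", OF Y' D' disjoint' scale' S \<open>0 < - l\<close> \<open>0 < - l + - m\<close> eq]
        show ?thesis
          using * l lm False by (cases "0 < m") (auto simp: value_simps)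
      qed
    qed
    \<comment> \<open>Here \<open>e\<close> cancels. Up to the positive scalar \<open>l\<close>,
      \<open>a + b\<close> is the difference of the two cut points, and if one point exceeds another
      then it exceeds \<open>e\<close> or \<open>e\<close> exceeds the other.\<close>
    have zero: "cut_value (0, a + b) \<subseteq> cut_value (l, a) \<union> cut_value (- l, b)"
      if ab: "a \<in> S" "b \<in> S" and l: "0 < l" for l a b
    proof -
      have "scale l (pt (- l) b - pt l a) = a + b"
        using l scale_pt[of "- l" b] by (simp add: scale_diff_right scale_pt scale_minus_left)
      then have "p (pt (- l) b - pt l a) = p (a + b)"
        using p_scale[of "pt (- l) b - pt l a" l] l ab by (simp add: diff_closed pt_closed)
      then show ?thesis
        using D[OF pt_closed[OF ab(2), of "- l"] pt_closed[OF ab(1), of l]] l by (auto simp: value_simps)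
    qed
    have "0 < l + m \<Longrightarrow> 0 < l \<or> 0 < m"
      by (meson add_nonpos_nonpos not_le)
    moreover have "l + m < 0 \<Longrightarrow> l < 0 \<or> m < 0"
      by (meson add_nonneg_nonneg not_le)
    moreover have "l + m = 0 \<Longrightarrow> 0 < l \<or> 0 < m \<or> l = 0 \<and> m = 0"
      by (cases l "0 :: 'k" rule: linorder_cases) (auto simp: add_eq_0_iff)
    ultimately consider "0 < l + m" "0 < l" | "0 < l + m" "0 < m" | "l + m < 0" "l < 0"
      | "l + m < 0" "m < 0" | "l + m = 0" "0 < l" | "l + m = 0" "0 < m" | "l = 0" "m = 0"
      by (cases "l + m" "0 :: 'k" rule: linorder_cases) auto
    then show ?thesis
    proof cases
      case 1 then show ?thesis using pos ab by blast
    next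
      case 2 then show ?thesis using pos[OF ab(2,1), of m l] by (simp add: add.commute Un_commute)
    next
      case 3 then show ?thesis using neg ab by blast
    next
      case 4 then show ?thesis using neg[OF ab(2,1), of m l] by (simp add: add.commute Un_commute)
    next
      case 5
      then have "m = - l" by (simp add: eq_neg_iff_add_eq_0 add.commute)
      then show ?thesis using zero[OF ab 5(2)] by simp
    next
      case 6
      then have "l = - m" by (simp add: eq_neg_iff_add_eq_0)
      then show ?thesis using zero[OF ab(2,1) 6(2)] by (simp add: add.commute Un_commute)
    next
      case 7 then show ?thesis using p_add[OF ab] by (simp add: value_simps)
    qed
  qed
  have disjoint: "cut_value (c, w) \<inter> cut_value (- c, - w) = {}" if w: "w \<in> S" for c w
  proof -
    have "pt (- c) (- w) = pt c w" if "c \<noteq> 0"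
      using that by (simp add: pt_def nonzero_inverse_minus_eq scale_minus_left scale_minus_right)
    then show ?thesis
      using f_disjoint[OF pt_closed[OF w]] p_disjoint[OF w]
      by (cases c "0 :: 'k" rule: linorder_cases) (auto simp: value_simps)
  qed
  show ?thesis
  proof
    show "0 \<in> UNIV \<times> S" and "cut_value 0 = {}"
      by (simp_all add: zero_prod_def zero_closed value_simps p_zero)
    show "cut_value (x + y) \<subseteq> cut_value x \<union> cut_value y"
      if "x \<in> UNIV \<times> S" "y \<in> UNIV \<times> S" for x y
      using that add by (cases x; cases y) simp
    show "cut_value x \<inter> cut_value (- x) = {}" if "x \<in> UNIV \<times> S" for x
      using that disjoint by (cases x) simp
  qed (use scl in \<open>auto simp: scale_add_right scale_add_left scale_assoc scale_one
        algebra_simps add_closed scale_closed\<close>)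
qed

end

end

section \<open>Equivalence at a point\<close>

context preorder_valuation
begin

definition equal_at :: "'q \<Rightarrow> 'v \<Rightarrow> 'v \<Rightarrow> bool" where
  "equal_at q x y \<longleftrightarrow> below q x y \<and> below q y x"

lemma equal_at_trans:
  "\<lbrakk>equal_at q x y; equal_at q y z; x \<in> S; y \<in> S; z \<in> S\<rbrakk> \<Longrightarrow> equal_at q x z"
  using below_trans unfolding equal_at_def by blast

lemma equal_at_p: "\<lbrakk>equal_at q x y; x \<in> S; y \<in> S\<rbrakk> \<Longrightarrow> q \<in> p x \<longleftrightarrow> q \<in> p y"
  using p_cong unfolding equal_at_def by blast

lemma equal_at_add:
  assumes "equal_at q x x'" "equal_at q y y'" "x \<in> S" "x' \<in> S" "y \<in> S" "y' \<in> S"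
  shows "equal_at q (x + y) (x' + y')"
proof (rule equal_at_trans)
  show "equal_at q (x + y) (x' + y)" "equal_at q (x' + y) (x' + y')"
    using assms below_add[of q y y' x'] below_add[of q y' y x'] below_add
    by (auto simp: equal_at_def add.commute)
qed (simp_all add: assms add_closed)

lemma equal_at_scale:
  assumes "equal_at q x y" "x \<in> S" "y \<in> S"
  shows "equal_at q (scale c x) (scale c y)"
proof (cases "0 \<le> c")
  case False
  then have "below q (scale (- c) x) (scale (- c) y)" "below q (scale (- c) y) (scale (- c) x)"
    using assms by (auto simp: equal_at_def intro!: below_scale)
  then show ?thesis by (simp add: equal_at_def below_def scale_minus_left)
qed (use assms in \<open>auto simp: equal_at_def intro!: below_scale\<close>)

lemma equal_at_diff:
  assumes "equal_at q x x'" "equal_at q y y'" "x \<in> S" "x' \<in> S" "y \<in> S" "y' \<in> S"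
  shows "equal_at q (x - y) (x' - y')"
  using equal_at_add[OF assms(1) equal_at_scale[OF assms(2), of "-1"]] assms
  by (simp add: scale_minus_left scale_one minus_closed)

end

lemma lattice_valuation_preorder: "lattice_valuation J p \<Longrightarrow> preorder_valuation fv_scale (vl_on J) p"
  by (simp add: lattice_valuation_def)

text \<open>The lattice clauses only compare with \<open>0\<close>, so the claim is translated
  there: \<open>(x \<curlyvee> y) - x\<close> equals \<open>0 \<curlyvee> (y - x)\<close>, whose
  region is that of \<open>y - x\<close>.\<close>

lemma equal_at_sup_inf:
  assumes p: "lattice_valuation J p" and x: "x \<in> vl_on J" and y: "y \<in> vl_on J" and q: "q \<notin> p (y - x)"
  shows "preorder_valuation.equal_at p q (x \<curlyvee> y) x" "preorder_valuation.equal_at p q (x \<curlywedge> y) y"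
proof -
  interpret preorder_valuation fv_scale "vl_on J" p
    by (rule lattice_valuation_preorder[OF p])
  have sup_inf: "p (u \<curlyvee> v) = p u \<union> p v" "p (u \<curlywedge> v) = p u \<inter> p v"
    if "u \<in> vl_on J" "v \<in> vl_on J" for u v
    using p that by (simp_all add: lattice_valuation_def)
  have closed: "y - x \<in> vl_on J" "x - y \<in> vl_on J" using x y diff_closed by auto
  have "(x \<curlyvee> y) - x = 0 \<curlyvee> (y - x)" "y - (x \<curlywedge> y) = (y - x) \<curlyvee> 0"
    using add_sup_distrib_right[of x y "- x"] add_sup_distrib_left[of y "- x" "- y"]
    by (simp_all add: diff_inf_eq_sup)
  moreover have "x - (x \<curlyvee> y) = 0 \<curlywedge> (x - y)" "(x \<curlywedge> y) - y = (x - y) \<curlywedge> 0"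
    using add_inf_distrib_left[of x "- x" "- y"] add_inf_distrib_right[of x y "- y"]
    by (simp_all add: diff_sup_eq_inf)
  ultimately show "equal_at q (x \<curlyvee> y) x" "equal_at q (x \<curlywedge> y) y"
    using q by (simp_all add: equal_at_def below_def sup_inf closed zero_closed p_zero)
qed

text \<open>The pair \<open>(c, w)\<close> stands for \<open>c e + w\<close>. The free object on the
  enlarged set is evaluated in this space, and the cut of \<open>e\<close> at \<open>0\<close>
  supplies the prescribed region \<open>z\<close>.\<close>

lemma add_generator:
  fixes p :: "('k::linordered_division_ring, 'i) free_vl \<Rightarrow> 'q set"
  assumes p: "lattice_valuation J p" and R: "normal_set_ring R"
    and range: "\<And>x. x \<in> vl_on J \<Longrightarrow> p x \<in> R"
    and "countable (UNIV :: 'k set)" "countable J"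
    and e: "e \<notin> J" and z: "z \<in> R"
  shows "\<exists>p'. lattice_valuation (insert e J) p' \<and> (\<forall>x\<in>vl_on (insert e J). p' x \<in> R) \<and>
    (\<forall>x\<in>vl_on J. p' x = p x) \<and> p' (fv_gen e) = z"
proof -
  interpret P: preorder_valuation fv_scale "vl_on J" p
    by (rule lattice_valuation_preorder[OF p])
  obtain f where f: "\<And>v. v \<in> vl_on J \<Longrightarrow> fst (f v) \<in> R \<and> snd (f v) \<in> R \<and> fst (f v) \<inter> snd (f v) = {}"
      "\<And>v w. v \<in> vl_on J \<Longrightarrow> w \<in> vl_on J \<Longrightarrow> P.cut_compatible v (f v) w (f w)" "f 0 = (z, {})"
    using P.cut_exists[OF R range countable_vl_on[OF assms(4,5)] z] by blast
  define p2 where "p2 = P.cut_value f"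
  define scale2 :: "'k \<Rightarrow> 'k \<times> ('k, 'i) free_vl \<Rightarrow> 'k \<times> ('k, 'i) free_vl"
    where "scale2 c = (\<lambda>(d, w). (c * d, c \<star> w))" for c
  have p2_simps: "p2 (0, w) = p w" "w \<in> vl_on J \<Longrightarrow> p2 (c, w) \<in> R" "p2 (1, 0) = z" for c w
    using f range zero_le_one_division_ring[where 'k='k]
    by (auto simp: p2_def P.cut_value_def P.scale_closed P.minus_closed P.scale_zero_right f(3))
  interpret Q: preorder_valuation scale2 "UNIV \<times> vl_on J" p2
    unfolding p2_def scale2_def by (rule P.cut_value_preorder_valuation) (use f in auto)
  \<comment> \<open>The value \<open>0\<close> at all remaining generators merely makes
    \<open>g\<close> total, so that every term can be evaluated.\<close>
  define g :: "'i \<Rightarrow> 'k \<times> ('k, 'i) free_vl" where "g = (\<lambda>i. if i \<in> J then (0, fv_gen i) else if i = e then (1, 0) else 0)"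
  have g: "g i \<in> UNIV \<times> vl_on J" for i
    by (auto simp: g_def zero_prod_def)
  define p' :: "('k, 'i) free_vl \<Rightarrow> 'q set" where "p' = Q.free_value g"
  note free_class = Q.free_value_class[of g, OF g]
  \<comment> \<open>For a term over \<open>J\<close> only equivalence with its class can be
    expected: evaluation selects an argument of each join, whereas the class contains the actual
    join in the free object. Since \<open>p\<close> respects equivalence at \<open>q\<close>, this
    suffices for \<open>p'\<close> to extend \<open>p\<close>.\<close>
  have approx: "fst (Q.term_value g q t) = 0 \<and> snd (Q.term_value g q t) \<in> vl_on J \<and>
      P.equal_at q (snd (Q.term_value g q t)) (fv_class t)" if "gens t \<subseteq> J" for q t
    using that
  proof (induction t)
    case (Join s t)
    let ?s = "snd (Q.term_value g q s)" and ?t = "snd (Q.term_value g q t)"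
    have st: "fv_class s \<in> vl_on J" "fv_class t \<in> vl_on J" "fv_class (Join s t) \<in> vl_on J"
      using Join.prems by (auto simp: vl_on_def)
    have vals: "Q.term_value g q s = (0, ?s)" "Q.term_value g q t = (0, ?t)"
      using Join by (auto simp: prod_eq_iff)
    have eq: "P.equal_at q ?s (fv_class s)" "P.equal_at q ?t (fv_class t)" "?s \<in> vl_on J" "?t \<in> vl_on J"
      using Join by auto
    have diff: "Q.term_value g q s - Q.term_value g q t = (0, ?s - ?t)"
      using vals by (metis diff_Pair diff_zero)
    have "q \<in> p (?s - ?t) \<longleftrightarrow> q \<in> p (fv_class s - fv_class t)"
      by (intro P.equal_at_p P.equal_at_diff P.diff_closed eq st)
    then have select: "q \<in> p (?s - ?t) \<Longrightarrow> P.equal_at q (fv_class s) (fv_class (Join s t))"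
        "q \<notin> p (?s - ?t) \<Longrightarrow> P.equal_at q (fv_class t) (fv_class (Join s t))"
      using equal_at_sup_inf(1)[OF p st(1,2), of q] equal_at_sup_inf(1)[OF p st(2,1), of q]
        P.not_below[OF st(1,2), of q]
      by (auto simp: P.equal_at_def P.below_def fv_class_eval sup.commute)
    show ?case
      using P.equal_at_trans[OF eq(1) select(1) eq(3) st(1,3)]
        P.equal_at_trans[OF eq(2) select(2) eq(4) st(2,3)] Join
      by (simp add: diff p2_simps)
  next
    case (Meet s t)
    let ?s = "snd (Q.term_value g q s)" and ?t = "snd (Q.term_value g q t)"
    have st: "fv_class s \<in> vl_on J" "fv_class t \<in> vl_on J" "fv_class (Meet s t) \<in> vl_on J"
      using Meet.prems by (auto simp: vl_on_def)
    have vals: "Q.term_value g q s = (0, ?s)" "Q.term_value g q t = (0, ?t)"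
      using Meet by (auto simp: prod_eq_iff)
    have eq: "P.equal_at q ?s (fv_class s)" "P.equal_at q ?t (fv_class t)" "?s \<in> vl_on J" "?t \<in> vl_on J"
      using Meet by auto
    have diff: "Q.term_value g q s - Q.term_value g q t = (0, ?s - ?t)"
      using vals by (metis diff_Pair diff_zero)
    have "q \<in> p (?s - ?t) \<longleftrightarrow> q \<in> p (fv_class s - fv_class t)"
      by (intro P.equal_at_p P.equal_at_diff P.diff_closed eq st)
    then have select: "q \<in> p (?s - ?t) \<Longrightarrow> P.equal_at q (fv_class t) (fv_class (Meet s t))"
        "q \<notin> p (?s - ?t) \<Longrightarrow> P.equal_at q (fv_class s) (fv_class (Meet s t))"
      using equal_at_sup_inf(2)[OF p st(1,2), of q] equal_at_sup_inf(2)[OF p st(2,1), of q]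
        P.not_below[OF st(1,2), of q]
      by (auto simp: P.equal_at_def P.below_def fv_class_eval inf.commute)
    show ?case
      using P.equal_at_trans[OF eq(2) select(1) eq(4) st(2,3)]
        P.equal_at_trans[OF eq(1) select(2) eq(3) st(1,3)] Meet
      by (simp add: diff p2_simps)
  next
    case (Add s t)
    have "fv_class s \<in> vl_on J" "fv_class t \<in> vl_on J"
      using Add.prems by (auto simp: vl_on_def)
    with Add show ?case by (simp add: fv_class_eval P.equal_at_add P.add_closed)
  next
    case (Scale c t)
    have "fv_class t \<in> vl_on J"
      using Scale.prems by (auto simp: vl_on_def)
    moreover have "fst (scale2 c x) = c * fst x" "snd (scale2 c x) = c \<star> snd x" for x
      by (simp_all add: scale2_def split_beta)
    ultimately show ?case
      using Scale by (simp add: fv_class_eval P.equal_at_scale P.scale_closed)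
  qed (auto simp: g_def fv_class_eval P.equal_at_def P.below_refl)
  have "p' x = p x" if x: "x \<in> vl_on J" for x
  proof -
    obtain t where t: "x = fv_class t" "gens t \<subseteq> J" using x by (auto simp: vl_on_def)
    have "q \<in> p2 (Q.term_value g q t) \<longleftrightarrow> q \<in> p x" for q
      using approx[OF t(2), of q] P.equal_at_p[of q "snd (Q.term_value g q t)" x] x t(1) p2_simps(1)
      by (metis prod.collapse)
    then show ?thesis by (simp add: p'_def t(1) free_class)
  qed
  \<comment> \<open>The region of a term is built from finitely many cut values by unions and
    intersections.\<close>
  moreover have "p' x \<in> R" for x
    unfolding p'_def using R p2_simps(2)
    by (intro Q.free_value_range g) (auto simp: normal_set_ring_def)
  moreover have "p' (fv_gen e) = z"
    using free_class[of "Gen e"] e by (simp add: p'_def fv_class_eval g_def p2_simps)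
  moreover have "lattice_valuation (insert e J) p'"
    unfolding p'_def by (rule Q.free_value_lattice_valuation) (rule g)
  ultimately show ?thesis by blast
qed

section \<open>Directed unions\<close>

lemma finite_gens: "finite (gens t)"
  by (induction t) auto

lemma directed_finite_subset:
  assumes "finite X" "X \<subseteq> (\<Union>a\<in>A. J a)" "A \<noteq> {}"
    and directed: "\<And>a b. a \<in> A \<Longrightarrow> b \<in> A \<Longrightarrow> \<exists>c\<in>A. J a \<union> J b \<subseteq> J c"
  shows "\<exists>a\<in>A. X \<subseteq> J a"
  using assms(1,2)
proof (induction X)
  case (insert x X)
  then obtain a b where "a \<in> A" "X \<subseteq> J a" "b \<in> A" "x \<in> J b" by auto
  moreover then obtain c where "c \<in> A" "J a \<union> J b \<subseteq> J c" using directed by meson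
  ultimately show ?case by blast
qed (use \<open>A \<noteq> {}\<close> in auto)

text \<open>Every axiom involves at most two elements, these involve finitely many generators, and
  by directedness all of them occur in a single \<open>J a\<close>.\<close>

lemma lattice_valuation_Union:
  fixes p :: "'a \<Rightarrow> ('k::linordered_division_ring, 'i) free_vl \<Rightarrow> 'q set"
  assumes "A \<noteq> {}"
    and directed: "\<And>a b. a \<in> A \<Longrightarrow> b \<in> A \<Longrightarrow> \<exists>c\<in>A. J a \<union> J b \<subseteq> J c"
    and p: "\<And>a. a \<in> A \<Longrightarrow> lattice_valuation (J a) (p a)"
    and agree: "\<And>a b x. \<lbrakk>a \<in> A; b \<in> A; x \<in> vl_on (J a); x \<in> vl_on (J b)\<rbrakk> \<Longrightarrow> p a x = p b x"
  shows "\<exists>P. lattice_valuation (\<Union>a\<in>A. J a) P \<and> (\<forall>a\<in>A. \<forall>x\<in>vl_on (J a). P x = p a x) \<and>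
    (\<forall>x\<in>vl_on (\<Union>a\<in>A. J a) :: ('k, 'i) free_vl set. \<exists>a\<in>A. x \<in> vl_on (J a))"
proof -
  define P where "P x = p (SOME a. a \<in> A \<and> x \<in> vl_on (J a)) x" for x
  have P: "P x = p a x" if "a \<in> A" "x \<in> vl_on (J a)" for a x
  proof -
    have "(SOME a. a \<in> A \<and> x \<in> vl_on (J a)) \<in> A \<and> x \<in> vl_on (J (SOME a. a \<in> A \<and> x \<in> vl_on (J a)))"
      by (rule someI[of _ a]) (use that in simp)
    then show ?thesis unfolding P_def using agree that by blast
  qed
  have cover: "\<exists>a\<in>A. x \<in> vl_on (J a)" if x: "x \<in> vl_on (\<Union>a\<in>A. J a)" for x :: "('k, 'i) free_vl"
  proof -
    obtain t where t: "x = fv_class t" "gens t \<subseteq> (\<Union>a\<in>A. J a)" using x by (auto simp: vl_on_def)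
    then obtain a where "a \<in> A" "gens t \<subseteq> J a"
      using directed_finite_subset[OF finite_gens _ \<open>A \<noteq> {}\<close> directed] by blast
    then show ?thesis by (auto simp: t(1) vl_on_def)
  qed
  have cover2: "\<exists>a\<in>A. x \<in> vl_on (J a) \<and> y \<in> vl_on (J a)"
    if x: "x \<in> vl_on (\<Union>a\<in>A. J a)" and y: "y \<in> vl_on (\<Union>a\<in>A. J a)" for x y :: "('k, 'i) free_vl"
  proof -
    obtain a b where ab: "a \<in> A" "x \<in> vl_on (J a)" "b \<in> A" "y \<in> vl_on (J b)"
      using cover[OF x] cover[OF y] by blast
    then obtain c where "c \<in> A" "J a \<union> J b \<subseteq> J c" using directed by meson
    then show ?thesis using ab vl_on_mono[of "J a" "J c"] vl_on_mono[of "J b" "J c"] by blast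
  qed
  have "preorder_valuation fv_scale (vl_on (\<Union>a\<in>A. J a)) P"
  proof (rule preorder_valuation_fv_scaleI)
    obtain a where a: "a \<in> A" using \<open>A \<noteq> {}\<close> by blast
    then interpret preorder_valuation fv_scale "vl_on (J a)" "p a"
      by (intro lattice_valuation_preorder p)
    show "P 0 = {}" using P[OF a zero_closed] p_zero by simp
  next
    fix x :: "('k, 'i) free_vl" and c assume x: "x \<in> vl_on (\<Union>a\<in>A. J a)" and c: "(0 :: 'k) < c"
    obtain a where a: "a \<in> A" and xa: "x \<in> vl_on (J a)" using cover[OF x] by blast
    interpret preorder_valuation fv_scale "vl_on (J a)" "p a"
      by (intro lattice_valuation_preorder p a)
    show "P (c \<star> x) = P x"
      using P[OF a xa] P[OF a scale_closed[OF xa]] p_scale[OF xa c] by simp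
  next
    fix x y :: "('k, 'i) free_vl" assume "x \<in> vl_on (\<Union>a\<in>A. J a)" "y \<in> vl_on (\<Union>a\<in>A. J a)"
    then obtain a where a: "a \<in> A" and xa: "x \<in> vl_on (J a)" "y \<in> vl_on (J a)"
      using cover2 by blast
    interpret preorder_valuation fv_scale "vl_on (J a)" "p a"
      by (intro lattice_valuation_preorder p a)
    show "P (x + y) \<subseteq> P x \<union> P y"
      using P[OF a xa(1)] P[OF a xa(2)] P[OF a add_closed[OF xa]] p_add[OF xa] by simp
  next
    fix x :: "('k, 'i) free_vl" assume x: "x \<in> vl_on (\<Union>a\<in>A. J a)"
    obtain a where a: "a \<in> A" and xa: "x \<in> vl_on (J a)" using cover[OF x] by blast
    interpret preorder_valuation fv_scale "vl_on (J a)" "p a"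
      by (intro lattice_valuation_preorder p a)
    show "P x \<inter> P (- x) = {}"
      using P[OF a xa] P[OF a minus_closed[OF xa]] p_disjoint[OF xa] by simp
  qed
  moreover have "P (x \<curlyvee> y) = P x \<union> P y \<and> P (x \<curlywedge> y) = P x \<inter> P y"
    if xy: "x \<in> vl_on (\<Union>a\<in>A. J a)" "y \<in> vl_on (\<Union>a\<in>A. J a)" for x y :: "('k, 'i) free_vl"
  proof -
    obtain a where a: "a \<in> A" and xa: "x \<in> vl_on (J a)" "y \<in> vl_on (J a)"
      using cover2 xy by blast
    then show ?thesis
      using P[OF a xa(1)] P[OF a xa(2)] P[OF a vl_on_closed(5)[OF xa]] P[OF a vl_on_closed(6)[OF xa]]
        p[OF a] by (simp add: lattice_valuation_def)
  qed
  ultimately show ?thesis using P cover by (auto simp: lattice_valuation_def)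
qed

lemma add_generators:
  fixes p :: "('k::linordered_division_ring, 'i) free_vl \<Rightarrow> 'q set" and e :: "nat \<Rightarrow> 'i"
  assumes p: "lattice_valuation J p" and R: "normal_set_ring R"
    and range: "\<And>x. x \<in> vl_on J \<Longrightarrow> p x \<in> R"
    and k: "countable (UNIV :: 'k set)" and J: "countable J"
    and e: "inj e" "range e \<inter> J = {}" and z: "\<And>n. z n \<in> R"
  shows "\<exists>p'. lattice_valuation (J \<union> range e) p' \<and> (\<forall>x\<in>vl_on (J \<union> range e). p' x \<in> R) \<and>
    (\<forall>x\<in>vl_on J. p' x = p x) \<and> (\<forall>n. p' (fv_gen (e n)) = z n)"
proof -
  define G where "G n = J \<union> e ` {..<n}" for n
  have G: "G 0 = J" "G (Suc n) = insert (e n) (G n)" "countable (G n)" "e n \<notin> G n" for n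
  proof -
    have "e n \<notin> J" using e(2) by blast
    then show "e n \<notin> G n" using e(1) by (auto simp: G_def inj_def)
  qed (use J in \<open>auto simp: G_def lessThan_Suc\<close>)
  \<comment> \<open>The clause for \<open>n = 0\<close> pins the start of the chosen sequence to
    \<open>p\<close>.\<close>
  have "\<exists>f. \<forall>n. (lattice_valuation (G n) (f n) \<and> (\<forall>x\<in>vl_on (G n). f n x \<in> R) \<and> (n = 0 \<longrightarrow> f n = p)) \<and>
      (\<forall>x\<in>vl_on (G n). f (Suc n) x = f n x) \<and> f (Suc n) (fv_gen (e n)) = z n"
  proof (rule dependent_nat_choice)
    show "\<exists>f. lattice_valuation (G 0) f \<and> (\<forall>x\<in>vl_on (G 0). f x \<in> R) \<and> (0 = 0 \<longrightarrow> f = p)"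
      using p range by (auto simp: G)
  next
    fix f n
    assume "lattice_valuation (G n) f \<and> (\<forall>x\<in>vl_on (G n). f x \<in> R) \<and> (n = 0 \<longrightarrow> f = p)"
    then show "\<exists>f'. (lattice_valuation (G (Suc n)) f' \<and> (\<forall>x\<in>vl_on (G (Suc n)). f' x \<in> R) \<and>
        (Suc n = 0 \<longrightarrow> f' = p)) \<and> (\<forall>x\<in>vl_on (G n). f' x = f x) \<and> f' (fv_gen (e n)) = z n"
      using add_generator[of "G n" f R "e n" "z n"] R k G z by auto
  qed
  then obtain f where f: "\<And>n. lattice_valuation (G n) (f n)" "\<And>n x. x \<in> vl_on (G n) \<Longrightarrow> f n x \<in> R"
    "f 0 = p" "\<And>n x. x \<in> vl_on (G n) \<Longrightarrow> f (Suc n) x = f n x" "\<And>n. f (Suc n) (fv_gen (e n)) = z n"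
    by metis
  have G_mono: "G m \<subseteq> G n" if "m \<le> n" for m n
    using that by (auto simp: G_def)
  have agree: "f n x = f m x" if "m \<le> n" "x \<in> vl_on (G m)" for m n x
    using that
  proof (induction n rule: dec_induct)
    case (step n)
    then have "x \<in> vl_on (G n)" using vl_on_mono[OF G_mono] by blast
    with step f(4) show ?case by simp
  qed simp
  have "\<exists>P. lattice_valuation (\<Union>n\<in>UNIV. G n) P \<and> (\<forall>n\<in>UNIV. \<forall>x\<in>vl_on (G n). P x = f n x) \<and>
      (\<forall>x\<in>vl_on (\<Union>n\<in>UNIV. G n) :: ('k, 'i) free_vl set. \<exists>n\<in>UNIV. x \<in> vl_on (G n))"
  proof (rule lattice_valuation_Union)
    show "\<exists>c\<in>UNIV. G a \<union> G b \<subseteq> G c" for a b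
      using G_mono[of a "max a b"] G_mono[of b "max a b"] by auto
    show "f a x = f b x" if "x \<in> vl_on (G a)" "x \<in> vl_on (G b)" for a b x
      using agree[of a b x] agree[of b a x] that by (cases "a \<le> b") auto
  qed (use f in auto)
  moreover have "(\<Union>n. G n) = J \<union> range e" by (auto simp: G_def)
  ultimately obtain P where P: "lattice_valuation (J \<union> range e) P" "\<And>n x. x \<in> vl_on (G n) \<Longrightarrow> P x = f n x"
      "\<And>x :: ('k, 'i) free_vl. x \<in> vl_on (J \<union> range e) \<Longrightarrow> \<exists>n. x \<in> vl_on (G n)"
    by auto
  moreover have "P (fv_gen (e n)) = z n" for n
    using P(2)[of "fv_gen (e n)" "Suc n"] f(5)[of n] by (simp add: G vl_on_closed)
  moreover have "P x = p x" if "x \<in> vl_on J" for x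
    using P(2)[of x 0] that f(3) by (simp add: G)
  ultimately show ?thesis using f(2) by (intro exI[of _ P]) metis
qed

section \<open>Prime filters\<close>

text \<open>The empty set is admitted: lattices have no top element here, so the preimage of a
  prime filter under a homomorphism may be empty.\<close>

definition prime_filter :: "('a, 'b) gorder_scheme \<Rightarrow> 'a set \<Rightarrow> bool" where
  "prime_filter L Q \<longleftrightarrow> Q \<subseteq> carrier L \<and> \<bottom>\<^bsub>L\<^esub> \<notin> Q \<and>
     (\<forall>x\<in>carrier L. \<forall>y\<in>carrier L. (x \<squnion>\<^bsub>L\<^esub> y \<in> Q \<longleftrightarrow> x \<in> Q \<or> y \<in> Q) \<and>
       (x \<sqinter>\<^bsub>L\<^esub> y \<in> Q \<longleftrightarrow> x \<in> Q \<and> y \<in> Q))"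

definition prime_filters :: "('a, 'b) gorder_scheme \<Rightarrow> 'a \<Rightarrow> 'a set set" where
  "prime_filters L x = {Q. prime_filter L Q \<and> x \<in> Q}"

lemma prime_filters_simps:
  "prime_filters L \<bottom>\<^bsub>L\<^esub> = {}"
  "\<lbrakk>x \<in> carrier L; y \<in> carrier L\<rbrakk> \<Longrightarrow>
    prime_filters L (x \<squnion>\<^bsub>L\<^esub> y) = prime_filters L x \<union> prime_filters L y"
  "\<lbrakk>x \<in> carrier L; y \<in> carrier L\<rbrakk> \<Longrightarrow>
    prime_filters L (x \<sqinter>\<^bsub>L\<^esub> y) = prime_filters L x \<inter> prime_filters L y"
  by (auto simp: prime_filters_def prime_filter_def)

context distributive_zero_lattice
begin

lemma meet_mono:
  "\<lbrakk>x \<sqsubseteq> x'; y \<sqsubseteq> y'; x \<in> carrier L; x' \<in> carrier L; y \<in> carrier L; y' \<in> carrier L\<rbrakk> \<Longrightarrow> x \<sqinter> y \<sqsubseteq> x' \<sqinter> y'"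
  by (meson le_trans meet_closed meet_le meet_left meet_right)

text \<open>A filter that is maximal among those containing \<open>a\<close> and avoiding
  \<open>b\<close> is prime, by distributivity.\<close>

lemma prime_filter_separation:
  assumes a: "a \<in> carrier L" and b: "b \<in> carrier L" and ab: "\<not> a \<sqsubseteq> b"
  shows "\<exists>Q. prime_filter L Q \<and> a \<in> Q \<and> b \<notin> Q"
proof -
  define filters where "filters = {F. F \<subseteq> carrier L \<and> a \<in> F \<and> b \<notin> F \<and>
    (\<forall>x\<in>F. \<forall>y\<in>F. x \<sqinter> y \<in> F) \<and> (\<forall>x\<in>F. \<forall>y\<in>carrier L. x \<sqsubseteq> y \<longrightarrow> y \<in> F)}"
  have up: "a \<sqsubseteq> z" if "a \<sqsubseteq> y" "y \<sqsubseteq> z" "y \<in> carrier L" "z \<in> carrier L" for y z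
    using le_trans[OF that(1,2) a that(3,4)] .
  have principal: "{y \<in> carrier L. a \<sqsubseteq> y} \<in> filters"
    unfolding filters_def mem_Collect_eq
  proof (intro conjI ballI impI)
    show "a \<sqsubseteq> x \<sqinter> y" "x \<sqinter> y \<in> carrier L"
      if "x \<in> {y \<in> carrier L. a \<sqsubseteq> y}" "y \<in> {y \<in> carrier L. a \<sqsubseteq> y}" for x y
      using that a by (simp_all add: meet_le)
    show "a \<sqsubseteq> y" "y \<in> carrier L"
      if "x \<in> {y \<in> carrier L. a \<sqsubseteq> y}" "y \<in> carrier L" "x \<sqsubseteq> y" for x y
      using that up[of x y] by simp_all
  qed (use a ab in simp_all)
  have "\<exists>F\<in>filters. \<forall>G\<in>filters. F \<subseteq> G \<longrightarrow> G = F"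
  proof (rule subset_Zorn_nonempty)
    show "filters \<noteq> {}" using principal by blast
    fix C assume C: "C \<noteq> {}" "subset.chain filters C"
    have "x \<sqinter> y \<in> \<Union>C" if xy: "x \<in> \<Union>C" "y \<in> \<Union>C" for x y
    proof -
      obtain F G where FG: "F \<in> C" "x \<in> F" "G \<in> C" "y \<in> G" using xy by blast
      then have "F \<subseteq> G \<or> G \<subseteq> F" using C(2) by (auto simp: subset.chain_def)
      moreover have "F \<in> filters" "G \<in> filters" using C(2) FG by (auto simp: subset.chain_def)
      then have "\<And>u v. u \<in> F \<Longrightarrow> v \<in> F \<Longrightarrow> u \<sqinter> v \<in> F" "\<And>u v. u \<in> G \<Longrightarrow> v \<in> G \<Longrightarrow> u \<sqinter> v \<in> G"
        by (auto simp: filters_def)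
      ultimately show ?thesis using FG by blast
    qed
    moreover have "C \<subseteq> filters" using C(2) by (auto simp: subset.chain_def)
    then have "F \<subseteq> carrier L \<and> a \<in> F \<and> b \<notin> F \<and> (\<forall>x\<in>F. \<forall>y\<in>carrier L. x \<sqsubseteq> y \<longrightarrow> y \<in> F)"
      if "F \<in> C" for F
      using that by (auto simp: filters_def)
    then have "\<Union>C \<subseteq> carrier L" "a \<in> \<Union>C" "b \<notin> \<Union>C"
        "\<forall>x\<in>\<Union>C. \<forall>y\<in>carrier L. x \<sqsubseteq> y \<longrightarrow> y \<in> \<Union>C"
      using C(1) by blast+
    ultimately show "\<Union>C \<in> filters"
      by (simp add: filters_def)
  qed
  then obtain F where F: "F \<in> filters" and max: "\<And>G. G \<in> filters \<Longrightarrow> F \<subseteq> G \<Longrightarrow> G = F"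
    by blast
  have F_carrier: "F \<subseteq> carrier L" and aF: "a \<in> F" and bF: "b \<notin> F"
    and F_meet: "\<And>x y. x \<in> F \<Longrightarrow> y \<in> F \<Longrightarrow> x \<sqinter> y \<in> F"
    and F_up: "\<And>x y. x \<in> F \<Longrightarrow> y \<in> carrier L \<Longrightarrow> x \<sqsubseteq> y \<Longrightarrow> y \<in> F"
    using F by (auto simp: filters_def)
  have meets_below: "\<exists>f\<in>F. f \<sqinter> x \<sqsubseteq> b" if x: "x \<in> carrier L" "x \<notin> F" for x
  proof (rule ccontr)
    assume none: "\<not> (\<exists>f\<in>F. f \<sqinter> x \<sqsubseteq> b)"
    \<comment> \<open>The filter generated by \<open>F\<close> and \<open>x\<close>; if no meet with
      \<open>x\<close> fell below \<open>b\<close>, it would contradict maximality.\<close>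
    define G where "G = {y \<in> carrier L. \<exists>f\<in>F. f \<sqinter> x \<sqsubseteq> y}"
    have FG: "F \<subseteq> G"
      using F_carrier x(1) by (auto simp: G_def intro!: bexI meet_left)
    have "x \<in> G"
      using F_carrier aF x(1) by (auto simp: G_def intro!: bexI[of _ a] meet_right)
    have "u \<sqinter> v \<in> G" if uv: "u \<in> G" "v \<in> G" for u v
    proof -
      obtain f g where fg: "f \<in> F" "g \<in> F" "f \<sqinter> x \<sqsubseteq> u" "g \<sqinter> x \<sqsubseteq> v" "u \<in> carrier L" "v \<in> carrier L"
        using uv by (auto simp: G_def)
      have closed: "f \<in> carrier L" "g \<in> carrier L" using fg F_carrier by auto
      have "(f \<sqinter> g) \<sqinter> x \<sqsubseteq> f \<sqinter> x" "(f \<sqinter> g) \<sqinter> x \<sqsubseteq> g \<sqinter> x"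
        using closed x(1) by (simp_all add: meet_mono meet_left meet_right)
      then have "(f \<sqinter> g) \<sqinter> x \<sqsubseteq> u \<sqinter> v"
        using fg closed x(1) by (meson le_trans meet_closed meet_le)
      then show ?thesis using fg F_meet by (auto simp: G_def)
    qed
    moreover have "y \<in> G" if uy: "u \<in> G" "y \<in> carrier L" "u \<sqsubseteq> y" for u y
    proof -
      obtain f where "f \<in> F" "f \<sqinter> x \<sqsubseteq> u" "u \<in> carrier L" using uy by (auto simp: G_def)
      moreover then have "f \<sqinter> x \<sqsubseteq> y"
        using uy F_carrier x(1) by (meson le_trans meet_closed subsetD)
      ultimately show ?thesis using uy by (auto simp: G_def)
    qed
    ultimately have "G \<in> filters"
      using FG aF none by (auto simp: filters_def G_def)
    then show False using max FG \<open>x \<in> G\<close> x(2) by blast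
  qed
  have "x \<squnion> y \<in> F \<longleftrightarrow> x \<in> F \<or> y \<in> F" if xy: "x \<in> carrier L" "y \<in> carrier L" for x y
  proof
    assume join: "x \<squnion> y \<in> F"
    show "x \<in> F \<or> y \<in> F"
    proof (rule ccontr)
      assume "\<not> (x \<in> F \<or> y \<in> F)"
      then obtain f g where fg: "f \<in> F" "f \<sqinter> x \<sqsubseteq> b" "g \<in> F" "g \<sqinter> y \<sqsubseteq> b"
        using meets_below xy by meson
      define h where "h = f \<sqinter> g"
      have closed: "f \<in> carrier L" "g \<in> carrier L" "h \<in> carrier L"
        using fg F_carrier by (auto simp: h_def intro!: meet_closed)
      have "h \<sqinter> x \<sqsubseteq> f \<sqinter> x" "h \<sqinter> y \<sqsubseteq> g \<sqinter> y"
        using closed xy by (simp_all add: h_def meet_mono meet_left meet_right)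
      then have "h \<sqinter> x \<sqsubseteq> b" "h \<sqinter> y \<sqsubseteq> b"
        using fg closed xy b by (meson le_trans meet_closed)+
      then have "h \<sqinter> (x \<squnion> y) \<sqsubseteq> b"
        using closed xy b by (simp add: meet_join_distrib join_le)
      moreover have "h \<sqinter> (x \<squnion> y) \<in> F" using fg join F_meet by (simp add: h_def)
      ultimately show False using F_up b bF by blast
    qed
  next
    assume "x \<in> F \<or> y \<in> F"
    then show "x \<squnion> y \<in> F"
      using F_up[of x "x \<squnion> y"] F_up[of y "x \<squnion> y"] join_left[OF xy] join_right[OF xy] join_closed[OF xy]
      by blast
  qed
  moreover have "x \<sqinter> y \<in> F \<longleftrightarrow> x \<in> F \<and> y \<in> F" if xy: "x \<in> carrier L" "y \<in> carrier L" for x y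
    using F_meet F_up[of "x \<sqinter> y" x] F_up[of "x \<sqinter> y" y] meet_left[OF xy] meet_right[OF xy] xy by blast
  moreover have "\<bottom> \<notin> F" using F_up[of \<bottom> b] b bF by auto
  ultimately have "prime_filter L F"
    unfolding prime_filter_def using F_carrier by simp
  then show ?thesis using aF bF by blast
qed

lemma prime_filters_subset_iff:
  assumes "a \<in> carrier L" "b \<in> carrier L"
  shows "prime_filters L a \<subseteq> prime_filters L b \<longleftrightarrow> a \<sqsubseteq> b"
proof
  show "prime_filters L a \<subseteq> prime_filters L b \<Longrightarrow> a \<sqsubseteq> b"
    using prime_filter_separation[OF assms] by (auto simp: prime_filters_def)
next
  assume "a \<sqsubseteq> b"
  then have "a \<squnion> b = b" using le_iff_meet assms by blast
  then show "prime_filters L a \<subseteq> prime_filters L b"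
    using prime_filters_simps(2)[OF assms] by auto
qed

lemma prime_filters_eq_iff:
  assumes "a \<in> carrier L" "b \<in> carrier L"
  shows "prime_filters L a = prime_filters L b \<longleftrightarrow> a = b"
  using prime_filters_subset_iff[OF assms] prime_filters_subset_iff[OF assms(2,1)] assms le_antisym
  by auto

end

lemma normal_set_ring_prime_filters:
  assumes "distributive_zero_lattice L" and cn: "completely_normal L"
  shows "normal_set_ring (prime_filters L ` carrier L)"
  unfolding normal_set_ring_def
proof (intro conjI ballI)
  interpret distributive_zero_lattice L by fact
  show "{} \<in> prime_filters L ` carrier L"
    using prime_filters_simps(1)[of L] by (metis bottom_closed imageI)
next
  interpret distributive_zero_lattice L by fact
  fix A B assume "A \<in> prime_filters L ` carrier L" "B \<in> prime_filters L ` carrier L"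
  then obtain a b where ab: "A = prime_filters L a" "a \<in> carrier L" "B = prime_filters L b" "b \<in> carrier L"
    by auto
  then show "A \<union> B \<in> prime_filters L ` carrier L" "A \<inter> B \<in> prime_filters L ` carrier L"
    by (metis imageI join_closed meet_closed prime_filters_simps(2,3))+
  obtain x y where xy: "x \<in> carrier L" "y \<in> carrier L" "a \<squnion>\<^bsub>L\<^esub> b = a \<squnion>\<^bsub>L\<^esub> y"
      "a \<squnion>\<^bsub>L\<^esub> b = x \<squnion>\<^bsub>L\<^esub> b" "x \<sqinter>\<^bsub>L\<^esub> y = \<bottom>\<^bsub>L\<^esub>"
    using cn ab unfolding completely_normal_def by meson
  have "A \<union> B = A \<union> prime_filters L y"
    using prime_filters_simps(2) ab xy by metis
  moreover have "A \<union> B = prime_filters L x \<union> B"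
    using prime_filters_simps(2) ab xy by metis
  moreover have "prime_filters L x \<inter> prime_filters L y = {}"
    using prime_filters_simps(1,3) xy by metis
  ultimately show "\<exists>X\<in>prime_filters L ` carrier L. \<exists>Y\<in>prime_filters L ` carrier L.
      A \<union> B = A \<union> Y \<and> A \<union> B = X \<union> B \<and> X \<inter> Y = {}"
    using xy(1,2) by blast
qed

text \<open>The values are elements of \<open>L\<close>, so that they can be transported along the
  diagram; the axioms are stated through prime filters, where they hold point by point.\<close>

definition valuation_into ::
    "'a gorder \<Rightarrow> 'i set \<Rightarrow> (('k::linordered_division_ring, 'i) free_vl \<Rightarrow> 'a) \<Rightarrow> bool" where
  "valuation_into L J P \<longleftrightarrow> P \<in> vl_on J \<rightarrow> carrier L \<and> lattice_valuation J (\<lambda>x. prime_filters L (P x))"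

text \<open>The axioms concern one point at a time, so points may be reindexed along any
  \<open>f\<close>. With \<open>f\<close> the identity, this replaces a valuation by one that agrees
  with it on \<open>vl_on J\<close>.\<close>

lemma lattice_valuation_vimage:
  assumes p: "lattice_valuation J p"
    and eq: "\<And>x. x \<in> vl_on J \<Longrightarrow> p' x = {q \<in> D. f q \<in> p x}"
  shows "lattice_valuation J p'"
proof -
  interpret preorder_valuation fv_scale "vl_on J" p
    by (rule lattice_valuation_preorder[OF p])
  have "preorder_valuation fv_scale (vl_on J) p'"
  proof (rule preorder_valuation_fv_scaleI)
    fix x y :: "('b, 'a) free_vl" assume xy: "x \<in> vl_on J" "y \<in> vl_on J"
    show "p' (x + y) \<subseteq> p' x \<union> p' y"
      using p_add[OF xy] by (auto simp: eq xy add_closed)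
  next
    fix x :: "('b, 'a) free_vl" assume x: "x \<in> vl_on J"
    show "p' x \<inter> p' (- x) = {}"
      using p_disjoint[OF x] by (auto simp: eq x minus_closed)
  qed (simp_all add: eq zero_closed p_zero scale_closed p_scale)
  moreover have "p' (x \<curlyvee> y) = p' x \<union> p' y \<and> p' (x \<curlywedge> y) = p' x \<inter> p' y"
    if "x \<in> vl_on J" "y \<in> vl_on J" for x y
    using p that by (auto simp: eq vl_on_closed lattice_valuation_def)
  ultimately show ?thesis by (simp add: lattice_valuation_def)
qed

text \<open>Preimages of prime filters of \<open>M\<close> are prime filters of \<open>L\<close>, so
  the new valuation is the old one reindexed along \<open>?pre\<close>.\<close>

lemma valuation_into_hom:
  assumes P: "valuation_into L J P" and \<phi>: "zero_lattice_hom L M \<phi>"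
    and L: "distributive_zero_lattice L"
  shows "valuation_into M J (\<lambda>x. \<phi> (P x))"
proof -
  interpret L: distributive_zero_lattice L by (rule L)
  let ?pre = "\<lambda>Q. {x \<in> carrier L. \<phi> x \<in> Q}"
  note \<phi>' = \<phi>[unfolded zero_lattice_hom_def join_pres_def meet_pres_def]
  have closed: "\<phi> x \<in> carrier M" if "x \<in> carrier L" for x
    using \<phi>' that by blast
  have pre: "prime_filter L (?pre Q)" if "prime_filter M Q" for Q
    using that \<phi>' closed by (auto simp: prime_filter_def)
  have "prime_filters M (\<phi> (P x)) = {Q \<in> Collect (prime_filter M). ?pre Q \<in> prime_filters L (P x)}"
    if "x \<in> vl_on J" for x
    using pre P that by (auto simp: prime_filters_def valuation_into_def)
  then have "lattice_valuation J (\<lambda>x. prime_filters M (\<phi> (P x)))"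
    using P lattice_valuation_vimage[of J "\<lambda>x. prime_filters L (P x)" "\<lambda>x. prime_filters M (\<phi> (P x))"
      "Collect (prime_filter M)" ?pre] by (auto simp: valuation_into_def)
  then show ?thesis using P closed by (auto simp: valuation_into_def Pi_def)
qed

section \<open>Principal ideals of free vector lattices\<close>

instantiation free_vl :: (linordered_division_ring, type) lattice_ab_group_add_abs
begin

definition "\<bar>x\<bar> = x \<curlyvee> - x" for x :: "('a, 'b) free_vl"

instance
  by standard (simp add: abs_free_vl_def)

end

lemma fv_scale_mono:
  fixes x y :: "('k::linordered_division_ring, 'i) free_vl"
  assumes "0 \<le> c" "x \<le> y"
  shows "c \<star> x \<le> c \<star> y"
proof -
  obtain s t where "x = fv_class s" "y = fv_class t" using fv_class_surj by metis
  with assms show ?thesis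
    by (simp add: fv_class_eval(4)[symmetric] fv_class_le_iff vl_scale_mono)
qed

lemma fv_scale_simps [simp]:
  fixes x :: "('k::linordered_division_ring, 'i) free_vl"
  shows "c \<star> 0 = (0 :: ('k, 'i) free_vl)" "0 \<star> x = 0" "(- c) \<star> x = - (c \<star> x)" "c \<star> (- x) = - (c \<star> x)"
proof -
  show zero: "c \<star> 0 = (0 :: ('k, 'i) free_vl)" "0 \<star> x = 0"
    using fv_scale_laws(1)[of c "0 :: ('k, 'i) free_vl" 0] fv_scale_laws(2)[of 0 0 x] by simp_all
  show "(- c) \<star> x = - (c \<star> x)"
    using fv_scale_laws(2)[of "- c" c x] by (simp add: zero eq_neg_iff_add_eq_0)
  show "c \<star> (- x) = - (c \<star> x)"
    using fv_scale_laws(1)[of c "- x" x] by (simp add: zero eq_neg_iff_add_eq_0)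
qed

lemma fv_scale_mono_left:
  fixes x :: "('k::linordered_division_ring, 'i) free_vl"
  assumes "c \<le> d" "0 \<le> x"
  shows "c \<star> x \<le> d \<star> x"
proof -
  have "0 \<le> (d - c) \<star> x" using fv_scale_mono[of "d - c" 0 x] assms by simp
  then show ?thesis using fv_scale_laws(2)[of "d - c" c x] by (simp add: add_increasing)
qed

lemma fv_abs_scale_le:
  fixes x :: "('k::linordered_division_ring, 'i) free_vl"
  shows "\<bar>c \<star> x\<bar> \<le> \<bar>c\<bar> \<star> \<bar>x\<bar>"
proof (cases "0 \<le> c")
  case True
  then have "c \<star> x \<le> c \<star> \<bar>x\<bar>" "c \<star> - x \<le> c \<star> \<bar>x\<bar>"
    by (intro fv_scale_mono abs_ge_self abs_ge_minus_self; simp)+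
  then show ?thesis using True by (intro abs_leI) simp_all
next
  case False
  then have "(- c) \<star> x \<le> (- c) \<star> \<bar>x\<bar>" "(- c) \<star> - x \<le> (- c) \<star> \<bar>x\<bar>"
    by (intro fv_scale_mono abs_ge_self abs_ge_minus_self; simp)+
  then show ?thesis using False by (intro abs_leI) simp_all
qed

text \<open>Scaling by \<open>c > 0\<close> is an order automorphism, with inverse the scaling by
  \<open>inverse c\<close>; for \<open>c = 0\<close> both bounds are \<open>0\<close>.\<close>

lemma fv_scale_inf:
  fixes x y :: "('k::linordered_division_ring, 'i) free_vl"
  assumes "0 \<le> c" "u \<le> c \<star> x" "u \<le> c \<star> y"
  shows "u \<le> c \<star> (x \<curlywedge> y)"
proof (cases "c = 0")
  case False
  then have c: "0 < c" using assms by simp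
  then have "0 \<le> inverse c" by (intro less_imp_le inverse_pos_division_ring)
  have "inverse c \<star> u \<le> inverse c \<star> c \<star> x" "inverse c \<star> u \<le> inverse c \<star> c \<star> y"
    using assms \<open>0 \<le> inverse c\<close> by (auto intro: fv_scale_mono)
  then have "inverse c \<star> u \<le> x \<curlywedge> y"
    using c by (simp add: fv_scale_laws(3)[symmetric] fv_scale_laws(4))
  then have "c \<star> inverse c \<star> u \<le> c \<star> (x \<curlywedge> y)"
    using assms by (intro fv_scale_mono)
  then show ?thesis using c by (simp add: fv_scale_laws(3)[symmetric] fv_scale_laws(4))
qed (use assms in simp)

lemma carrier_free_vector_lattice: "carrier (free_vector_lattice J) = vl_on J"
  by (simp add: vl_on_def)

lemma free_vector_lattice_ops:
  "vadd (free_vector_lattice J) = (+)" "vzero (free_vector_lattice J) = 0"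
  "vscale (free_vector_lattice J) = (\<star>)" "le (free_vector_lattice J) = (\<le>)"
  by (auto simp: plus_free_vl_def zero_free_vl_def less_eq_free_vl_def fun_eq_iff)

lemma free_vector_lattice_join_meet:
  assumes "x \<in> vl_on J" "y \<in> vl_on J"
  shows "x \<squnion>\<^bsub>free_vector_lattice J\<^esub> y = x \<curlyvee> y" "x \<sqinter>\<^bsub>free_vector_lattice J\<^esub> y = x \<curlywedge> y"
  using assms by (auto simp: vl_on_def free_vl_join_meet fv_class_eval)

lemmas free_vector_lattice_laws =
  carrier_free_vector_lattice free_vector_lattice_ops free_vector_lattice_join_meet

declare free_vector_lattice_simps [simp del]

section \<open>Principal ideals through absolute values\<close>

abbreviation principal ::
    "'i set \<Rightarrow> ('k::linordered_division_ring, 'i) free_vl \<Rightarrow> ('k, 'i) free_vl set" where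
  "principal J a \<equiv> l_ideal_gen (free_vector_lattice J) {a}"

lemma vl_on_minus: "x \<in> vl_on J \<Longrightarrow> - x \<in> vl_on J"
  using vl_on_closed(4)[of x J "-1"] by (simp add: fv_scale_laws)

lemma vl_on_abs: "x \<in> vl_on J \<Longrightarrow> \<bar>x\<bar> \<in> vl_on J"
  by (simp add: abs_free_vl_def vl_on_closed vl_on_minus)

lemma principal_eq:
  fixes a :: "('k::linordered_division_ring, 'i) free_vl"
  assumes a: "a \<in> vl_on J"
  shows "principal J a = {z \<in> vl_on J. \<exists>c\<ge>0. \<bar>z\<bar> \<le> c \<star> \<bar>a\<bar>}" (is "_ = ?B")
proof
  \<comment> \<open>A single domination criterion covers sums, joins, meets and convexity, since
    each of these yields an element bounded by \<open>\<bar>x\<bar> + \<bar>y\<bar>\<close>.\<close>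
  have "z \<in> ?B" if xy: "x \<in> ?B" "y \<in> ?B" and z: "z \<in> vl_on J" "\<bar>z\<bar> \<le> \<bar>x\<bar> + \<bar>y\<bar>" for x y z
  proof -
    obtain c d where cd: "0 \<le> c" "\<bar>x\<bar> \<le> c \<star> \<bar>a\<bar>" "0 \<le> d" "\<bar>y\<bar> \<le> d \<star> \<bar>a\<bar>" using xy by auto
    have "\<bar>z\<bar> \<le> (c + d) \<star> \<bar>a\<bar>"
      using z(2) add_mono[OF cd(2,4)] by (simp add: fv_scale_laws)
    then show ?thesis using z cd by (auto intro!: exI[of _ "c + d"])
  qed
  note sum = this
  have bounds: "\<bar>x\<bar> \<le> \<bar>x\<bar> + \<bar>y\<bar>" "\<bar>y\<bar> \<le> \<bar>x\<bar> + \<bar>y\<bar>" for x y :: "('k, 'i) free_vl"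
    by simp_all
  have convex: "\<bar>z\<bar> \<le> \<bar>x\<bar> + \<bar>y\<bar>" if "x \<le> z" "z \<le> y" for x y z :: "('k, 'i) free_vl"
  proof (rule abs_leI)
    show "z \<le> \<bar>x\<bar> + \<bar>y\<bar>"
      using that(2) abs_ge_self[of y] bounds(2)[of y x] by (meson order_trans)
    have "- z \<le> - x" using that(1) by simp
    then show "- z \<le> \<bar>x\<bar> + \<bar>y\<bar>"
      using abs_ge_minus_self[of x] bounds(1)[of x y] by (meson order_trans)
  qed
  have "l_ideal (free_vector_lattice J) ?B"
    unfolding l_ideal_def
  proof (intro conjI ballI allI impI)
    show "?B \<subseteq> carrier (free_vector_lattice J)" by (auto simp: free_vector_lattice_laws)
    show "vzero (free_vector_lattice J) \<in> ?B"
      by (auto simp: free_vector_lattice_laws vl_on_closed intro!: exI[of _ 0])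
  next
    fix x y assume xy: "x \<in> ?B" "y \<in> ?B"
    show "x \<boxplus>\<^bsub>free_vector_lattice J\<^esub> y \<in> ?B"
      using xy by (intro sum[OF xy]) (auto simp: free_vector_lattice_laws vl_on_closed abs_triangle_ineq)
    show "x \<squnion>\<^bsub>free_vector_lattice J\<^esub> y \<in> ?B"
    proof (rule sum[OF xy])
      have "x \<curlyvee> y \<le> \<bar>x\<bar> + \<bar>y\<bar>"
        using abs_ge_self[of x] abs_ge_self[of y] bounds(1)[of x y] bounds(2)[of y x] by (meson le_supI order_trans)
      moreover have "- (x \<curlyvee> y) \<le> \<bar>x\<bar> + \<bar>y\<bar>"
        using abs_ge_minus_self[of x] bounds(1)[of x y]
        unfolding neg_sup_eq_inf by (meson inf.coboundedI1 order_trans)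
      ultimately show "\<bar>x \<squnion>\<^bsub>free_vector_lattice J\<^esub> y\<bar> \<le> \<bar>x\<bar> + \<bar>y\<bar>"
        using xy by (simp add: free_vector_lattice_laws abs_leI)
    qed (use xy in \<open>auto simp: free_vector_lattice_laws vl_on_closed\<close>)
    show "x \<sqinter>\<^bsub>free_vector_lattice J\<^esub> y \<in> ?B"
    proof (rule sum[OF xy])
      have "- (x \<curlywedge> y) \<le> \<bar>x\<bar> + \<bar>y\<bar>"
        using abs_ge_minus_self[of x] abs_ge_minus_self[of y] bounds(1)[of x y] bounds(2)[of y x]
        unfolding neg_inf_eq_sup by (meson le_supI order_trans)
      moreover have "x \<curlywedge> y \<le> \<bar>x\<bar> + \<bar>y\<bar>"
        using abs_ge_self[of x] bounds(1)[of x y] bounds(2)[of y x] by (meson inf.coboundedI1 order_trans)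
      ultimately show "\<bar>x \<sqinter>\<^bsub>free_vector_lattice J\<^esub> y\<bar> \<le> \<bar>x\<bar> + \<bar>y\<bar>"
        using xy by (simp add: free_vector_lattice_laws abs_leI)
    qed (use xy in \<open>auto simp: free_vector_lattice_laws vl_on_closed\<close>)
    fix z assume "z \<in> carrier (free_vector_lattice J)"
      "x \<sqsubseteq>\<^bsub>free_vector_lattice J\<^esub> z \<and> z \<sqsubseteq>\<^bsub>free_vector_lattice J\<^esub> y"
    then show "z \<in> ?B"
      by (intro sum[OF xy]) (auto simp: free_vector_lattice_laws intro: convex)
  next
    fix k x assume x: "x \<in> ?B"
    then obtain c where c: "0 \<le> c" "\<bar>x\<bar> \<le> c \<star> \<bar>a\<bar>" by auto
    have "\<bar>k \<star> x\<bar> \<le> \<bar>k\<bar> \<star> \<bar>x\<bar>" by (rule fv_abs_scale_le)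
    also have "\<dots> \<le> \<bar>k\<bar> \<star> c \<star> \<bar>a\<bar>" using c by (intro fv_scale_mono) simp_all
    also have "\<dots> = (\<bar>k\<bar> * c) \<star> \<bar>a\<bar>" by (simp add: fv_scale_laws)
    finally show "k \<boxdot>\<^bsub>free_vector_lattice J\<^esub> x \<in> ?B"
      using c x by (auto simp: free_vector_lattice_laws vl_on_closed intro!: exI[of _ "\<bar>k\<bar> * c"])
  qed
  moreover have "a \<in> ?B"
    using a zero_le_one_division_ring[where 'k='k]
    by (auto simp: fv_scale_laws intro!: exI[of _ 1])
  ultimately show "principal J a \<subseteq> ?B" by (intro l_ideal_gen_least) auto
  show "?B \<subseteq> principal J a"
  proof
    fix z assume "z \<in> ?B"
    then obtain c where z: "z \<in> vl_on J" "\<bar>z\<bar> \<le> c \<star> \<bar>a\<bar>" by auto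
    have A: "l_ideal (free_vector_lattice J) (principal J a)"
      using a by (intro l_ideal_gen_l_ideal free_vector_lattice_left_vector_lattice)
        (auto simp: free_vector_lattice_laws)
    note closed = A[unfolded l_ideal_def free_vector_lattice_ops carrier_free_vector_lattice]
    have "a \<in> principal J a" using l_ideal_gen_superset[of "{a}"] by auto
    then have "(-1) \<star> a \<in> principal J a" using closed by blast
    then have "a \<squnion>\<^bsub>free_vector_lattice J\<^esub> (-1) \<star> a \<in> principal J a"
      using \<open>a \<in> principal J a\<close> closed by blast
    then have "\<bar>a\<bar> \<in> principal J a"
      using a by (simp add: free_vector_lattice_laws fv_scale_laws abs_free_vl_def vl_on_minus)
    then have "c \<star> \<bar>a\<bar> \<in> principal J a" "(- c) \<star> \<bar>a\<bar> \<in> principal J a" using closed by blast+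
    moreover have "(- c) \<star> \<bar>a\<bar> \<le> z" "z \<le> c \<star> \<bar>a\<bar>"
      using z(2) abs_ge_self[of z] abs_ge_minus_self[of z] by (auto intro: order_trans simp: minus_le_iff)
    ultimately show "z \<in> principal J a" using closed z(1) by blast
  qed
qed

lemma principal_subset_iff:
  assumes "a \<in> vl_on J" "b \<in> vl_on J"
  shows "principal J a \<subseteq> principal J b \<longleftrightarrow> (\<exists>c\<ge>0. \<bar>a\<bar> \<le> c \<star> \<bar>b\<bar>)"
proof -
  have "principal J a \<subseteq> principal J b \<longleftrightarrow> a \<in> principal J b"
  proof
    show "a \<in> principal J b" if "principal J a \<subseteq> principal J b"
      using that l_ideal_gen_superset[of "{a}" "free_vector_lattice J"] by auto
    have "l_ideal (free_vector_lattice J) (principal J b)"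
      using assms by (intro l_ideal_gen_l_ideal free_vector_lattice_left_vector_lattice)
        (auto simp: free_vector_lattice_laws)
    then show "principal J a \<subseteq> principal J b" if "a \<in> principal J b"
      using that by (intro l_ideal_gen_least) auto
  qed
  then show ?thesis using assms by (simp add: principal_eq)
qed

lemma principal_abs:
  fixes a :: "('k::linordered_division_ring, 'i) free_vl"
  assumes "a \<in> vl_on J"
  shows "principal J \<bar>a\<bar> = principal J a"
  using assms by (simp add: principal_eq vl_on_abs)

section \<open>The lattice of principal ideals\<close>

lemma Id_c_simps:
  "carrier (Id_c (free_vector_lattice J)) = principal J ` vl_on J"
  "le (Id_c (free_vector_lattice J)) = (\<subseteq>)" "eq (Id_c (free_vector_lattice J)) = (=)"
  by (simp_all add: Id_c_def free_vector_lattice_laws)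

lemma partial_order_Id_c: "partial_order (Id_c (free_vector_lattice J))"
  by unfold_locales (auto simp: Id_c_simps)

lemma least_Upper_pairI:
  assumes "x \<in> carrier D" "y \<in> carrier D" "s \<in> carrier D" "x \<sqsubseteq>\<^bsub>D\<^esub> s" "y \<sqsubseteq>\<^bsub>D\<^esub> s"
    and "\<And>z. \<lbrakk>z \<in> carrier D; x \<sqsubseteq>\<^bsub>D\<^esub> z; y \<sqsubseteq>\<^bsub>D\<^esub> z\<rbrakk> \<Longrightarrow> s \<sqsubseteq>\<^bsub>D\<^esub> z"
  shows "least D s (Upper D {x, y})"
  using assms by (auto simp: least_def Upper_def)

lemma greatest_Lower_pairI:
  assumes "x \<in> carrier D" "y \<in> carrier D" "s \<in> carrier D" "s \<sqsubseteq>\<^bsub>D\<^esub> x" "s \<sqsubseteq>\<^bsub>D\<^esub> y"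
    and "\<And>z. \<lbrakk>z \<in> carrier D; z \<sqsubseteq>\<^bsub>D\<^esub> x; z \<sqsubseteq>\<^bsub>D\<^esub> y\<rbrakk> \<Longrightarrow> z \<sqsubseteq>\<^bsub>D\<^esub> s"
  shows "greatest D s (Lower D {x, y})"
  using assms by (auto simp: greatest_def Lower_def)

lemma Id_c_lub:
  fixes a b :: "('k::linordered_division_ring, 'i) free_vl"
  assumes ab: "a \<in> vl_on J" "b \<in> vl_on J"
  shows "least (Id_c (free_vector_lattice J)) (principal J (\<bar>a\<bar> \<curlyvee> \<bar>b\<bar>))
    (Upper (Id_c (free_vector_lattice J)) {principal J a, principal J b})"
proof -
  let ?s = "\<bar>a\<bar> \<curlyvee> \<bar>b\<bar>"
  have s: "?s \<in> vl_on J" "\<bar>?s\<bar> = ?s"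
    using ab by (auto simp: vl_on_closed vl_on_abs intro!: abs_of_nonneg le_supI1)
  have "principal J a \<subseteq> principal J ?s" "principal J b \<subseteq> principal J ?s"
    using ab s zero_le_one_division_ring[where 'k='k]
    by (auto simp: principal_subset_iff fv_scale_laws intro!: exI[of _ 1])
  moreover have "principal J ?s \<subseteq> principal J u"
    if u: "u \<in> vl_on J" "principal J a \<subseteq> principal J u" "principal J b \<subseteq> principal J u" for u
  proof -
    obtain c d where cd: "0 \<le> c" "\<bar>a\<bar> \<le> c \<star> \<bar>u\<bar>" "0 \<le> d" "\<bar>b\<bar> \<le> d \<star> \<bar>u\<bar>"
      using u ab by (auto simp: principal_subset_iff)
    \<comment> \<open>The two bounds come with different scalars; \<open>c + d\<close> serves for
      both because absolute values are nonnegative.\<close>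
    have "c \<star> \<bar>u\<bar> \<le> (c + d) \<star> \<bar>u\<bar>" "d \<star> \<bar>u\<bar> \<le> (c + d) \<star> \<bar>u\<bar>"
      using cd by (auto intro!: fv_scale_mono_left)
    then have "?s \<le> (c + d) \<star> \<bar>u\<bar>" using cd by (meson le_supI order_trans)
    then show ?thesis
      using s u cd by (auto simp: principal_subset_iff intro!: exI[of _ "c + d"])
  qed
  ultimately show ?thesis
    by (intro least_Upper_pairI) (use ab s(1) in \<open>auto simp only: Id_c_simps\<close>)
qed

lemma Id_c_glb:
  fixes a b :: "('k::linordered_division_ring, 'i) free_vl"
  assumes ab: "a \<in> vl_on J" "b \<in> vl_on J"
  shows "greatest (Id_c (free_vector_lattice J)) (principal J (\<bar>a\<bar> \<curlywedge> \<bar>b\<bar>))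
    (Lower (Id_c (free_vector_lattice J)) {principal J a, principal J b})"
proof -
  let ?s = "\<bar>a\<bar> \<curlywedge> \<bar>b\<bar>"
  have s: "?s \<in> vl_on J" "\<bar>?s\<bar> = ?s"
    using ab by (auto simp: vl_on_closed vl_on_abs intro!: abs_of_nonneg le_infI)
  have "principal J ?s \<subseteq> principal J a" "principal J ?s \<subseteq> principal J b"
    using ab s zero_le_one_division_ring[where 'k='k]
    by (auto simp: principal_subset_iff fv_scale_laws intro!: exI[of _ 1])
  moreover have "principal J u \<subseteq> principal J ?s"
    if u: "u \<in> vl_on J" "principal J u \<subseteq> principal J a" "principal J u \<subseteq> principal J b" for u
  proof -
    obtain c d where cd: "0 \<le> c" "\<bar>u\<bar> \<le> c \<star> \<bar>a\<bar>" "0 \<le> d" "\<bar>u\<bar> \<le> d \<star> \<bar>b\<bar>"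
      using u ab by (auto simp: principal_subset_iff)
    have "c \<star> \<bar>a\<bar> \<le> (c + d) \<star> \<bar>a\<bar>" "d \<star> \<bar>b\<bar> \<le> (c + d) \<star> \<bar>b\<bar>"
      using cd by (auto intro!: fv_scale_mono_left)
    then have "\<bar>u\<bar> \<le> (c + d) \<star> ?s" using cd by (intro fv_scale_inf) (auto intro: order_trans)
    then show ?thesis
      using s u cd by (auto simp: principal_subset_iff intro!: exI[of _ "c + d"])
  qed
  ultimately show ?thesis
    by (intro greatest_Lower_pairI) (use ab s(1) in \<open>auto simp only: Id_c_simps\<close>)
qed

lemma Id_c_join_meet:
  fixes a b :: "('k::linordered_division_ring, 'i) free_vl"
  assumes ab: "a \<in> vl_on J" "b \<in> vl_on J"
  shows "principal J a \<squnion>\<^bsub>Id_c (free_vector_lattice J)\<^esub> principal J b = principal J (\<bar>a\<bar> \<curlyvee> \<bar>b\<bar>)"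
    and "principal J a \<sqinter>\<^bsub>Id_c (free_vector_lattice J)\<^esub> principal J b = principal J (\<bar>a\<bar> \<curlywedge> \<bar>b\<bar>)"
proof -
  interpret partial_order "Id_c (free_vector_lattice J) :: ('k, 'i) free_vl set gorder"
    by (rule partial_order_Id_c)
  show "principal J a \<squnion>\<^bsub>Id_c (free_vector_lattice J)\<^esub> principal J b = principal J (\<bar>a\<bar> \<curlyvee> \<bar>b\<bar>)"
    unfolding join_def sup_def
    by (rule some_equality) (use Id_c_lub[OF ab] least_unique in blast)+
  show "principal J a \<sqinter>\<^bsub>Id_c (free_vector_lattice J)\<^esub> principal J b = principal J (\<bar>a\<bar> \<curlywedge> \<bar>b\<bar>)"
    unfolding meet_def inf_def
    by (rule some_equality) (use Id_c_glb[OF ab] greatest_unique in blast)+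
qed

lemma lattice_Id_c:
  "Lattice.lattice (Id_c (free_vector_lattice J) :: ('k::linordered_division_ring, 'i) free_vl set gorder)"
  (is "Lattice.lattice ?D")
proof -
  interpret partial_order ?D by (rule partial_order_Id_c)
  show ?thesis
  proof unfold_locales
    fix x y assume "x \<in> carrier ?D" "y \<in> carrier ?D"
    then obtain a b where "x = principal J a" "a \<in> vl_on J" "y = principal J b" "b \<in> vl_on J"
      by (auto simp: Id_c_simps)
    then show "\<exists>s. least ?D s (Upper ?D {x, y})" "\<exists>s. greatest ?D s (Lower ?D {x, y})"
      using Id_c_lub Id_c_glb by metis+
  qed
qed

lemma Id_c_bottom:
  "\<bottom>\<^bsub>Id_c (free_vector_lattice J)\<^esub> = principal J (0 :: ('k::linordered_division_ring, 'i) free_vl)"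
proof -
  let ?D = "Id_c (free_vector_lattice J) :: ('k, 'i) free_vl set gorder"
  interpret partial_order ?D by (rule partial_order_Id_c)
  have least: "least ?D (principal J 0) (carrier ?D)"
    by (auto simp: least_def Id_c_simps vl_on_closed principal_subset_iff intro!: exI[of _ 0])
  then show ?thesis
    unfolding bottom_def by (rule some_equality) (use least least_unique in blast)
qed

section \<open>Valuations and homomorphisms\<close>

text \<open>Since \<open>z \<curlyvee> 0 = z + (0 \<curlyvee> - z)\<close>, adding one common
  \<open>k\<close> to \<open>x\<close> and to \<open>y\<close> dominates both positive parts, and
  translation by \<open>k\<close> commutes with the meet. The identity makes positive parts respect
  meets in \<open>valuation_of_hom\<close>.\<close>

lemma sup_zero_inf_distrib:
  fixes x y :: "'v::lattice_ab_group_add"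
  shows "(x \<curlywedge> y) \<curlyvee> 0 = (x \<curlyvee> 0) \<curlywedge> (y \<curlyvee> 0)"
proof (rule order_antisym)
  define k where "k = 0 \<curlyvee> - (x \<curlywedge> y)"
  have shift: "z + (0 \<curlyvee> - z) = z \<curlyvee> 0" for z :: 'v
    by (simp add: add_sup_distrib_left)
  have bound: "z \<curlyvee> 0 \<le> z + k" if "x \<curlywedge> y \<le> z" for z
  proof -
    have "z \<curlyvee> 0 = z + (0 \<curlyvee> - z)" by (rule shift[symmetric])
    also have "\<dots> \<le> z + k"
      using that unfolding k_def by (intro add_left_mono sup.mono order_refl) (simp only: neg_le_iff_le)
    finally show ?thesis .
  qed
  have "(x \<curlyvee> 0) \<curlywedge> (y \<curlyvee> 0) \<le> (x + k) \<curlywedge> (y + k)"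
    by (intro inf_mono bound) simp_all
  also have "\<dots> = (x \<curlywedge> y) + k"
    by (simp only: add_inf_distrib_right)
  also have "\<dots> = (x \<curlywedge> y) \<curlyvee> 0"
    unfolding k_def by (rule shift)
  finally show "(x \<curlyvee> 0) \<curlywedge> (y \<curlyvee> 0) \<le> (x \<curlywedge> y) \<curlyvee> 0" .
qed (auto intro: le_infI1 le_infI2)

lemma pos_part_disjoint:
  fixes x :: "'v::lattice_ab_group_add"
  shows "(x \<curlyvee> 0) \<curlywedge> (- x \<curlyvee> 0) = 0"
proof -
  have "- x \<curlyvee> 0 = (x \<curlyvee> 0) - x"
    using add_sup_distrib_right[of x 0 "- x"] by (simp add: sup.commute)
  then have "(x \<curlyvee> 0) \<curlywedge> (- x \<curlyvee> 0) = (x \<curlyvee> 0) + (0 \<curlywedge> - x)"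
    by (simp add: add_inf_distrib_left)
  also have "0 \<curlywedge> - x = - (x \<curlyvee> 0)"
    by (simp add: neg_sup_eq_inf inf.commute)
  finally show ?thesis by (simp only: add.right_inverse)
qed

text \<open>The ideal of \<open>x\<close> records where \<open>x\<close> is nonzero; that of the
  positive part keeps only where \<open>x > 0\<close>.\<close>

lemma valuation_of_hom:
  fixes \<chi> :: "('k::linordered_division_ring, 'i) free_vl set \<Rightarrow> 'a"
  assumes L: "distributive_zero_lattice L"
    and \<chi>: "zero_lattice_hom (Id_c (free_vector_lattice J)) L \<chi>"
  shows "valuation_into L J (\<lambda>x. \<chi> (principal J (x \<curlyvee> 0)))"
proof -
  interpret L: distributive_zero_lattice L by (rule L)
  let ?D = "Id_c (free_vector_lattice J) :: ('k, 'i) free_vl set gorder"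
  note \<chi>' = \<chi>[unfolded zero_lattice_hom_def]
  define Z where "Z x = prime_filters L (\<chi> (principal J x))" for x
  have closed: "\<chi> (principal J x) \<in> carrier L" if "x \<in> vl_on J" for x
    using \<chi>' that by (auto simp: Id_c_simps)
  have isotone: "isotone ?D L \<chi>"
    using \<chi>' by (intro join_pres_isotone) auto
  have mono: "Z x \<subseteq> Z y" if "x \<in> vl_on J" "y \<in> vl_on J" "0 \<le> c" "\<bar>x\<bar> \<le> c \<star> \<bar>y\<bar>" for x y c
  proof -
    have "principal J x \<subseteq> principal J y" using that principal_subset_iff by blast
    then have "\<chi> (principal J x) \<sqsubseteq>\<^bsub>L\<^esub> \<chi> (principal J y)"
      using isotone that(1,2) by (simp add: isotone_def Id_c_simps)
    then show ?thesis
      using L.prime_filters_subset_iff closed that(1,2) by (simp add: Z_def)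
  qed
  have join_meet: "Z (\<bar>x\<bar> \<curlyvee> \<bar>y\<bar>) = Z x \<union> Z y" "Z (\<bar>x\<bar> \<curlywedge> \<bar>y\<bar>) = Z x \<inter> Z y"
    if "x \<in> vl_on J" "y \<in> vl_on J" for x y
    using \<chi>' that closed
    by (simp_all add: Z_def Id_c_join_meet[symmetric] prime_filters_simps join_pres_def meet_pres_def Id_c_simps)
  have Z_zero: "Z 0 = {}"
    using \<chi>' by (simp add: Z_def Id_c_bottom prime_filters_simps)
  define p where "p x = Z (x \<curlyvee> 0)" for x
  have pos: "x \<curlyvee> 0 \<in> vl_on J" "\<bar>x \<curlyvee> 0\<bar> = x \<curlyvee> 0" if "x \<in> vl_on J" for x :: "('k, 'i) free_vl"
    using that by (auto simp: vl_on_closed)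
  have p_scale: "p (c \<star> x) \<subseteq> p x" if "x \<in> vl_on J" "0 < c" for x c
    unfolding p_def
  proof (rule mono)
    have "c \<star> x \<le> c \<star> (x \<curlyvee> 0)" "0 \<le> c \<star> (x \<curlyvee> 0)"
      using that fv_scale_mono[of c x "x \<curlyvee> 0"] fv_scale_mono[of c 0 "x \<curlyvee> 0"] by auto
    then show "\<bar>c \<star> x \<curlyvee> 0\<bar> \<le> c \<star> \<bar>x \<curlyvee> 0\<bar>"
      using pos that vl_on_closed(4) by auto
  qed (use that in \<open>auto simp: pos vl_on_closed\<close>)
  have "preorder_valuation fv_scale (vl_on J) p"
  proof (rule preorder_valuation_fv_scaleI)
    show "p 0 = {}" by (simp add: p_def Z_zero)
  next
    fix x :: "('k, 'i) free_vl" and c :: 'k assume x: "x \<in> vl_on J" "0 < c"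
    have "p (inverse c \<star> c \<star> x) \<subseteq> p (c \<star> x)"
      using x by (intro p_scale vl_on_closed inverse_pos_division_ring)
    also have "inverse c \<star> c \<star> x = x"
      using x by (simp add: fv_scale_laws(3)[symmetric] fv_scale_laws(4))
    finally show "p (c \<star> x) = p x" using p_scale[OF x] by blast
  next
    fix x y :: "('k, 'i) free_vl" assume xy: "x \<in> vl_on J" "y \<in> vl_on J"
    let ?u = "x \<curlyvee> 0" and ?v = "y \<curlyvee> 0"
    have "Z ((x + y) \<curlyvee> 0) \<subseteq> Z (\<bar>?u\<bar> \<curlyvee> \<bar>?v\<bar>)"
    \<comment> \<open>The sum of two positive parts is at most twice their join.\<close>
    proof (rule mono[where c = "1 + 1"])
      have "x + y \<le> ?u + ?v" by (intro add_mono) simp_all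
      moreover have "0 \<le> ?u + ?v" by (intro add_nonneg_nonneg) simp_all
      ultimately have "(x + y) \<curlyvee> 0 \<le> ?u + ?v" by simp
      also have "\<dots> \<le> (?u \<curlyvee> ?v) + (?u \<curlyvee> ?v)" by (intro add_mono) simp_all
      also have "\<dots> = (1 + 1) \<star> (?u \<curlyvee> ?v)" by (simp only: fv_scale_laws(2,4))
      also have "?u \<curlyvee> ?v = \<bar>\<bar>?u\<bar> \<curlyvee> \<bar>?v\<bar>\<bar>"
        using xy pos(2) by (metis abs_of_nonneg le_supI1 sup_ge2)
      finally show "\<bar>(x + y) \<curlyvee> 0\<bar> \<le> (1 + 1) \<star> \<bar>\<bar>?u\<bar> \<curlyvee> \<bar>?v\<bar>\<bar>" by simp
      show "0 \<le> 1 + (1 :: 'k)"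
        by (intro add_nonneg_nonneg zero_le_one_division_ring)
    qed (use xy in \<open>auto intro!: vl_on_closed vl_on_abs\<close>)
    then show "p (x + y) \<subseteq> p x \<union> p y"
      using join_meet(1)[OF pos(1) pos(1)] xy by (simp add: p_def)
  next
    fix x :: "('k, 'i) free_vl" assume x: "x \<in> vl_on J"
    show "p x \<inter> p (- x) = {}"
      using join_meet(2)[OF pos(1) pos(1), of x "- x"] x
      by (simp add: p_def vl_on_minus pos pos_part_disjoint Z_zero)
  qed
  moreover have "p (x \<curlyvee> y) = p x \<union> p y \<and> p (x \<curlywedge> y) = p x \<inter> p y"
    if xy: "x \<in> vl_on J" "y \<in> vl_on J" for x y
  proof -
    have "(x \<curlyvee> y) \<curlyvee> 0 = (x \<curlyvee> 0) \<curlyvee> (y \<curlyvee> 0)" by (simp add: sup.assoc sup.left_commute)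
    then show ?thesis
      using join_meet[OF pos(1) pos(1), of x y] xy
      by (simp only: p_def pos sup_zero_inf_distrib simp_thms)
  qed
  ultimately have "lattice_valuation J p" by (simp add: lattice_valuation_def)
  then show ?thesis
    using closed pos(1) by (simp add: valuation_into_def p_def[abs_def] Z_def)
qed

text \<open>The element \<open>a\<close> is nonzero where \<open>\<bar>a\<bar>\<close> is positive.
  This depends on the ideal alone: a bound
  \<open>\<bar>a\<bar> \<le> c \<star> \<bar>b\<bar>\<close> places the region of
  \<open>\<bar>a\<bar>\<close> inside that of \<open>\<bar>b\<bar>\<close>. Identities in
  \<open>L\<close> are checked on prime filters, which separate its elements.\<close>

lemma hom_of_valuation:
  fixes P :: "('k::linordered_division_ring, 'i) free_vl \<Rightarrow> 'a"
  assumes L: "distributive_zero_lattice L" and P: "valuation_into L J P"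
  shows "\<exists>\<chi>. zero_lattice_hom (Id_c (free_vector_lattice J)) L \<chi> \<and>
    (\<forall>a\<in>vl_on J. \<chi> (principal J a) = P \<bar>a\<bar>)"
proof -
  interpret L: distributive_zero_lattice L by (rule L)
  let ?D = "Id_c (free_vector_lattice J) :: ('k, 'i) free_vl set gorder"
  define p where "p x = prime_filters L (P x)" for x
  have lattice: "lattice_valuation J p"
    using P by (simp add: p_def[abs_def] valuation_into_def)
  interpret V: preorder_valuation fv_scale "vl_on J" p
    by (rule lattice_valuation_preorder[OF lattice])
  have sup_inf: "p (x \<curlyvee> y) = p x \<union> p y" "p (x \<curlywedge> y) = p x \<inter> p y"
    if "x \<in> vl_on J" "y \<in> vl_on J" for x y
    using lattice that by (simp_all add: lattice_valuation_def)
  have closed: "P x \<in> carrier L" if "x \<in> vl_on J" for x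
    using P that by (auto simp: valuation_into_def)
  have P_eq: "P x = l" if "x \<in> vl_on J" "l \<in> carrier L" "p x = prime_filters L l" for x l
    using that L.prime_filters_eq_iff closed by (simp add: p_def)
  have ideal_mono: "p \<bar>a\<bar> \<subseteq> p \<bar>b\<bar>"
    if ab: "a \<in> vl_on J" "b \<in> vl_on J" "principal J a \<subseteq> principal J b" for a b
  proof -
    obtain c where c: "0 \<le> c" "\<bar>a\<bar> \<le> c \<star> \<bar>b\<bar>" using principal_subset_iff ab by blast
    have "p \<bar>a\<bar> \<union> p (c \<star> \<bar>b\<bar>) = p (c \<star> \<bar>b\<bar>)"
      using sup_inf(1)[of "\<bar>a\<bar>" "c \<star> \<bar>b\<bar>"] c ab
      by (simp add: vl_on_abs vl_on_closed sup.absorb2)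
    also have "\<dots> \<subseteq> p \<bar>b\<bar>"
      using c V.p_scale[of "\<bar>b\<bar>" c] ab by (cases "c = 0") (auto simp: V.p_zero vl_on_abs)
    finally show ?thesis by blast
  qed
  define \<chi> where "\<chi> A = P \<bar>SOME a. a \<in> vl_on J \<and> principal J a = A\<bar>" for A
  have \<chi>: "\<chi> (principal J a) = P \<bar>a\<bar>" if a: "a \<in> vl_on J" for a
  proof -
    define b where "b = (SOME b. b \<in> vl_on J \<and> principal J b = principal J a)"
    have b: "b \<in> vl_on J \<and> principal J b = principal J a"
      unfolding b_def by (rule someI[of _ a]) (use a in simp)
    then have "p \<bar>b\<bar> = p \<bar>a\<bar>" using ideal_mono a by (metis order_antisym order_refl)
    then have "P \<bar>b\<bar> = P \<bar>a\<bar>" using P_eq[of "\<bar>b\<bar>" "P \<bar>a\<bar>"] closed a b by (simp add: p_def vl_on_abs)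
    then show ?thesis by (simp add: \<chi>_def b_def)
  qed
  have abs_abs: "\<bar>\<bar>a\<bar> \<curlyvee> \<bar>b\<bar>\<bar> = \<bar>a\<bar> \<curlyvee> \<bar>b\<bar>" "\<bar>\<bar>a\<bar> \<curlywedge> \<bar>b\<bar>\<bar> = \<bar>a\<bar> \<curlywedge> \<bar>b\<bar>"
    for a b :: "('k, 'i) free_vl"
    by (auto intro!: abs_of_nonneg le_supI1 le_infI)
  have L_lattice: "Lattice.lattice L" ..
  have "zero_lattice_hom ?D L \<chi>"
    unfolding zero_lattice_hom_def join_pres_def meet_pres_def
  proof (intro conjI ballI lattice_Id_c L_lattice)
    show "\<chi> \<in> carrier ?D \<rightarrow> carrier L"
      using closed by (auto simp: Id_c_simps \<chi> vl_on_abs)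
    have "P \<bar>0\<bar> = \<bottom>\<^bsub>L\<^esub>"
      by (rule P_eq) (simp_all add: vl_on_closed V.p_zero prime_filters_simps)
    then show "\<chi> \<bottom>\<^bsub>?D\<^esub> = \<bottom>\<^bsub>L\<^esub>"
      by (simp add: Id_c_bottom \<chi> vl_on_closed)
  next
    fix A B assume "A \<in> carrier ?D" "B \<in> carrier ?D"
    then obtain a b where AB: "A = principal J a" "B = principal J b" and ab: "a \<in> vl_on J" "b \<in> vl_on J"
      by (auto simp: Id_c_simps)
    have "P (\<bar>a\<bar> \<curlyvee> \<bar>b\<bar>) = P \<bar>a\<bar> \<squnion>\<^bsub>L\<^esub> P \<bar>b\<bar>"
      using ab closed by (intro P_eq) (simp_all add: sup_inf vl_on_abs vl_on_closed prime_filters_simps p_def[symmetric])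
    then show "\<chi> (A \<squnion>\<^bsub>?D\<^esub> B) = \<chi> A \<squnion>\<^bsub>L\<^esub> \<chi> B"
      using ab by (simp add: AB Id_c_join_meet \<chi> vl_on_abs vl_on_closed abs_abs)
    have "P (\<bar>a\<bar> \<curlywedge> \<bar>b\<bar>) = P \<bar>a\<bar> \<sqinter>\<^bsub>L\<^esub> P \<bar>b\<bar>"
      using ab closed by (intro P_eq) (simp_all add: sup_inf vl_on_abs vl_on_closed prime_filters_simps p_def[symmetric])
    then show "\<chi> (A \<sqinter>\<^bsub>?D\<^esub> B) = \<chi> A \<sqinter>\<^bsub>L\<^esub> \<chi> B"
      using ab by (simp add: AB Id_c_join_meet \<chi> vl_on_abs vl_on_closed abs_abs)
  qed
  then show ?thesis using \<chi> by blast
qed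

text \<open>Both free objects share one type, so by uniqueness in the universal property the
  canonical map between them is the identity on elements.\<close>

lemma eta_principal:
  fixes a :: "('k::linordered_division_ring, 'i) free_vl"
  assumes IJ: "I \<subseteq> J" and a: "a \<in> vl_on I"
  shows "eta I J (principal I a) = principal J a"
proof -
  let ?F = "free_vector_lattice :: 'i set \<Rightarrow> ('k, ('k, 'i) free_vl) vector_lattice"
  have "vector_lattice_hom (?F I) (?F J) (\<lambda>x. x)"
    unfolding vector_lattice_hom_def join_pres_def meet_pres_def
    using vl_on_mono[OF IJ] by (auto simp: free_vector_lattice_laws free_vl_lattice subset_iff)
  moreover have "fv_gen \<in> I \<rightarrow> carrier (?F J)"
    using IJ by (auto simp: free_vector_lattice_laws vl_on_closed)
  ultimately have "free_vl_incl I J a = a"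
    unfolding free_vl_incl_def
    using a free_vector_lattice_universal(3)[OF free_vector_lattice_left_vector_lattice, of fv_gen I J "\<lambda>x. x" a]
    by (simp add: free_vector_lattice_laws)
  then show ?thesis
    unfolding eta_def
    using Id_c_map_principal[OF free_vector_lattice_left_vector_lattice
        free_vector_lattice_left_vector_lattice free_vl_incl_hom(1)[OF IJ], of a] a
    by (simp add: free_vector_lattice_laws)
qed

text \<open>Infinitely many fresh generators leave one for each term of an enumeration of
  \<open>L\<close>, and the region where a fresh generator is positive can be prescribed.\<close>

lemma extend_valuation_onto:
  fixes P :: "('k::linordered_division_ring, 'i) free_vl \<Rightarrow> 'a"
  assumes L: "distributive_zero_lattice L" "completely_normal L" "countable (carrier L)"
    and P: "valuation_into L J P" and k: "countable (UNIV :: 'k set)"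
    and K: "countable K" "J \<subseteq> K" "infinite (K - J)"
  shows "\<exists>P'. valuation_into L K P' \<and> (\<forall>x\<in>vl_on J. P' x = P x) \<and>
    carrier L \<subseteq> (\<lambda>e. P' (fv_gen e)) ` K"
proof -
  interpret L: distributive_zero_lattice L by (rule L)
  let ?R = "prime_filters L ` carrier L"
  have nonempty: "carrier L \<noteq> {}" using L.bottom_closed by blast
  define e where "e = from_nat_into (K - J)"
  have e: "bij_betw e UNIV (K - J)"
    unfolding e_def using K countable_subset[of "K - J" K] by (intro bij_betw_from_nat_into) auto
  then have "inj e" "range e = K - J" by (auto simp: bij_betw_def)
  \<comment> \<open>Repetitions, as for a finite \<open>L\<close>, do no harm: only surjectivity of
    the enumeration matters.\<close>
  define z where "z n = from_nat_into (carrier L) n" for n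
  have z: "z n \<in> carrier L" for n
    unfolding z_def using nonempty by (rule from_nat_into)
  have "\<exists>p'. lattice_valuation (J \<union> range e) p' \<and> (\<forall>x\<in>vl_on (J \<union> range e). p' x \<in> ?R) \<and>
      (\<forall>x\<in>vl_on J. p' x = prime_filters L (P x)) \<and> (\<forall>n. p' (fv_gen (e n)) = prime_filters L (z n))"
  proof (rule add_generators[OF _ normal_set_ring_prime_filters[OF L(1,2)] _ k])
    show "lattice_valuation J (\<lambda>x. prime_filters L (P x))" "\<And>x. x \<in> vl_on J \<Longrightarrow> prime_filters L (P x) \<in> ?R"
      using P by (auto simp: valuation_into_def)
    show "countable J" using K countable_subset by blast
  qed (use z \<open>inj e\<close> \<open>range e = K - J\<close> in auto)
  moreover have "J \<union> range e = K" using \<open>range e = K - J\<close> K by blast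
  ultimately obtain p' where p': "lattice_valuation K p'" "\<And>x. x \<in> vl_on K \<Longrightarrow> p' x \<in> ?R"
    "\<And>x. x \<in> vl_on J \<Longrightarrow> p' x = prime_filters L (P x)" "\<And>n. p' (fv_gen (e n)) = prime_filters L (z n)"
    by metis
  \<comment> \<open>The regions are images of elements of \<open>L\<close>, and injectivity of
    \<open>prime_filters\<close> makes those elements unique; hence \<open>P'\<close> restricts to
    \<open>P\<close>.\<close>
  define P' where "P' x = inv_into (carrier L) (prime_filters L) (p' x)" for x
  have inj: "inj_on (prime_filters L) (carrier L)"
    using L.prime_filters_eq_iff by (auto simp: inj_on_def)
  have P'_closed: "P' x \<in> carrier L" and P'_filters: "prime_filters L (P' x) = p' x" if "x \<in> vl_on K" for x
    using p'(2)[OF that] by (simp_all add: P'_def inv_into_into f_inv_into_f)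
  have P'_eq: "P' x = l" if "l \<in> carrier L" "p' x = prime_filters L l" for x l
    using that inj by (simp add: P'_def)
  have "valuation_into L K P'"
    using P'_closed lattice_valuation_vimage[OF p'(1), of "\<lambda>x. prime_filters L (P' x)" UNIV "\<lambda>q. q"]
    by (auto simp: valuation_into_def P'_filters)
  moreover have "P' x = P x" if "x \<in> vl_on J" for x
    using P that p'(3) by (intro P'_eq) (auto simp: valuation_into_def)
  moreover have "carrier L \<subseteq> (\<lambda>e. P' (fv_gen e)) ` K"
  proof
    fix l assume l: "l \<in> carrier L"
    then obtain n where "z n = l"
      unfolding z_def using from_nat_into_surj[OF L(3)] by blast
    then have "P' (fv_gen (e n)) = l" using P'_eq[OF l] p'(4) by simp
    moreover have "e n \<in> K" using \<open>range e = K - J\<close> by blast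
    ultimately show "l \<in> (\<lambda>e. P' (fv_gen e)) ` K" by blast
  qed
  ultimately show ?thesis by blast
qed

section \<open>Recursion over the tree\<close>

lemma rooted_tree_linear:
  fixes s s' t :: "'t::rooted_tree"
  assumes "s \<le> t" "s' \<le> t"
  shows "s \<le> s' \<or> s' \<le> s"
proof -
  have "total_on {..t} {(x, y). x \<le> y \<and> y \<le> t}"
    using down_set_well_ordered[of t] by (simp add: well_order_on_def linear_order_on_def)
  then show ?thesis using assms by (cases "s = s'") (auto simp: total_on_def)
qed

text \<open>An element minimal in the part of \<open>A\<close> below some \<open>t\<close> in
  \<open>A\<close> is minimal in \<open>A\<close>, since anything smaller also lies below
  \<open>t\<close>.\<close>

lemma wf_rooted_tree: "wf {(x, y :: 't::rooted_tree). x < y}"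
  unfolding wf_eq_minimal
proof (intro allI impI)
  fix A :: "'t set" and t assume "t \<in> A"
  have "wf ({(x, y). x \<le> y \<and> y \<le> t} - Id)"
    using down_set_well_ordered[of t] by (simp add: well_order_on_def)
  then obtain z where z: "z \<in> A \<inter> {..t}"
      "\<And>y. (y, z) \<in> {(x, y). x \<le> y \<and> y \<le> t} - Id \<Longrightarrow> y \<notin> A \<inter> {..t}"
    using \<open>t \<in> A\<close> by (elim wfE_min[of _ t "A \<inter> {..t}"]) auto
  then have "y \<notin> A" if "y < z" for y
  proof -
    have "y \<le> z" "y \<noteq> z" using that by (auto intro: less_imp_le)
    moreover then have "y \<le> t" using z(1) by (meson IntD2 atMost_iff order_trans)
    ultimately show ?thesis using z(1) z(2)[of y] by auto
  qed
  then show "\<exists>z\<in>A. \<forall>y. (y, z) \<in> {(x, y). x < y} \<longrightarrow> y \<notin> A"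
    using z(1) by blast
qed

theorem theorem7p3:
  fixes L :: "'t::rooted_tree \<Rightarrow> 'a gorder"
    and \<phi> :: "'t \<Rightarrow> 't \<Rightarrow> 'a \<Rightarrow> 'a"
    and I :: "'t \<Rightarrow> ('t \<times> nat) set"
    and \<chi>_bot :: "('k::linordered_division_ring, 't \<times> nat) free_vl set \<Rightarrow> 'a"
  assumes countable_scalars: "countable (UNIV :: 'k set)"
    and countable_height: "\<And>t :: 't. countable {..<t}"
    and L_lattice: "\<And>t. distributive_zero_lattice (L t)"
    and \<phi>_hom: "\<And>s t. s \<le> t \<Longrightarrow> zero_lattice_hom (L s) (L t) (\<phi> s t)"
    and \<phi>_id: "\<And>s x. x \<in> carrier (L s) \<Longrightarrow> \<phi> s s x = x"
    and \<phi>_comp: "\<And>s t u x. s \<le> t \<Longrightarrow> t \<le> u \<Longrightarrow> x \<in> carrier (L s) \<Longrightarrow> \<phi> s u x = \<phi> t u (\<phi> s t x)"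
    and L_countable: "\<And>t. t \<noteq> bot \<Longrightarrow> countable (carrier (L t))"
    and L_normal: "\<And>t. t \<noteq> bot \<Longrightarrow> completely_normal (L t)"
    and I_bot: "I bot \<subseteq> {bot} \<times> UNIV"
    and I_nonbot: "\<And>t. t \<noteq> bot \<Longrightarrow> I t = {..t} \<times> UNIV"
    and \<chi>_bot_hom: "zero_lattice_hom (Id_c (free_vector_lattice (I bot))) (L bot) \<chi>_bot"
  shows "\<exists>\<chi> :: 't \<Rightarrow> ('k, 't \<times> nat) free_vl set \<Rightarrow> 'a.
      (\<forall>A \<in> carrier (Id_c (free_vector_lattice (I bot))). \<chi> bot A = \<chi>_bot A) \<and>
      (\<forall>t. zero_lattice_hom (Id_c (free_vector_lattice (I t))) (L t) (\<chi> t)) \<and>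
      (\<forall>s t. s \<le> t \<longrightarrow> (\<forall>A \<in> carrier (Id_c (free_vector_lattice (I s))).
          \<chi> t (eta (I s) (I t) A) = \<phi> s t (\<chi> s A))) \<and>
      (\<forall>t. t \<noteq> bot \<longrightarrow> \<chi> t ` carrier (Id_c (free_vector_lattice (I t))) = carrier (L t))"
proof -
  have I_subset: "I t \<subseteq> {..t} \<times> UNIV" for t
    using I_bot I_nonbot by (cases "t = bot") auto
  have I_mono: "I s \<subseteq> I t" if "s \<le> t" for s t
  proof (cases "t = bot")
    case True
    then show ?thesis using that by (simp add: bot_unique)
  next
    case False
    have "{..s} \<times> (UNIV :: nat set) \<subseteq> {..t} \<times> UNIV" using that by auto
    then show ?thesis using I_subset[of s] I_nonbot[OF False] by blast
  qed
  have "{..t} = insert t {..<t}" for t :: 't by (auto simp: order.order_iff_strict)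
  then have "countable ({..t} \<times> (UNIV :: nat set))" for t :: 't
    using countable_height[of t] by simp
  then have I_countable: "countable (I t)" for t
    using I_subset[of t] countable_subset by blast
  define P0 where "P0 x = \<chi>_bot (principal (I bot) (x \<curlyvee> 0))" for x
  \<comment> \<open>Surjectivity is demanded already on generators. The choice at \<open>t\<close>
    depends on \<open>f\<close> only at the predecessors of \<open>t\<close>, as the recursion
    requires.\<close>
  define good where "good f t P \<longleftrightarrow> valuation_into (L t) (I t) P \<and>
    (\<forall>s<t. \<forall>x\<in>vl_on (I s). P x = \<phi> s t (f s x)) \<and> (t = bot \<longrightarrow> P = P0) \<and>
    (t \<noteq> bot \<longrightarrow> carrier (L t) \<subseteq> (\<lambda>e. P (fv_gen e)) ` I t)"
    for f and t :: 't and P :: "('k, 't \<times> nat) free_vl \<Rightarrow> 'a"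
  have "\<exists>f. \<forall>t. good f t (f t)"
  proof (rule dependent_wf_choice[OF wf_rooted_tree])
    show "good f t P = good g t P" if "\<And>s. (s, t) \<in> {(x, y). x < y} \<Longrightarrow> f s = g s" for f g t P
      using that by (simp add: good_def)
  next
    fix t :: 't and f assume "\<And>s. (s, t) \<in> {(x, y). x < y} \<Longrightarrow> good f s (f s)"
    then have f: "good f s (f s)" if "s < t" for s using that by blast
    show "\<exists>P. good f t P"
    proof (cases "t = bot")
      case True
      have "valuation_into (L bot) (I bot) P0"
        unfolding P0_def[abs_def] by (rule valuation_of_hom[OF L_lattice \<chi>_bot_hom])
      then show ?thesis using True by (auto simp: good_def)
    next
      case False
      \<comment> \<open>The predecessors of \<open>t\<close> form a chain, so this union is
        directed, and successor and limit nodes are treated alike.\<close>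
      let ?J = "\<Union>s\<in>{..<t}. I s"
      have into: "valuation_into (L t) (I s) (\<lambda>x. \<phi> s t (f s x))" if "s < t" for s
        using f[OF that] that by (intro valuation_into_hom[OF _ \<phi>_hom L_lattice]) (auto simp: good_def)
      \<comment> \<open>Different predecessors induce the same value in \<open>L t\<close>, by
        functoriality of the diagram.\<close>
      have agree: "\<phi> s t (f s x) = \<phi> s' t (f s' x)"
        if s: "s \<le> s'" "s' < t" and x: "x \<in> vl_on (I s)" for s s' x
      proof (cases "s = s'")
        case False
        then have "s < s'" "s < t" using s by auto
        then have "f s' x = \<phi> s s' (f s x)" "f s x \<in> carrier (L s)"
          using f[OF s(2)] f[of s] x by (auto simp: good_def valuation_into_def)
        then show ?thesis
          using \<phi>_comp[OF s(1) less_imp_le[OF s(2)], of "f s x"] by simp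
      qed simp
      have "\<exists>p. lattice_valuation ?J p \<and>
          (\<forall>s\<in>{..<t}. \<forall>x\<in>vl_on (I s). p x = prime_filters (L t) (\<phi> s t (f s x))) \<and>
          (\<forall>x\<in>vl_on ?J :: ('k, 't \<times> nat) free_vl set. \<exists>s\<in>{..<t}. x \<in> vl_on (I s))"
      proof (rule lattice_valuation_Union)
        show "{..<t} \<noteq> {}" using False bot.not_eq_extremum by blast
        show "\<exists>c\<in>{..<t}. I a \<union> I b \<subseteq> I c" if "a \<in> {..<t}" "b \<in> {..<t}" for a b
        proof -
          have "a \<le> b \<or> b \<le> a" using rooted_tree_linear[of a t b] that by (simp add: less_imp_le)
          then have "I a \<union> I b \<subseteq> I b \<or> I a \<union> I b \<subseteq> I a" using I_mono by blast
          then show ?thesis using that by blast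
        qed
        show "lattice_valuation (I s) (\<lambda>x. prime_filters (L t) (\<phi> s t (f s x)))" if "s \<in> {..<t}" for s
          using into[of s] that unfolding valuation_into_def by blast
        show "prime_filters (L t) (\<phi> a t (f a x)) = prime_filters (L t) (\<phi> b t (f b x))"
          if "a \<in> {..<t}" "b \<in> {..<t}" "x \<in> vl_on (I a)" "x \<in> vl_on (I b)" for a b x
        proof -
          have "a \<le> b \<or> b \<le> a" using rooted_tree_linear[of a t b] that by (simp add: less_imp_le)
          then have "\<phi> a t (f a x) = \<phi> b t (f b x)"
            using agree[of a b x] agree[of b a x, symmetric] that by blast
          then show ?thesis by simp
        qed
      qed
      then obtain p where p1: "lattice_valuation ?J p"
        and p2: "\<forall>s\<in>{..<t}. \<forall>x\<in>vl_on (I s). p x = prime_filters (L t) (\<phi> s t (f s x))"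
        and p3: "\<forall>x\<in>vl_on ?J :: ('k, 't \<times> nat) free_vl set. \<exists>s\<in>{..<t}. x \<in> vl_on (I s)"
        by blast
      have p: "p x = prime_filters (L t) (\<phi> s t (f s x))" if "s < t" "x \<in> vl_on (I s)" for s x
        using p2 that by blast
      interpret L: distributive_zero_lattice "L t" by (rule L_lattice)
      define P where "P x = inv_into (carrier (L t)) (prime_filters (L t)) (p x)" for x
      have inj: "inj_on (prime_filters (L t)) (carrier (L t))"
        using L.prime_filters_eq_iff by (auto simp: inj_on_def)
      have P: "P x = \<phi> s t (f s x)" "\<phi> s t (f s x) \<in> carrier (L t)" if "s < t" "x \<in> vl_on (I s)" for s x
      proof -
        show *: "\<phi> s t (f s x) \<in> carrier (L t)"
          using into[OF that(1)] that(2) by (auto simp: valuation_into_def)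
        show "P x = \<phi> s t (f s x)"
          using inv_into_f_f[OF inj *] by (simp add: P_def p[OF that])
      qed
      have "P x \<in> carrier (L t) \<and> prime_filters (L t) (P x) = p x" if x: "x \<in> vl_on ?J" for x
      proof -
        obtain s where "s < t" "x \<in> vl_on (I s)" using p3 x by blast
        then show ?thesis using P p by simp
      qed
      then have "valuation_into (L t) ?J P"
        using lattice_valuation_vimage[OF p1, of "\<lambda>x. prime_filters (L t) (P x)" UNIV "\<lambda>q. q"]
        by (auto simp: valuation_into_def)
      moreover have "countable ?J"
        using countable_height I_countable by blast
      moreover have "?J \<subseteq> I t" using I_mono less_imp_le by blast
      moreover have "infinite (I t - ?J)"
      proof -
        \<comment> \<open>The generators with first component \<open>t\<close> are fresh, because
          those of a predecessor \<open>s\<close> have first component at most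
          \<open>s\<close>.\<close>
        have "t \<notin> {..s}" if "s < t" for s using that by auto
        then have "{t} \<times> UNIV \<subseteq> I t - ?J"
          using I_nonbot[OF False] I_subset by blast
        moreover have "infinite ({t} \<times> (UNIV :: nat set))"
          by (simp add: finite_cartesian_product_iff)
        ultimately show ?thesis using finite_subset by blast
      qed
      ultimately obtain P' where P': "valuation_into (L t) (I t) P'" "\<forall>x\<in>vl_on ?J. P' x = P x"
        "carrier (L t) \<subseteq> (\<lambda>e. P' (fv_gen e)) ` I t"
        using extend_valuation_onto[OF L_lattice L_normal[OF False] L_countable[OF False], of ?J P "I t"]
          countable_scalars I_countable by blast
      have "P' x = \<phi> s t (f s x)" if "s < t" "x \<in> vl_on (I s)" for s x
      proof -
        have "x \<in> vl_on ?J" using that vl_on_mono[of "I s" ?J] by blast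
        then show ?thesis using P' P[OF that] by simp
      qed
      then show ?thesis using P' False by (auto simp: good_def)
    qed
  qed
  then obtain f where f: "\<And>t. good f t (f t)" by blast
  then have into: "valuation_into (L t) (I t) (f t)" for t by (simp add: good_def)
  have "\<exists>c. zero_lattice_hom (Id_c (free_vector_lattice (I t))) (L t) c \<and>
      (\<forall>a\<in>vl_on (I t). c (principal (I t) a) = f t \<bar>a\<bar>) \<and> (t = bot \<longrightarrow> c = \<chi>_bot)" for t
  proof (cases "t = bot")
    case True
    \<comment> \<open>\<open>P0\<close> is defined through positive parts, but
      \<open>\<bar>a\<bar>\<close> is its own positive part and generates the same ideal as
      \<open>a\<close>. So \<open>\<chi>_bot\<close> itself can be used at
      \<open>bot\<close>.\<close>
    have "\<chi>_bot (principal (I bot) a) = f bot \<bar>a\<bar>" if "a \<in> vl_on (I bot)" for a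
      using f[of bot] that by (simp add: good_def P0_def principal_abs sup.absorb1)
    then show ?thesis using True \<chi>_bot_hom by auto
  qed (use hom_of_valuation[OF L_lattice into] in blast)
  then obtain \<chi> where \<chi>: "\<And>t. zero_lattice_hom (Id_c (free_vector_lattice (I t))) (L t) (\<chi> t)"
    "\<And>t a. a \<in> vl_on (I t) \<Longrightarrow> \<chi> t (principal (I t) a) = f t \<bar>a\<bar>" "\<chi> bot = \<chi>_bot"
    by metis
  have comp: "f t x = \<phi> s t (f s x)" if "s \<le> t" "x \<in> vl_on (I s)" for s t x
  proof (cases "s = t")
    case True
    then have "f t x \<in> carrier (L t)"
      using into[of t] that by (auto simp: valuation_into_def Pi_iff)
    then show ?thesis using \<phi>_id True by simp
  next
    case False
    then show ?thesis using f[of t] that by (simp add: good_def)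
  qed
  have "\<chi> t (eta (I s) (I t) A) = \<phi> s t (\<chi> s A)"
    if st: "s \<le> t" and "A \<in> carrier (Id_c (free_vector_lattice (I s)))" for s t A
  proof -
    obtain a where A: "A = principal (I s) a" and a: "a \<in> vl_on (I s)"
      using \<open>A \<in> _\<close> by (auto simp: Id_c_simps)
    have "a \<in> vl_on (I t)" using a vl_on_mono[OF I_mono[OF st]] by blast
    then show ?thesis
      using a st by (simp add: A eta_principal I_mono \<chi>(2) comp vl_on_abs)
  qed
  moreover have "\<chi> t ` carrier (Id_c (free_vector_lattice (I t))) = carrier (L t)" if nonbot: "t \<noteq> bot" for t
  proof
    show "\<chi> t ` carrier (Id_c (free_vector_lattice (I t))) \<subseteq> carrier (L t)"
      using \<chi>(1)[of t] by (auto simp: zero_lattice_hom_def)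
    show "carrier (L t) \<subseteq> \<chi> t ` carrier (Id_c (free_vector_lattice (I t)))"
    proof
      fix l assume l: "l \<in> carrier (L t)"
      then obtain e where e: "e \<in> I t" "f t (fv_gen e) = l"
        using f[of t] nonbot by (auto simp: good_def)
      let ?g = "fv_gen e :: ('k, 't \<times> nat) free_vl"
      interpret L: distributive_zero_lattice "L t" by (rule L_lattice)
      interpret V: preorder_valuation fv_scale "vl_on (I t)" "\<lambda>x. prime_filters (L t) (f t x)"
        using into[of t] by (simp add: valuation_into_def lattice_valuation_def)
      have g: "?g \<in> vl_on (I t)" "?g \<curlyvee> 0 \<in> vl_on (I t)"
        using e by (auto simp: vl_on_closed)
      \<comment> \<open>\<open>\<chi> t\<close> evaluates \<open>f t\<close> at absolute values,
        whereas \<open>l\<close> is attained at the generator itself. The positive part bridges the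
        gap: it has the same region as the generator and is its own absolute value.\<close>
      have "prime_filters (L t) (f t (?g \<curlyvee> 0)) = prime_filters (L t) (f t ?g)"
        using into[of t] g V.p_zero V.zero_closed by (simp add: valuation_into_def lattice_valuation_def)
      moreover have "f t (?g \<curlyvee> 0) \<in> carrier (L t)" "f t ?g \<in> carrier (L t)"
        using into[of t] g unfolding valuation_into_def by blast+
      ultimately have "f t (?g \<curlyvee> 0) = l"
        using e(2) L.prime_filters_eq_iff by simp
      then have "\<chi> t (principal (I t) (?g \<curlyvee> 0)) = l"
        using \<chi>(2)[OF g(2)] by simp
      then show "l \<in> \<chi> t ` carrier (Id_c (free_vector_lattice (I t)))"
        using g by (auto simp: Id_c_simps)
    qed
  qed
  ultimately show ?thesis using \<chi>(1,3) by (intro exI[of _ \<chi>]) blast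
qed

end
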